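(* Let $N\ge 3$, $\ell\ge 2$, $1<p\le 2$, $1\le q\le\ell$, let $\Omega\subset\mathbb{R}^N$ be a nonempty open set, let $H$ be either $H_0^1(\Omega)$ or $D_0^{1,2}(\Omega)$ with $H$ continuously embedded in $L^{2p}(\Omega)$, and let $\lambda_1,\dots,\lambda_\ell\in\mathbb{R}$ be such that every operator $-\Delta+\lambda_i$ is well defined and coercive in $H$. Then there exists a constant $C_*>0$, depending on $\Omega$, $\lambda_i$, $p$ and $q$ but independent of $(\beta_{ij})$, with the following property. If a real $\ell\times\ell$ matrix $(\beta_{ij})$ satisfies the block decomposition condition with $q$ blocks $I_1,\dots,I_q$, and either (1) $p<2$ and for every $h=1,\dots,q$ with $|I_h|\ge2$ $$\min_{\substack{i,j\in I_h\\ i\ne j}}\beta_{ij}\left(\frac{\min_{k=1,\dots,q}\max_{i\in I_k}\beta_{ii}}{\max_{i,j\in I_h}\beta_{ij}}\right)^{\frac p{p-1}}>C_*\,(\ell_h-\ell_{h-1}-1)^{\frac{2p}{p-1}}\sum_{i\in I_h}\ \sum_{j\notin I_h}|\beta_{ij}|,$$ or (2) $p=2$, and for every $h=1,\dots,q$ with $|I_h|\ge 2$ there are numbers $a_h,b_h$ with $\lambda_i=a_h$ for all $i\in I_h$, $\beta_{ij}=b_h$ for all $i,j\in I_h$ with $i\ne j$, and $$b_h>\max_{i\in I_h}\beta_{ii}+C_*\left[\frac{(\ell_h-\ell_{h-1}-1)\,b_h}{\min_{k=1,\dots,q}\max_{i\in I_k}\beta_{ii}}\right]^2\max_{i,j\in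 I_h}\ \sum_{m\notin I_h}|\beta_{im}-\beta_{jm}|,$$ then every least energy block-wise nontrivial solution of the system $$-\Delta u_i+\lambda_i u_i=\sum_{j=1}^\ell\beta_{ij}|u_j|^p|u_i|^{p-2}u_i,\qquad u_i\in H,\quad i=1,\dots,\ell,$$ is fully nontrivial, i.e. $u_i\neq0$ for every $i=1,\dots,\ell$.
   Context: $D_0^{1,2}(\Omega)$ is the completion of $C_c^\infty(\Omega)$ with respect to the norm $(\int_\Omega|\nabla u|^2)^{1/2}$. Solutions are understood in the weak sense, and $|t|^{p-2}t:=0$ for $t=0$. "$-\Delta+\lambda_i$ is well defined and coercive in $H$" means that $\|v\|_i:=\big(\int_\Omega(|\nabla v|^2+\lambda_i v^2)\big)^{1/2}$ is a well-defined norm in $H$, equivalent to the standard one. Block decomposition condition with $q$ blocks: $(\beta_{ij})$ is symmetric and there exist integers $0=\ell_0<\ell_1<\dots<\ell_q=\ell$ such that, with $I_h:=\{i:\ell_{h-1}<i\le\ell_h\}$ for $h=1,\dots,q$, one has $\beta_{ii}>0$ for all $i$; $\beta_{ij}\ge0$ if $i,j\in I_h$ for some $h$; and $\beta_{ij}\le 0$ if $i\in I_h$, $j\in I_k$ with $h\ne k$. Write $\mathbf{u}=(u_1,\dots,u_\ell)=(\bar u_1,\dots,\bar u_q)\in H^\ell$ with $\bar u_h=(u_i)_{i\in I_h}$, and $\|\bar u_h\|^2:=\sum_{i\in I_h}\|u_i\|_i^2$. A solution is block-wise nontrivial if $\bar u_h\neq0$ for every $h$. Let $$\mathcal{J}(\mathbf{u}):=\frac12\sum_{i=1}^\ell\|u_i\|_i^2-\frac1{2p}\sum_{i,j=1}^\ell\beta_{ij}\int_\Omega|u_i|^p|u_j|^p,$$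 $$\mathcal{N}:=\{\mathbf{u}\in H^\ell:\ \|\bar u_h\|\ne0\ \text{and}\ \partial_{\bar u_h}\mathcal{J}(\mathbf{u})\bar u_h=0\ \text{for all}\ h=1,\dots,q\},$$ where $\partial_{\bar u_h}\mathcal{J}(\mathbf{u})\bar u_h=\|\bar u_h\|^2-\sum_{i\in I_h}\sum_{j=1}^\ell\beta_{ij}\int_\Omega|u_i|^p|u_j|^p$. A least energy block-wise nontrivial solution is a block-wise nontrivial solution $\mathbf{u}$ of the system with $\mathcal{J}(\mathbf{u})=\inf_{\mathcal{N}}\mathcal{J}$. *)

theory Defs
  imports "HOL-Analysis.Analysis"
begin

section \<open>Function spaces on an open set\<close>

text \<open>
  Elements of the function spaces below are represented by functions on the whole space whose
  values outside \<open>\<Omega>\<close> are irrelevant; two functions represent the same element iff they agree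
  almost everywhere on \<open>\<Omega>\<close>.  In particular "\<open>u = 0\<close>" means \<open>zero_on \<Omega> u\<close>.
\<close>

definition zero_on :: "(real^'n) set \<Rightarrow> (real^'n \<Rightarrow> real) \<Rightarrow> bool" where
  "zero_on \<Omega> u \<longleftrightarrow> (AE x in lebesgue_on \<Omega>. u x = 0)"

definition Lspace :: "(real^'n) set \<Rightarrow> real \<Rightarrow> (real^'n \<Rightarrow> 'b::real_normed_vector) set" where
  "Lspace \<Omega> s = {f. f \<in> borel_measurable (lebesgue_on \<Omega>) \<and>
                     integrable (lebesgue_on \<Omega>) (\<lambda>x. norm (f x) powr s)}"

definition Lnorm :: "(real^'n) set \<Rightarrow> real \<Rightarrow> (real^'n \<Rightarrow> 'b::real_normed_vector) \<Rightarrow> real" where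
  "Lnorm \<Omega> s f = (LINT x|lebesgue_on \<Omega>. norm (f x) powr s) powr (1 / s)"

definition partial_deriv :: "'n \<Rightarrow> (real^'n \<Rightarrow> real) \<Rightarrow> real^'n \<Rightarrow> real" where
  "partial_deriv i f x = frechet_derivative f (at x) (axis i 1)"

definition grad :: "(real^'n \<Rightarrow> real) \<Rightarrow> real^'n \<Rightarrow> real^'n" where
  "grad f x = (\<chi> i. partial_deriv i f x)"

text \<open>\<open>C\<^sup>\<infinity>\<close>: all iterated partial derivatives exist and are (Frechet) differentiable everywhere.\<close>

definition smooth :: "(real^'n \<Rightarrow> real) \<Rightarrow> bool" where
  "smooth f \<longleftrightarrow> (\<forall>is x. foldr partial_deriv is f differentiable (at x))"

definition Cc_infinity :: "(real^'n) set \<Rightarrow> (real^'n \<Rightarrow> real) set" where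
  "Cc_infinity \<Omega> = {\<phi>. smooth \<phi> \<and> compact (closure {x. \<phi> x \<noteq> 0}) \<and> closure {x. \<phi> x \<noteq> 0} \<subseteq> \<Omega>}"

definition loc_integrable :: "(real^'n) set \<Rightarrow> (real^'n \<Rightarrow> real) \<Rightarrow> bool" where
  "loc_integrable \<Omega> f \<longleftrightarrow> (\<forall>K. compact K \<and> K \<subseteq> \<Omega> \<longrightarrow> integrable (lebesgue_on K) f)"

definition has_weak_grad :: "(real^'n) set \<Rightarrow> (real^'n \<Rightarrow> real) \<Rightarrow> (real^'n \<Rightarrow> real^'n) \<Rightarrow> bool" where
  "has_weak_grad \<Omega> u g \<longleftrightarrow>
     loc_integrable \<Omega> u \<and> (\<forall>i. loc_integrable \<Omega> (\<lambda>x. g x $ i)) \<and>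
     (\<forall>\<phi>\<in>Cc_infinity \<Omega>. \<forall>i.
        (LINT x|lebesgue_on \<Omega>. u x * partial_deriv i \<phi> x) = - (LINT x|lebesgue_on \<Omega>. g x $ i * \<phi> x))"

text \<open>The weak gradient, determined almost everywhere on \<open>\<Omega>\<close> whenever it exists.\<close>

definition weak_grad :: "(real^'n) set \<Rightarrow> (real^'n \<Rightarrow> real) \<Rightarrow> real^'n \<Rightarrow> real^'n" where
  "weak_grad \<Omega> u = (SOME g. has_weak_grad \<Omega> u g)"

definition H1 :: "(real^'n) set \<Rightarrow> (real^'n \<Rightarrow> real) set" where
  "H1 \<Omega> = {u \<in> Lspace \<Omega> 2. \<exists>g\<in>Lspace \<Omega> 2. has_weak_grad \<Omega> u g}"

definition H1_norm :: "(real^'n) set \<Rightarrow> (real^'n \<Rightarrow> real) \<Rightarrow> real" where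
  "H1_norm \<Omega> u = sqrt (LINT x|lebesgue_on \<Omega>. (norm (weak_grad \<Omega> u x))\<^sup>2 + (u x)\<^sup>2)"

definition H1_0 :: "(real^'n) set \<Rightarrow> (real^'n \<Rightarrow> real) set" where
  "H1_0 \<Omega> = {u \<in> H1 \<Omega>. \<exists>\<phi>. (\<forall>n::nat. \<phi> n \<in> Cc_infinity \<Omega>) \<and>
                         (\<lambda>n. H1_norm \<Omega> (\<lambda>x. \<phi> n x - u x)) \<longlonglongrightarrow> 0}"

text \<open>
  The completion of \<open>C\<^sub>c\<^sup>\<infinity>(\<Omega>)\<close> with respect to the Dirichlet norm, realised as a space of
  functions.  For \<open>N \<ge> 3\<close> the Sobolev inequality shows that every sequence of test functions
  which is Cauchy for the Dirichlet norm converges in \<open>L\<^sup>2\<^sup>*(\<Omega>)\<close>, \<open>2* = 2N/(N-2)\<close>, and that two such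
  sequences have the same limit iff they are equivalent in the completion.  An element of the
  completion is identified with this limit; its Dirichlet norm is that of its weak gradient.
  The definitions are meant for \<open>N \<ge> 3\<close> only.
\<close>

definition crit_exp :: "'n itself \<Rightarrow> real" where
  "crit_exp _ = 2 * real CARD('n) / (real CARD('n) - 2)"

definition D12_0 :: "(real^'n) set \<Rightarrow> (real^'n \<Rightarrow> real) set" where
  "D12_0 \<Omega> = {u \<in> Lspace \<Omega> (crit_exp TYPE('n)). \<exists>\<phi>. (\<forall>n::nat. \<phi> n \<in> Cc_infinity \<Omega>) \<and>
       (\<forall>\<epsilon>>0. \<exists>M. \<forall>m\<ge>M. \<forall>n\<ge>M. Lnorm \<Omega> 2 (grad (\<lambda>x. \<phi> m x - \<phi> n x)) < \<epsilon>) \<and>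
       (\<lambda>n. Lnorm \<Omega> (crit_exp TYPE('n)) (\<lambda>x. \<phi> n x - u x)) \<longlonglongrightarrow> 0}"

definition D12_norm :: "(real^'n) set \<Rightarrow> (real^'n \<Rightarrow> real) \<Rightarrow> real" where
  "D12_norm \<Omega> u = sqrt (LINT x|lebesgue_on \<Omega>. (norm (weak_grad \<Omega> u x))\<^sup>2)"

text \<open>In the following, \<open>H\<close> is a space of functions on \<open>\<Omega>\<close> and \<open>nrm\<close> its standard norm.\<close>

definition cont_embedded_L ::
    "(real^'n) set \<Rightarrow> (real^'n \<Rightarrow> real) set \<Rightarrow> ((real^'n \<Rightarrow> real) \<Rightarrow> real) \<Rightarrow> real \<Rightarrow> bool" where
  "cont_embedded_L \<Omega> H nrm s \<longleftrightarrow> H \<subseteq> Lspace \<Omega> s \<and> (\<exists>C. \<forall>v\<in>H. Lnorm \<Omega> s v \<le> C * nrm v)"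

definition norm_lam :: "(real^'n) set \<Rightarrow> real \<Rightarrow> (real^'n \<Rightarrow> real) \<Rightarrow> real" where
  "norm_lam \<Omega> c v = sqrt (LINT x|lebesgue_on \<Omega>. (norm (weak_grad \<Omega> v x))\<^sup>2 + c * (v x)\<^sup>2)"

definition is_norm_on ::
    "(real^'n) set \<Rightarrow> (real^'n \<Rightarrow> real) set \<Rightarrow> ((real^'n \<Rightarrow> real) \<Rightarrow> real) \<Rightarrow> bool" where
  "is_norm_on \<Omega> H f \<longleftrightarrow>
     (\<forall>v\<in>H. 0 \<le> f v \<and> (f v = 0 \<longleftrightarrow> zero_on \<Omega> v)) \<and>
     (\<forall>v\<in>H. \<forall>t. f (\<lambda>x. t * v x) = \<bar>t\<bar> * f v) \<and>
     (\<forall>v\<in>H. \<forall>w\<in>H. f (\<lambda>x. v x + w x) \<le> f v + f w)"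

text \<open>
  \<open>-\<Delta> + c\<close> is well defined and coercive in \<open>H\<close>.  As \<^const>\<open>sqrt\<close> is negative on negative
  reals, nonnegativity of the norm includes nonnegativity of the quadratic form.
\<close>

definition well_defined_coercive ::
    "(real^'n) set \<Rightarrow> (real^'n \<Rightarrow> real) set \<Rightarrow> ((real^'n \<Rightarrow> real) \<Rightarrow> real) \<Rightarrow> real \<Rightarrow> bool" where
  "well_defined_coercive \<Omega> H nrm c \<longleftrightarrow>
     (\<forall>v\<in>H. integrable (lebesgue_on \<Omega>) (\<lambda>x. (norm (weak_grad \<Omega> v x))\<^sup>2 + c * (v x)\<^sup>2)) \<and>
     is_norm_on \<Omega> H (norm_lam \<Omega> c) \<and>
     (\<exists>A>0. \<exists>B>0. \<forall>v\<in>H. A * nrm v \<le> norm_lam \<Omega> c v \<and> norm_lam \<Omega> c v \<le> B * nrm v)"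


section \<open>The system and its variational structure\<close>

text \<open>
  Vectors and matrices are functions on \<^typ>\<open>nat\<close> used at the indices \<open>1, \<dots>, \<ell>\<close>; the block ends
  \<open>\<ell>\<^sub>0 < \<dots> < \<ell>\<^sub>q\<close> are \<open>L 0, \<dots>, L q\<close>.
\<close>

definition block :: "(nat \<Rightarrow> nat) \<Rightarrow> nat \<Rightarrow> nat set" where
  "block L h = {L (h - 1)<..L h}"

definition block_decomposition ::
    "nat \<Rightarrow> nat \<Rightarrow> (nat \<Rightarrow> nat) \<Rightarrow> (nat \<Rightarrow> nat \<Rightarrow> real) \<Rightarrow> bool" where
  "block_decomposition l q L \<beta> \<longleftrightarrow>
     (\<forall>i\<in>{1..l}. \<forall>j\<in>{1..l}. \<beta> i j = \<beta> j i) \<and>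
     L 0 = 0 \<and> (\<forall>h<q. L h < L (Suc h)) \<and> L q = l \<and>
     (\<forall>i\<in>{1..l}. \<beta> i i > 0) \<and>
     (\<forall>h\<in>{1..q}. \<forall>i\<in>block L h. \<forall>j\<in>block L h. \<beta> i j \<ge> 0) \<and>
     (\<forall>h\<in>{1..q}. \<forall>k\<in>{1..q}. h \<noteq> k \<longrightarrow> (\<forall>i\<in>block L h. \<forall>j\<in>block L k. \<beta> i j \<le> 0))"

definition interaction :: "(real^'n) set \<Rightarrow> real \<Rightarrow> (real^'n \<Rightarrow> real) \<Rightarrow> (real^'n \<Rightarrow> real) \<Rightarrow> real" where
  "interaction \<Omega> p v w = (LINT x|lebesgue_on \<Omega>. \<bar>v x\<bar> powr p * \<bar>w x\<bar> powr p)"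

text \<open>
  Weak formulation.  \<open>\<bar>t\<bar> powr (p - 2) * t\<close> vanishes at \<open>t = 0\<close>.
\<close>

definition weak_solution ::
    "(real^'n) set \<Rightarrow> (real^'n \<Rightarrow> real) set \<Rightarrow> nat \<Rightarrow> real \<Rightarrow> (nat \<Rightarrow> real) \<Rightarrow> (nat \<Rightarrow> nat \<Rightarrow> real) \<Rightarrow>
      (nat \<Rightarrow> real^'n \<Rightarrow> real) \<Rightarrow> bool" where
  "weak_solution \<Omega> H l p lam \<beta> u \<longleftrightarrow>
     (\<forall>i\<in>{1..l}. u i \<in> H \<and>
        (\<forall>v\<in>H. (LINT x|lebesgue_on \<Omega>.
                   weak_grad \<Omega> (u i) x \<bullet> weak_grad \<Omega> v x + lam i * u i x * v x)
              = (\<Sum>j=1..l. \<beta> i j * (LINT x|lebesgue_on \<Omega>.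
                   \<bar>u j x\<bar> powr p * (\<bar>u i x\<bar> powr (p - 2) * u i x) * v x))))"

definition blockwise_nontrivial ::
    "(real^'n) set \<Rightarrow> nat \<Rightarrow> (nat \<Rightarrow> nat) \<Rightarrow> (nat \<Rightarrow> real^'n \<Rightarrow> real) \<Rightarrow> bool" where
  "blockwise_nontrivial \<Omega> q L u \<longleftrightarrow> (\<forall>h\<in>{1..q}. \<exists>i\<in>block L h. \<not> zero_on \<Omega> (u i))"

definition fully_nontrivial ::
    "(real^'n) set \<Rightarrow> nat \<Rightarrow> (nat \<Rightarrow> real^'n \<Rightarrow> real) \<Rightarrow> bool" where
  "fully_nontrivial \<Omega> l u \<longleftrightarrow> (\<forall>i\<in>{1..l}. \<not> zero_on \<Omega> (u i))"

definition block_norm ::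
    "(real^'n) set \<Rightarrow> (nat \<Rightarrow> real) \<Rightarrow> (nat \<Rightarrow> nat) \<Rightarrow> nat \<Rightarrow> (nat \<Rightarrow> real^'n \<Rightarrow> real) \<Rightarrow> real" where
  "block_norm \<Omega> lam L h u = sqrt (\<Sum>i\<in>block L h. (norm_lam \<Omega> (lam i) (u i))\<^sup>2)"

definition energy ::
    "(real^'n) set \<Rightarrow> nat \<Rightarrow> real \<Rightarrow> (nat \<Rightarrow> real) \<Rightarrow> (nat \<Rightarrow> nat \<Rightarrow> real) \<Rightarrow>
      (nat \<Rightarrow> real^'n \<Rightarrow> real) \<Rightarrow> real" where
  "energy \<Omega> l p lam \<beta> u =
     1 / 2 * (\<Sum>i=1..l. (norm_lam \<Omega> (lam i) (u i))\<^sup>2)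
     - 1 / (2 * p) * (\<Sum>i=1..l. \<Sum>j=1..l. \<beta> i j * interaction \<Omega> p (u i) (u j))"

text \<open>The partial derivative of the energy in the \<open>h\<close>-th block \<open>u\<^sub>h\<close>, applied to \<open>u\<^sub>h\<close>.\<close>

definition block_deriv ::
    "(real^'n) set \<Rightarrow> nat \<Rightarrow> real \<Rightarrow> (nat \<Rightarrow> real) \<Rightarrow> (nat \<Rightarrow> nat \<Rightarrow> real) \<Rightarrow> (nat \<Rightarrow> nat) \<Rightarrow> nat \<Rightarrow>
      (nat \<Rightarrow> real^'n \<Rightarrow> real) \<Rightarrow> real" where
  "block_deriv \<Omega> l p lam \<beta> L h u =
     (block_norm \<Omega> lam L h u)\<^sup>2
     - (\<Sum>i\<in>block L h. \<Sum>j=1..l. \<beta> i j * interaction \<Omega> p (u i) (u j))"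

definition nehari ::
    "(real^'n) set \<Rightarrow> (real^'n \<Rightarrow> real) set \<Rightarrow> nat \<Rightarrow> nat \<Rightarrow> real \<Rightarrow> (nat \<Rightarrow> real) \<Rightarrow>
      (nat \<Rightarrow> nat \<Rightarrow> real) \<Rightarrow> (nat \<Rightarrow> nat) \<Rightarrow> (nat \<Rightarrow> real^'n \<Rightarrow> real) set" where
  "nehari \<Omega> H l q p lam \<beta> L =
     {u. (\<forall>i\<in>{1..l}. u i \<in> H) \<and>
         (\<forall>h\<in>{1..q}. block_norm \<Omega> lam L h u \<noteq> 0 \<and> block_deriv \<Omega> l p lam \<beta> L h u = 0)}"

text \<open>
  The infimum of a set of reals is meaningful here: for block decomposed \<open>\<beta>\<close> the set is nonempty,
  and on it the energy is \<open>(1/2 - 1/(2p)) \<Sum>\<parallel>u\<^sub>i\<parallel>\<^sub>i\<^sup>2 \<ge> 0\<close>.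
\<close>

definition least_energy_solution ::
    "(real^'n) set \<Rightarrow> (real^'n \<Rightarrow> real) set \<Rightarrow> nat \<Rightarrow> nat \<Rightarrow> real \<Rightarrow> (nat \<Rightarrow> real) \<Rightarrow>
      (nat \<Rightarrow> nat \<Rightarrow> real) \<Rightarrow> (nat \<Rightarrow> nat) \<Rightarrow> (nat \<Rightarrow> real^'n \<Rightarrow> real) \<Rightarrow> bool" where
  "least_energy_solution \<Omega> H l q p lam \<beta> L u \<longleftrightarrow>
     weak_solution \<Omega> H l p lam \<beta> u \<and> blockwise_nontrivial \<Omega> q L u \<and>
     energy \<Omega> l p lam \<beta> u = (INF w\<in>nehari \<Omega> H l q p lam \<beta> L. energy \<Omega> l p lam \<beta> w)"


section \<open>The conditions on the matrix\<close>

definition minmax_diag :: "nat \<Rightarrow> (nat \<Rightarrow> nat) \<Rightarrow> (nat \<Rightarrow> nat \<Rightarrow> real) \<Rightarrow> real" where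
  "minmax_diag q L \<beta> = (MIN k\<in>{1..q}. MAX i\<in>block L k. \<beta> i i)"

definition condition1 ::
    "real \<Rightarrow> nat \<Rightarrow> nat \<Rightarrow> real \<Rightarrow> (nat \<Rightarrow> nat \<Rightarrow> real) \<Rightarrow> (nat \<Rightarrow> nat) \<Rightarrow> bool" where
  "condition1 C l q p \<beta> L \<longleftrightarrow>
     (\<forall>h\<in>{1..q}. card (block L h) \<ge> 2 \<longrightarrow>
        (MIN (i, j)\<in>{(i, j). i \<in> block L h \<and> j \<in> block L h \<and> i \<noteq> j}. \<beta> i j) *
          (minmax_diag q L \<beta> / (MAX (i, j)\<in>block L h \<times> block L h. \<beta> i j)) powr (p / (p - 1))
        > C * (real (L h) - real (L (h - 1)) - 1) powr (2 * p / (p - 1)) *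
            (\<Sum>i\<in>block L h. \<Sum>j\<in>{1..l} - block L h. \<bar>\<beta> i j\<bar>))"

definition condition2 ::
    "real \<Rightarrow> nat \<Rightarrow> nat \<Rightarrow> (nat \<Rightarrow> real) \<Rightarrow> (nat \<Rightarrow> nat \<Rightarrow> real) \<Rightarrow> (nat \<Rightarrow> nat) \<Rightarrow> bool" where
  "condition2 C l q lam \<beta> L \<longleftrightarrow>
     (\<forall>h\<in>{1..q}. card (block L h) \<ge> 2 \<longrightarrow>
        (\<exists>a b. (\<forall>i\<in>block L h. lam i = a) \<and>
               (\<forall>i\<in>block L h. \<forall>j\<in>block L h. i \<noteq> j \<longrightarrow> \<beta> i j = b) \<and>
               b > (MAX i\<in>block L h. \<beta> i i) +
                   C * ((real (L h) - real (L (h - 1)) - 1) * b / minmax_diag q L \<beta>)\<^sup>2 *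
                   (MAX (i, j)\<in>block L h \<times> block L h.
                      \<Sum>m\<in>{1..l} - block L h. \<bar>\<beta> i m - \<beta> j m\<bar>)))"

end

theory Submission
  imports Defs
begin

text \<open>
  A least energy block-wise nontrivial solution \<open>u\<close> minimises the energy on the Nehari set, and the
  proof shows that such a minimiser cannot have a vanishing component: filling the vacant slot lowers
  the energy.

  For a fixed vector \<open>u\<close>, multiplying the block \<open>h\<close> by \<open>s\<^sub>h > 0\<close> turns the energy into
  \<open>F(s) = 1/2 \<Sum> s\<^sub>h\<^sup>2 A\<^sub>h - 1/(2p) \<Sum> s\<^sub>h\<^sup>p s\<^sub>k\<^sup>p B\<^sub>h\<^sub>k\<close>, where \<open>A\<^sub>h\<close> is the squared norm of the block and
  \<open>B\<close> collects the interaction integrals; the Nehari conditions are \<open>A\<^sub>h = \<Sum>\<^sub>k B\<^sub>h\<^sub>k\<close>.  Since the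
  blocks compete, \<open>B\<^sub>h\<^sub>k \<le> 0\<close> off the diagonal, and \<open>F\<close> is strictly concave in the variables
  \<open>s\<^sub>h\<^sup>2\<^sup>p\<close>.  On the Nehari set its strict maximum is therefore at \<open>s = 1\<close>, and this
  persists: if \<open>A\<close> and \<open>B\<close> are changed slightly, the maximum over the cube \<open>[1/2, 2]\<^sup>q\<close> stays
  interior and yields a point of the Nehari set (\<open>nehari_projection_near\<close>).  Hence for
  every small perturbation of a minimiser there is some \<open>s\<close> in the cube for which the perturbed
  \<open>F(s)\<close> is at least the original \<open>F(s)\<close> (\<open>eventually_comparison\<close>).

  Suppose now that \<open>u\<^sub>i = 0\<close> with \<open>i\<close> in block \<open>h\<close>, and let \<open>u\<^sub>j\<close> be the component of that
  block with largest \<open>L\<^sup>2\<^sup>p\<close> norm.  Put \<open>E\<^sup>1\<^sup>/\<^sup>p u\<^sub>j\<close> into the vacant slot; for \<open>p = 2\<close> also shrink \<open>u\<^sub>j\<close>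
  to \<open>(1 - E)\<^sup>1\<^sup>/\<^sup>2 u\<^sub>j\<close>, which is a rotation in the plane of the two components and leaves the
  quadratic part of the energy unchanged.  In both cases the quadratic part changes by \<open>o(E)\<close> and the
  interaction part by a multiple of \<open>E\<close>, so the comparison above forces the cooperative gain
  inside the block to be at most \<open>4\<^sup>p\<close> times the competitive loss to the other blocks
  (\<open>component_perturbation\<close>).

  The hypotheses on \<open>\<beta>\<close> make the gain larger, once the norms of the components have been
  compared.  For this, \<open>energy_bound\<close> bounds the norms from above, by testing minimality with \<open>q\<close> fixed bumps of disjoint supports placed in the components with largest
  \<open>\<beta>\<^sub>i\<^sub>i\<close>; and the Nehari condition for the block, where at most \<open>|I\<^sub>h| - 1\<close> components are nonzero,
  bounds \<open>u\<^sub>j\<close> from below (\<open>dominant_component\<close>).  Neither bound sees \<open>\<beta>\<close> other than through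
  the quantities in the hypotheses, so the constant depends on \<open>\<Omega>\<close>, \<open>\<lambda>\<^sub>i\<close>, \<open>p\<close>, \<open>q\<close> and \<open>\<ell>\<close> only.

  Apart from the norms, the variational argument uses of the function space only that it is closed
  under scaling, that it embeds into \<open>L\<^sup>2\<^sup>p\<close>, and that it contains the bumps.
  For \<open>H\<^sub>0\<^sup>1(\<Omega>)\<close> the first and the last property rest on the uniqueness of weak gradients and on integration by parts for test functions.
\<close>

text \<open>
  Block indices start at 1; keeping the numeral prevents the simplifier from rewriting
  the ranges \<open>{1..q}\<close> and \<open>{1..l}\<close> to \<^term>\<open>Suc 0\<close>.
\<close>

declare One_nat_def [simp del]

section \<open>Projecting onto the Nehari set near a critical point\<close>

text \<open>
  The energy as a function of the block scalings \<open>s\<close>, for given squared block norms \<open>A\<close> and block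
  couplings \<open>B\<close>.
\<close>

definition reduced_energy :: "nat \<Rightarrow> real \<Rightarrow> (nat \<Rightarrow> real) \<Rightarrow> (nat \<Rightarrow> nat \<Rightarrow> real) \<Rightarrow> (nat \<Rightarrow> real) \<Rightarrow> real" where
  "reduced_energy q p A B s =
     1 / 2 * (\<Sum>h=1..q. (s h)\<^sup>2 * A h)
     - 1 / (2 * p) * (\<Sum>h=1..q. \<Sum>k=1..q. s h powr p * s k powr p * B h k)"

text \<open>
  The cube \<open>[1/2, 2]\<^sup>q\<close>.  All coordinates of \<^typ>\<open>nat \<Rightarrow> real\<close> are confined, also those beyond \<open>q\<close>, so
  that the set is compact in the product topology.
\<close>

definition scaling_box :: "(nat \<Rightarrow> real) set" where
  "scaling_box = PiE UNIV (\<lambda>_. {1/2..2})"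

lemma scaling_boxD: "s \<in> scaling_box \<Longrightarrow> 1/2 \<le> s h \<and> s h \<le> 2"
  by (auto simp: scaling_box_def PiE_iff)

lemma compact_scaling_box: "compact scaling_box"
proof -
  have "compactin (product_topology (\<lambda>_::nat. euclideanreal) UNIV) (PiE UNIV (\<lambda>_. {1/2..2::real}))"
    by (subst compactin_PiE) auto
  then show ?thesis
    by (simp add: scaling_box_def euclidean_product_topology)
qed

text \<open>
  Bernoulli's inequality for a real exponent, in the form in which strict concavity of \<open>F\<close> needs it.  By the mean
  value theorem \<open>y\<^sup>p - 1 = p (y - 1) z\<^sup>p\<^sup>-\<^sup>1\<close> with \<open>z\<close> strictly between \<open>1\<close> and \<open>y\<close>.
\<close>

lemma bernoulli_powr_strict:
  fixes y p :: real
  assumes "p > 1" "y > 0" "y \<noteq> 1"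
  shows "y < 1 + (y powr p - 1) / p"
proof -
  have D: "DERIV (\<lambda>x. x powr p) x :> p * x powr (p - 1)" if "x > 0" for x :: real
    using that by (auto intro!: derivative_eq_intros)
  have "y powr p - 1 > p * (y - 1)"
  proof (cases "y > 1")
    case True
    obtain z where z: "z > 1" "z < y" "y powr p - 1 powr p = (y - 1) * (p * z powr (p - 1))"
      using MVT2[OF True, of "\<lambda>x. x powr p" "\<lambda>x. p * x powr (p - 1)"] D by force
    have "z powr (p - 1) > 1" using z(1) assms by (simp add: gr_one_powr)
    then have "(y - 1) * (p * 1) < (y - 1) * (p * z powr (p - 1))"
      using True assms by (intro mult_strict_left_mono) auto
    with z show ?thesis by (simp add: mult.commute)
  next
    case False
    then have y1: "y < 1" using assms by simp
    obtain z where z: "z > y" "z < 1" "1 powr p - y powr p = (1 - y) * (p * z powr (p - 1))"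
      using MVT2[OF y1, of "\<lambda>x. x powr p" "\<lambda>x. p * x powr (p - 1)"] D assms by force
    have "z powr (p - 1) < 1" using z assms powr_less_mono2[of "p - 1" z 1] by simp
    then have "(1 - y) * (p * z powr (p - 1)) < (1 - y) * (p * 1)"
      using y1 assms by (intro mult_strict_left_mono) auto
    with z show ?thesis by (simp add: algebra_simps)
  qed
  then have "(y powr p - 1) / p > y - 1" using assms by (simp add: field_simps)
  then show ?thesis by simp
qed

text \<open>
  The data \<open>A\<close>, \<open>B\<close> of a point of the Nehari set.
\<close>

locale balanced_form =
  fixes q :: nat and p :: real and A :: "nat \<Rightarrow> real" and B :: "nat \<Rightarrow> nat \<Rightarrow> real"
  assumes p: "p > 1"
    and A_pos: "\<And>h. h \<in> {1..q} \<Longrightarrow> A h > 0"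
    and B_sym: "\<And>h k. h \<in> {1..q} \<Longrightarrow> k \<in> {1..q} \<Longrightarrow> B h k = B k h"
    and B_off: "\<And>h k. h \<in> {1..q} \<Longrightarrow> k \<in> {1..q} \<Longrightarrow> h \<noteq> k \<Longrightarrow> B h k \<le> 0"
    and balance: "\<And>h. h \<in> {1..q} \<Longrightarrow> A h = (\<Sum>k=1..q. B h k)"
begin

lemma reduced_energy_one: "reduced_energy q p A B (\<lambda>_. 1) = (1/2 - 1/(2*p)) * (\<Sum>h=1..q. A h)"
proof -
  have "(\<Sum>h=1..q. \<Sum>k=1..q. B h k) = (\<Sum>h=1..q. A h)"
    by (intro sum.cong refl) (simp add: balance)
  then show ?thesis by (simp add: reduced_energy_def algebra_simps)
qed

text \<open>
  This is concavity in \<open>t\<^sub>h = s\<^sub>h\<^sup>2\<^sup>p\<close> written out: the mixed terms are estimated by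
  \<open>s\<^sub>h\<^sup>p s\<^sub>k\<^sup>p \<le> (t\<^sub>h + t\<^sub>k) / 2\<close>, which has the right direction because \<open>B\<^sub>h\<^sub>k \<le> 0\<close>, and then symmetry and
  balance of \<open>B\<close> collapse the double sum to \<open>\<Sum> t\<^sub>h A\<^sub>h\<close>.  What is left on the right is Bernoulli's
  defect in each coordinate.
\<close>

lemma reduced_energy_gap:
  assumes s: "\<And>h. s h > 0"
  shows "reduced_energy q p A B s \<le> reduced_energy q p A B (\<lambda>_. 1)
           - (\<Sum>h=1..q. A h / 2 * (1 + (s h powr (2*p) - 1) / p - (s h)\<^sup>2))"
proof -
  define t where "t h = s h powr (2 * p)" for h
  have tp: "t h = s h powr p * s h powr p" for h
    by (simp add: t_def flip: powr_add)
  have pair: "s h powr p * s k powr p * B h k \<ge> (t h + t k) / 2 * B h k"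
    if "h \<in> {1..q}" "k \<in> {1..q}" for h k
  proof (cases "h = k")
    case True then show ?thesis by (simp add: tp)
  next
    case False
    have "0 \<le> (s h powr p - s k powr p)\<^sup>2" by simp
    then have "s h powr p * s k powr p \<le> (t h + t k) / 2"
      by (simp add: tp power2_eq_square algebra_simps)
    then show ?thesis using B_off[OF that False] by (rule mult_right_mono_neg)
  qed
  have eq: "(\<Sum>h=1..q. \<Sum>k=1..q. (t h + t k) / 2 * B h k) = (\<Sum>h=1..q. t h * A h)"
  proof -
    have "(\<Sum>h=1..q. \<Sum>k=1..q. (t h + t k) / 2 * B h k)
        = (\<Sum>h=1..q. \<Sum>k=1..q. t h / 2 * B h k) + (\<Sum>h=1..q. \<Sum>k=1..q. t k / 2 * B h k)"
      by (simp add: sum.distrib add_divide_distrib distrib_right)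
    also have "(\<Sum>h=1..q. \<Sum>k=1..q. t k / 2 * B h k) = (\<Sum>k=1..q. \<Sum>h=1..q. t k / 2 * B k h)"
      by (subst sum.swap) (intro sum.cong refl, simp add: B_sym)
    finally have "(\<Sum>h=1..q. \<Sum>k=1..q. (t h + t k) / 2 * B h k)
        = (\<Sum>h=1..q. \<Sum>k=1..q. t h * B h k)"
      by (simp flip: sum.distrib)
    also have "\<dots> = (\<Sum>h=1..q. t h * A h)"
      by (intro sum.cong refl) (simp add: balance sum_distrib_left)
    finally show ?thesis .
  qed
  have "(\<Sum>h=1..q. \<Sum>k=1..q. s h powr p * s k powr p * B h k) \<ge> (\<Sum>h=1..q. t h * A h)"
    unfolding eq[symmetric] by (intro sum_mono pair)
  then have "reduced_energy q p A B s
      \<le> 1 / 2 * (\<Sum>h=1..q. (s h)\<^sup>2 * A h) - 1 / (2 * p) * (\<Sum>h=1..q. t h * A h)"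
    using p by (simp add: reduced_energy_def divide_right_mono)
  also have "\<dots> = (\<Sum>h=1..q. ((s h)\<^sup>2 * A h) / 2 - t h * A h / (2 * p))"
    by (simp add: sum_subtractf sum_divide_distrib)
  also have "\<dots> = (\<Sum>h=1..q. (1/2 - 1/(2*p)) * A h
        - A h / 2 * (1 + (t h - 1) / p - (s h)\<^sup>2))"
    using p by (intro sum.cong refl) (simp add: field_simps)
  also have "\<dots> = reduced_energy q p A B (\<lambda>_. 1) - (\<Sum>h=1..q. A h / 2 * (1 + (t h - 1) / p - (s h)\<^sup>2))"
    by (simp add: reduced_energy_one sum_subtractf sum_distrib_left)
  finally show ?thesis by (simp add: t_def)
qed

lemma gap_pos:
  assumes "x > 0" "x \<noteq> (1::real)"
  shows "1 + (x powr (2*p) - 1) / p - x\<^sup>2 > 0"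
proof -
  have "x\<^sup>2 \<noteq> 1" using assms by (simp add: power2_eq_1_iff)
  moreover have "(x\<^sup>2) powr p = x powr (2*p)"
    using assms by (simp add: powr_powr flip: powr_numeral)
  ultimately show ?thesis
    using bernoulli_powr_strict[OF p, of "x\<^sup>2"] assms by simp
qed

lemma gap_nonneg:
  assumes "x > (0::real)"
  shows "1 + (x powr (2*p) - 1) / p - x\<^sup>2 \<ge> 0"
  using gap_pos[OF assms] by (cases "x = 1") auto

lemma reduced_energy_le_one:
  assumes s: "\<And>h. s h > 0"
  shows "reduced_energy q p A B s \<le> reduced_energy q p A B (\<lambda>_. 1)"
proof -
  have "(\<Sum>h=1..q. A h / 2 * (1 + (s h powr (2*p) - 1) / p - (s h)\<^sup>2)) \<ge> 0"
    using A_pos gap_nonneg s by (intro sum_nonneg mult_nonneg_nonneg) (auto intro: less_imp_le)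
  then show ?thesis using reduced_energy_gap[of s] s by simp
qed

text \<open>
  On the boundary of the cube one coordinate is \<open>1/2\<close> or \<open>2\<close>, and its defect alone is bounded away
  from zero.
\<close>

lemma reduced_energy_boundary_gap:
  "\<exists>\<eta>>0. \<forall>s\<in>scaling_box. (\<exists>h\<in>{1..q}. s h = 1/2 \<or> s h = 2) \<longrightarrow>
      reduced_energy q p A B s \<le> reduced_energy q p A B (\<lambda>_. 1) - \<eta>"
proof -
  define D where "D x = 1 + (x powr (2*p) - 1) / p - x\<^sup>2" for x :: real
  define d where "d = min (D (1/2)) (D 2)"
  have d: "d > 0" using gap_pos[of "1/2"] gap_pos[of 2] by (simp add: d_def D_def)
  define m where "m = Min (insert 1 (A ` {1..q}))"
  have m: "m > 0" "\<And>h. h \<in> {1..q} \<Longrightarrow> m \<le> A h"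
    using A_pos unfolding m_def by (auto simp del: Min_insert intro!: Min_le)
  show ?thesis
  proof (intro exI[of _ "m / 2 * d"] conjI ballI impI)
    show "m / 2 * d > 0" using d m by simp
  next
    fix s assume s: "s \<in> scaling_box" and "\<exists>h\<in>{1..q}. s h = 1/2 \<or> s h = 2"
    then obtain h where h: "h \<in> {1..q}" "s h = 1/2 \<or> s h = 2" by auto
    have sp: "s k > 0" for k using scaling_boxD[OF s, of k] by linarith
    have "m / 2 * d \<le> A h / 2 * D (s h)"
    proof (rule mult_mono)
      show "d \<le> D (s h)" using h(2) unfolding d_def by (elim disjE) (simp_all only: min.cobounded1 min.cobounded2)
    qed (use m(2)[OF h(1)] d m(1) in auto)
    also have "\<dots> \<le> (\<Sum>h=1..q. A h / 2 * D (s h))"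
    proof (rule member_le_sum[OF h(1)])
      fix x assume "x \<in> {1..q} - {h}"
      then show "0 \<le> A x / 2 * D (s x)"
        using A_pos[of x] gap_nonneg[of "s x"] sp unfolding D_def by auto
    qed simp
    finally show "reduced_energy q p A B s \<le> reduced_energy q p A B (\<lambda>_. 1) - m / 2 * d"
      using reduced_energy_gap[of s, OF sp] unfolding D_def by linarith
  qed
qed

end

lemma continuous_on_reduced_energy:
  "continuous_on scaling_box (reduced_energy q p A B)"
proof -
  have nz: "s h \<noteq> 0" if "s \<in> scaling_box" for s h
    using scaling_boxD[OF that, of h] by auto
  then show ?thesis
    unfolding reduced_energy_def
    by (intro continuous_intros continuous_on_product_coordinates[THEN continuous_on_subset]) (auto simp: nz)
qed

lemma reduced_energy_partial:
  assumes p: "p > 1" and s: "\<And>a. s a > 0" and h: "h \<in> {1..q}"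
    and sym: "\<And>a b. a \<in> {1..q} \<Longrightarrow> b \<in> {1..q} \<Longrightarrow> B a b = B b a"
  shows "((\<lambda>x. reduced_energy q p A B (s(h := x))) has_real_derivative
      s h * A h - s h powr (p - 1) * (\<Sum>k=1..q. s k powr p * B h k)) (at (s h))"
proof -
  define d where "d a = (if a = h then p * s h powr (p - 1) else 0)" for a
  have sq: "((\<lambda>x. ((s(h := x)) a)\<^sup>2) has_real_derivative (if a = h then 2 * s h else 0)) (at (s h))" for a
    by (auto intro!: derivative_eq_intros)
  have pw: "((\<lambda>x. ((s(h := x)) a) powr p) has_real_derivative d a) (at (s h))" for a
    using s by (cases "a = h") (auto simp: d_def intro!: derivative_eq_intros)
  have "((\<lambda>x. reduced_energy q p A B (s(h := x))) has_real_derivative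
      (1 / 2 * (\<Sum>a=1..q. (if a = h then 2 * s h else 0) * A a)
       - 1 / (2 * p) * (\<Sum>a=1..q. \<Sum>b=1..q. (d a * s b powr p + d b * s a powr p) * B a b))) (at (s h))"
    unfolding reduced_energy_def
    by (rule derivative_eq_intros sq pw refl | simp)+
  moreover have "(\<Sum>a=1..q. (if a = h then 2 * s h else 0) * A a) = 2 * s h * A h"
    using h by (simp add: if_distrib[of "\<lambda>x. x * _"] sum.delta cong: if_cong)
  moreover have "(\<Sum>a=1..q. \<Sum>b=1..q. (d a * s b powr p + d b * s a powr p) * B a b)
      = 2 * (p * s h powr (p - 1) * (\<Sum>k=1..q. s k powr p * B h k))"
  proof -
    have "(\<Sum>a=1..q. \<Sum>b=1..q. (d a * s b powr p + d b * s a powr p) * B a b)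
        = (\<Sum>a=1..q. \<Sum>b=1..q. d a * s b powr p * B a b) + (\<Sum>a=1..q. \<Sum>b=1..q. d b * s a powr p * B a b)"
      by (simp add: sum.distrib distrib_right)
    also have "(\<Sum>a=1..q. \<Sum>b=1..q. d b * s a powr p * B a b) = (\<Sum>b=1..q. \<Sum>a=1..q. d b * s a powr p * B b a)"
      by (subst sum.swap) (intro sum.cong refl, simp add: sym)
    also have "(\<Sum>a=1..q. \<Sum>b=1..q. d a * s b powr p * B a b) = (\<Sum>a=1..q. d a * (\<Sum>b=1..q. s b powr p * B a b))"
      by (simp add: sum_distrib_left mult.assoc)
    also have "\<dots> = p * s h powr (p - 1) * (\<Sum>k=1..q. s k powr p * B h k)"
      using h by (simp add: d_def if_distrib[of "\<lambda>x. x * _"] sum.delta cong: if_cong)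
    finally show ?thesis by simp
  qed
  ultimately show ?thesis
    using p by (simp add: mult.assoc)
qed

lemma reduced_energy_close:
  assumes p: "p > 1" and s: "s \<in> scaling_box" and "\<delta> \<ge> 0"
    and A: "\<And>h. h \<in> {1..q} \<Longrightarrow> \<bar>A' h - A h\<bar> \<le> \<delta>"
    and B: "\<And>h k. h \<in> {1..q} \<Longrightarrow> k \<in> {1..q} \<Longrightarrow> \<bar>B' h k - B h k\<bar> \<le> \<delta>"
  shows "\<bar>reduced_energy q p A' B' s - reduced_energy q p A B s\<bar> \<le> (2 * real q + real q * real q * 4 powr p) * \<delta>"
proof -
  have s2: "0 \<le> s h" "s h \<le> 2" for h using scaling_boxD[OF s, of h] by auto
  have "reduced_energy q p A' B' s - reduced_energy q p A B s
      = 1 / 2 * (\<Sum>h=1..q. (s h)\<^sup>2 * (A' h - A h))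
        - 1 / (2 * p) * (\<Sum>h=1..q. \<Sum>k=1..q. s h powr p * s k powr p * (B' h k - B h k))"
    by (simp add: reduced_energy_def sum_subtractf right_diff_distrib)
  moreover have "\<bar>\<Sum>h=1..q. (s h)\<^sup>2 * (A' h - A h)\<bar> \<le> q * (4 * \<delta>)"
  proof -
    have "\<bar>\<Sum>h=1..q. (s h)\<^sup>2 * (A' h - A h)\<bar> \<le> (\<Sum>h=1..q. 4 * \<delta>)"
    proof (rule order_trans[OF sum_abs sum_mono])
      fix h assume h: "h \<in> {1..q}"
      have "(s h)\<^sup>2 \<le> 2\<^sup>2" using s2 by (intro power_mono) auto
      then show "\<bar>(s h)\<^sup>2 * (A' h - A h)\<bar> \<le> 4 * \<delta>"
        unfolding abs_mult using A[OF h] by (intro mult_mono) auto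
    qed
    then show ?thesis by simp
  qed
  moreover have "\<bar>\<Sum>h=1..q. \<Sum>k=1..q. s h powr p * s k powr p * (B' h k - B h k)\<bar> \<le> q * q * (4 powr p * \<delta>)"
  proof -
    have "\<bar>\<Sum>h=1..q. \<Sum>k=1..q. s h powr p * s k powr p * (B' h k - B h k)\<bar>
        \<le> (\<Sum>h=1..q. \<Sum>k=1..q. 4 powr p * \<delta>)"
    proof (rule order_trans[OF sum_abs sum_mono], rule order_trans[OF sum_abs sum_mono])
      fix h k assume h: "h \<in> {1..q}" "k \<in> {1..q}"
      have "s h powr p * s k powr p = (s h * s k) powr p" using s2 by (simp add: powr_mult)
      also have "\<dots> \<le> (2 * 2) powr p" using s2 p by (intro powr_mono2 mult_mono) auto
      finally show "\<bar>s h powr p * s k powr p * (B' h k - B h k)\<bar> \<le> 4 powr p * \<delta>"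
        unfolding abs_mult[of "_ * _" "_ - _"] using B[OF h] by (intro mult_mono) auto
    qed
    then show ?thesis by simp
  qed
  ultimately have le: "\<bar>reduced_energy q p A' B' s - reduced_energy q p A B s\<bar>
      \<le> 1 / 2 * (q * (4 * \<delta>)) + 1 / (2 * p) * (q * q * (4 powr p * \<delta>))"
  proof -
    have *: "\<bar>1 / 2 * X - 1 / (2 * p) * Y\<bar> \<le> 1 / 2 * a + 1 / (2 * p) * b"
      if "\<bar>X\<bar> \<le> a" "\<bar>Y\<bar> \<le> b" for X Y a b :: real
    proof -
      have "\<bar>1 / (2 * p) * Y\<bar> \<le> 1 / (2 * p) * b"
        unfolding abs_mult using that p by (intro mult_mono) auto
      then show ?thesis using that by linarith
    qed
    show ?thesis if "reduced_energy q p A' B' s - reduced_energy q p A B s = 1 / 2 * X - 1 / (2 * p) * Y"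
      "\<bar>X\<bar> \<le> q * (4 * \<delta>)" "\<bar>Y\<bar> \<le> q * q * (4 powr p * \<delta>)" for X Y
      unfolding that(1) by (rule *) (use that in auto)
  qed
  have "1 / (2 * p) * (q * q * (4 powr p * \<delta>)) \<le> 1 * (q * q * (4 powr p * \<delta>))"
    using p \<open>\<delta> \<ge> 0\<close> by (intro mult_right_mono) auto
  with le show ?thesis by (simp add: algebra_simps)
qed

text \<open>
  A perturbed \<open>F\<close> differs from \<open>F\<close> uniformly little on the cube, so it cannot attain its maximum where
  \<open>F\<close> is below \<open>F(1)\<close> by a fixed gap.  The maximum is therefore interior in every coordinate
  and a critical point, which after multiplication by \<open>s\<^sub>h\<close> is the Nehari condition for the
  scaled vector.
\<close>

lemma (in balanced_form) nehari_projection_near: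
  "\<exists>\<delta>>0. \<forall>A' B'. (\<forall>h\<in>{1..q}. \<bar>A' h - A h\<bar> < \<delta>) \<longrightarrow> (\<forall>h\<in>{1..q}. \<forall>k\<in>{1..q}. \<bar>B' h k - B h k\<bar> < \<delta>) \<longrightarrow>
     (\<forall>h\<in>{1..q}. \<forall>k\<in>{1..q}. B' h k = B' k h) \<longrightarrow>
     (\<exists>s\<in>scaling_box. \<forall>h\<in>{1..q}. A' h > 0 \<and>
        (s h)\<^sup>2 * A' h = (\<Sum>k=1..q. s h powr p * s k powr p * B' h k))"
proof -
  obtain \<eta> where \<eta>: "\<eta> > 0" and gap: "\<And>s. s \<in> scaling_box \<Longrightarrow> \<exists>h\<in>{1..q}. s h = 1/2 \<or> s h = 2 \<Longrightarrow>
      reduced_energy q p A B s \<le> reduced_energy q p A B (\<lambda>_. 1) - \<eta>"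
    using reduced_energy_boundary_gap by blast
  define c where "c = 2 * real q + real q * real q * 4 powr p"
  have c: "c \<ge> 0" by (simp add: c_def)
  define m where "m = Min (insert 1 (A ` {1..q}))"
  have m: "m > 0" "\<And>h. h \<in> {1..q} \<Longrightarrow> m \<le> A h"
    using A_pos unfolding m_def by (auto simp del: Min_insert intro!: Min_le)
  (* The bound m keeps the perturbed A positive; the other one makes twice the uniform distance of the
     two functions smaller than the boundary gap. *)
  define \<delta> where "\<delta> = min m (\<eta> / (2 * c + 1) / 2)"
  have \<delta>: "\<delta> > 0" using \<eta> c m by (simp add: \<delta>_def)
  have "2 * (c * \<delta>) \<le> 2 * (c * (\<eta> / (2 * c + 1) / 2))"
    using c by (intro mult_left_mono) (auto simp: \<delta>_def)
  also have "\<dots> < \<eta>" using \<eta> c by (simp add: field_simps add_pos_nonneg)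
  finally have c\<delta>: "2 * (c * \<delta>) < \<eta>" .
  have one: "(\<lambda>_. 1) \<in> scaling_box" by (auto simp: scaling_box_def)
  show ?thesis
  proof (intro exI[of _ \<delta>] conjI allI impI)
    show "\<delta> > 0" by fact
  next
    fix A' B'
    assume A': "\<forall>h\<in>{1..q}. \<bar>A' h - A h\<bar> < \<delta>"
      and B': "\<forall>h\<in>{1..q}. \<forall>k\<in>{1..q}. \<bar>B' h k - B h k\<bar> < \<delta>"
      and sym: "\<forall>h\<in>{1..q}. \<forall>k\<in>{1..q}. B' h k = B' k h"
    have close: "\<bar>reduced_energy q p A' B' s - reduced_energy q p A B s\<bar> \<le> c * \<delta>" if "s \<in> scaling_box" for s
    proof -
      have "\<bar>reduced_energy q p A' B' s - reduced_energy q p A B s\<bar> \<le> (2 * real q + real q * real q * 4 powr p) * \<delta>"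
        by (rule reduced_energy_close[OF p that]) (use A' B' \<delta> in \<open>auto intro: less_imp_le\<close>)
      then show ?thesis by (simp add: c_def)
    qed
    obtain s where s: "s \<in> scaling_box" and
      max: "\<And>r. r \<in> scaling_box \<Longrightarrow> reduced_energy q p A' B' r \<le> reduced_energy q p A' B' s"
      using continuous_attains_sup[OF compact_scaling_box _ continuous_on_reduced_energy[of q p A' B']] one
      by blast
    have sp: "s a > 0" for a using scaling_boxD[OF s, of a] by linarith
    show "\<exists>s\<in>scaling_box. \<forall>h\<in>{1..q}. A' h > 0 \<and>
        (s h)\<^sup>2 * A' h = (\<Sum>k=1..q. s h powr p * s k powr p * B' h k)"
    proof (intro bexI[OF _ s] ballI conjI)
      fix h assume h: "h \<in> {1..q}"
      show "A' h > 0" using A' h m(2)[OF h] by (force simp: \<delta>_def)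
      have "s h \<noteq> 1/2 \<and> s h \<noteq> 2"
      proof (rule ccontr)
        assume "\<not> ?thesis"
        then have "reduced_energy q p A B s \<le> reduced_energy q p A B (\<lambda>_. 1) - \<eta>"
          using gap[OF s] h by blast
        then show False using close[OF s] close[OF one] max[OF one] c\<delta> by linarith
      qed
      then have int: "1/2 < s h" "s h < 2" using scaling_boxD[OF s, of h] by auto
      have "s h * A' h - s h powr (p - 1) * (\<Sum>k=1..q. s k powr p * B' h k) = 0"
      proof (rule DERIV_local_max[OF reduced_energy_partial[OF p sp h]])
        show "0 < min (s h - 1/2) (2 - s h)" using int by simp
        show "\<forall>y. \<bar>s h - y\<bar> < min (s h - 1/2) (2 - s h) \<longrightarrow>
            reduced_energy q p A' B' (s(h := y)) \<le> reduced_energy q p A' B' (s(h := s h))"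
        proof (intro allI impI)
          fix y assume "\<bar>s h - y\<bar> < min (s h - 1/2) (2 - s h)"
          then have "s(h := y) \<in> scaling_box"
            using s by (auto simp: scaling_box_def PiE_iff)
          then show "reduced_energy q p A' B' (s(h := y)) \<le> reduced_energy q p A' B' (s(h := s h))"
            using max by simp
        qed
      qed (use sym in auto)
      then have "s h * (s h * A' h) = s h * s h powr (p - 1) * (\<Sum>k=1..q. s k powr p * B' h k)"
        by simp
      moreover have "s h * s h powr (p - 1) = s h powr p"
        using sp[of h] by (simp add: powr_mult_base)
      ultimately show "(s h)\<^sup>2 * A' h = (\<Sum>k=1..q. s h powr p * s k powr p * B' h k)"
        by (simp add: power2_eq_square sum_distrib_left mult.assoc)
    qed
  qed
qed

section \<open>Interaction integrals\<close>

lemma interaction_commute: "interaction \<Omega> p v w = interaction \<Omega> p w v"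
  by (simp add: interaction_def mult.commute)

lemma interaction_nonneg: "interaction \<Omega> p v w \<ge> 0"
  unfolding interaction_def by (intro integral_nonneg_AE) auto

lemma interaction_scale:
  "interaction \<Omega> p (\<lambda>x. a * v x) (\<lambda>x. b * w x) = \<bar>a\<bar> powr p * \<bar>b\<bar> powr p * interaction \<Omega> p v w"
proof -
  have "\<bar>a * v x\<bar> powr p * \<bar>b * w x\<bar> powr p
      = (\<bar>a\<bar> powr p * \<bar>b\<bar> powr p) * (\<bar>v x\<bar> powr p * \<bar>w x\<bar> powr p)" for x
    by (simp add: abs_mult powr_mult)
  then show ?thesis unfolding interaction_def by simp
qed

lemma interaction_zero_left: "zero_on \<Omega> v \<Longrightarrow> interaction \<Omega> p v w = 0"
  unfolding zero_on_def interaction_def by (rule integral_eq_zero_AE) auto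

lemma interaction_zero_right: "zero_on \<Omega> w \<Longrightarrow> interaction \<Omega> p v w = 0"
  using interaction_zero_left interaction_commute by metis

lemma interaction_self: "interaction \<Omega> p v v = (LINT x|lebesgue_on \<Omega>. norm (v x) powr (2 * p))"
  by (simp add: interaction_def flip: powr_add)

lemma interaction_self_zero_iff:
  fixes v :: "real^'n \<Rightarrow> real"
  assumes "v \<in> Lspace \<Omega> (2 * p)"
  shows "interaction \<Omega> p v v = 0 \<longleftrightarrow> zero_on \<Omega> v"
  unfolding interaction_self zero_on_def using assms
  by (subst integral_nonneg_eq_0_iff_AE) (auto simp: Lspace_def)

text \<open>
  With \<open>a\<close>, \<open>b\<close> the two square roots, the integrand is at most half the sum of the squares weighted by \<open>b/a\<close> and
  \<open>a/b\<close>; integrating gives \<open>a b\<close>.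
\<close>

lemma interaction_Cauchy_Schwarz:
  fixes v w :: "real^'n \<Rightarrow> real"
  assumes v: "v \<in> Lspace \<Omega> (2 * p)" and w: "w \<in> Lspace \<Omega> (2 * p)"
  shows "interaction \<Omega> p v w \<le> sqrt (interaction \<Omega> p v v) * sqrt (interaction \<Omega> p w w)"
proof (cases "zero_on \<Omega> v \<or> zero_on \<Omega> w")
  case True
  then show ?thesis
    by (auto simp: interaction_zero_left interaction_zero_right interaction_nonneg)
next
  case False
  define a where "a = sqrt (interaction \<Omega> p v v)"
  define b where "b = sqrt (interaction \<Omega> p w w)"
  have ab: "a > 0" "b > 0"
    using False interaction_self_zero_iff[OF v] interaction_self_zero_iff[OF w]
      interaction_nonneg[of \<Omega> p v v] interaction_nonneg[of \<Omega> p w w]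
    by (auto simp: a_def b_def)
  have sq: "\<bar>t\<bar> powr (2 * p) = (\<bar>t\<bar> powr p)\<^sup>2" for t :: real
    by (simp add: power2_eq_square flip: powr_add)
  have iv: "integrable (lebesgue_on \<Omega>) (\<lambda>x. b / a / 2 * \<bar>v x\<bar> powr (2 * p))"
    and iw: "integrable (lebesgue_on \<Omega>) (\<lambda>x. a / b / 2 * \<bar>w x\<bar> powr (2 * p))"
    using v w by (auto simp: Lspace_def)
  have [measurable]: "v \<in> borel_measurable (lebesgue_on \<Omega>)" "w \<in> borel_measurable (lebesgue_on \<Omega>)"
    using v w by (auto simp: Lspace_def)
  have le: "\<bar>v x\<bar> powr p * \<bar>w x\<bar> powr p
      \<le> b / a / 2 * \<bar>v x\<bar> powr (2 * p) + a / b / 2 * \<bar>w x\<bar> powr (2 * p)" for x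
  proof -
    have "0 \<le> (b * \<bar>v x\<bar> powr p - a * \<bar>w x\<bar> powr p)\<^sup>2 / (2 * a * b)"
      using ab by simp
    also have "\<dots> = b / a / 2 * (\<bar>v x\<bar> powr p)\<^sup>2 + a / b / 2 * (\<bar>w x\<bar> powr p)\<^sup>2
        - \<bar>v x\<bar> powr p * \<bar>w x\<bar> powr p"
      using ab by (simp add: power2_eq_square field_simps)
    finally show ?thesis by (simp add: sq)
  qed
  have int: "integrable (lebesgue_on \<Omega>) (\<lambda>x. \<bar>v x\<bar> powr p * \<bar>w x\<bar> powr p)"
    by (rule Bochner_Integration.integrable_bound[OF Bochner_Integration.integrable_add[OF iv iw]])
       (use le in \<open>auto intro!: AE_I2 order_trans[OF _ abs_ge_self]\<close>)
  have "interaction \<Omega> p v w \<le> (LINT x|lebesgue_on \<Omega>. b / a / 2 * \<bar>v x\<bar> powr (2 * p) + a / b / 2 * \<bar>w x\<bar> powr (2 * p))"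
    unfolding interaction_def by (rule integral_mono[OF int Bochner_Integration.integrable_add[OF iv iw] le])
  also have "\<dots> = b / a / 2 * interaction \<Omega> p v v + a / b / 2 * interaction \<Omega> p w w"
    using iv iw by (subst Bochner_Integration.integral_add) (auto simp: interaction_self)
  also have "interaction \<Omega> p v v = a\<^sup>2" by (simp add: a_def interaction_nonneg)
  also have "interaction \<Omega> p w w = b\<^sup>2" by (simp add: b_def interaction_nonneg)
  also have "b / a / 2 * a\<^sup>2 + a / b / 2 * b\<^sup>2 = a * b"
    using ab by (simp add: power2_eq_square field_simps)
  finally show ?thesis by (simp add: a_def b_def)
qed

section \<open>The energy as a function of the block scalings\<close>

locale block_partition =
  fixes l q :: nat and L :: "nat \<Rightarrow> nat"
  assumes L_0: "L 0 = 0" and L_step: "\<And>h. h < q \<Longrightarrow> L h < L (Suc h)" and L_q: "L q = l"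
begin

lemma L_mono: "h \<le> k \<Longrightarrow> k \<le> q \<Longrightarrow> L h \<le> L k"
proof (induction k)
  case (Suc k)
  then show ?case using L_step[of k] by (cases "h = Suc k") auto
qed simp

lemma sum_blocks_upto: "m \<le> q \<Longrightarrow> (\<Sum>i=1..L m. f i) = (\<Sum>h=1..m. \<Sum>i\<in>block L h. f i)"
  for f :: "nat \<Rightarrow> real"
proof (induction m)
  case 0 then show ?case by (simp add: L_0)
next
  case (Suc m)
  have "{1..L (Suc m)} = {1..L m} \<union> block L (Suc m)"
    using L_step[of m] Suc.prems by (auto simp: block_def)
  moreover have "{1..L m} \<inter> block L (Suc m) = {}" by (auto simp: block_def)
  ultimately show ?case using Suc by (simp add: sum.union_disjoint block_def)
qed

lemma sum_blocks: "(\<Sum>i=1..l. f i) = (\<Sum>h=1..q. \<Sum>i\<in>block L h. f i)" for f :: "nat \<Rightarrow> real"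
  using sum_blocks_upto[of q f] by (simp add: L_q)

lemma finite_block [simp]: "finite (block L h)"
  by (simp add: block_def)

lemma block_subset: "h \<in> {1..q} \<Longrightarrow> i \<in> block L h \<Longrightarrow> i \<in> {1..l}"
  using L_mono[of h q] L_q by (auto simp: block_def)

lemma block_nonempty: "h \<in> {1..q} \<Longrightarrow> block L h \<noteq> {}"
  using L_step[of "h - 1"] by (auto simp: block_def)

text \<open>
  The block ends increase, so \<open>i\<close> lies in the first block whose end reaches it.
\<close>

definition blk :: "nat \<Rightarrow> nat" where "blk i = (LEAST h. i \<le> L h)"

lemma blk_eq: "h \<in> {1..q} \<Longrightarrow> i \<in> block L h \<Longrightarrow> blk i = h"
  unfolding blk_def
proof (rule Least_equality)
  assume h: "h \<in> {1..q}" "i \<in> block L h"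
  then show "i \<le> L h" by (simp add: block_def)
  fix k assume "i \<le> L k"
  show "h \<le> k"
  proof (rule ccontr)
    assume "\<not> h \<le> k"
    then have "L k \<le> L (h - 1)" using h by (intro L_mono) auto
    then show False using h \<open>i \<le> L k\<close> by (simp add: block_def)
  qed
qed

lemma ex_block: "i \<in> {1..l} \<Longrightarrow> \<exists>h\<in>{1..q}. i \<in> block L h"
proof -
  assume i: "i \<in> {1..l}"
  define h where "h = (LEAST h. i \<le> L h)"
  have "i \<le> L h" unfolding h_def by (rule LeastI[of _ q]) (use i L_q in auto)
  moreover have "h \<le> q" unfolding h_def by (rule Least_le) (use i L_q in auto)
  moreover have "h \<noteq> 0" using \<open>i \<le> L h\<close> i L_0 by (cases "h = 0") auto
  moreover have "\<not> i \<le> L (h - 1)" using not_less_Least[of "h - 1" "\<lambda>h. i \<le> L h"] \<open>h \<noteq> 0\<close>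
    by (simp add: h_def)
  ultimately show ?thesis by (intro bexI[of _ h]) (auto simp: block_def)
qed

lemma card_block: "h \<in> {1..q} \<Longrightarrow> real (card (block L h)) = real (L h) - real (L (h - 1))"
proof -
  assume "h \<in> {1..q}"
  then have "h - 1 < q" "Suc (h - 1) = h" by auto
  then have "L (h - 1) < L h" using L_step[of "h - 1"] by simp
  then show ?thesis by (simp add: block_def of_nat_diff)
qed

lemma sum_other_blocks:
  fixes f :: "nat \<Rightarrow> real"
  assumes h: "h \<in> {1..q}"
  shows "(\<Sum>m\<in>{1..l} - block L h. f m) = (\<Sum>k\<in>{1..q} - {h}. \<Sum>m\<in>block L k. f m)"
proof -
  have "(\<Sum>m\<in>{1..l} - block L h. f m) = (\<Sum>m=1..l. f m) - (\<Sum>m\<in>block L h. f m)"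
    using block_subset[OF h] by (subst sum_diff) auto
  also have "\<dots> = (\<Sum>k\<in>{1..q} - {h}. \<Sum>m\<in>block L k. f m)"
    using h by (simp add: sum_blocks sum_diff1)
  finally show ?thesis .
qed

end

text \<open>
  All that the variational argument needs to know about the function space.  The number \<open>\<kappa>\<close> is the
  constant of the embedding into \<open>L\<^sup>2\<^sup>p\<close>, raised to the power \<open>p\<close> and common to all norms.
\<close>

locale coupled_system =
  fixes \<Omega> :: "(real^'n) set" and H :: "(real^'n \<Rightarrow> real) set"
    and l q :: nat and p :: real and lam :: "nat \<Rightarrow> real"
    and \<beta> :: "nat \<Rightarrow> nat \<Rightarrow> real" and L :: "nat \<Rightarrow> nat" and \<kappa> :: real
  assumes p: "1 < p"
    and decomp: "block_decomposition l q L \<beta>"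
    and H_Lspace: "\<And>v. v \<in> H \<Longrightarrow> v \<in> Lspace \<Omega> (2 * p)"
    and H_scale: "\<And>v t. v \<in> H \<Longrightarrow> (\<lambda>x. t * v x) \<in> H"
    and norm_nonneg: "\<And>i v. i \<in> {1..l} \<Longrightarrow> v \<in> H \<Longrightarrow> norm_lam \<Omega> (lam i) v \<ge> 0"
    and norm_eq_0: "\<And>i v. i \<in> {1..l} \<Longrightarrow> v \<in> H \<Longrightarrow> norm_lam \<Omega> (lam i) v = 0 \<longleftrightarrow> zero_on \<Omega> v"
    and norm_scale: "\<And>i v t. i \<in> {1..l} \<Longrightarrow> v \<in> H \<Longrightarrow>
        norm_lam \<Omega> (lam i) (\<lambda>x. t * v x) = \<bar>t\<bar> * norm_lam \<Omega> (lam i) v"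
    and \<kappa>: "\<kappa> > 0"
    and embedding: "\<And>i v. i \<in> {1..l} \<Longrightarrow> v \<in> H \<Longrightarrow>
        sqrt (interaction \<Omega> p v v) \<le> \<kappa> * norm_lam \<Omega> (lam i) v powr p"
begin

sublocale block_partition l q L
  using decomp by unfold_locales (auto simp: block_decomposition_def)

lemma \<beta>_sym: "i \<in> {1..l} \<Longrightarrow> j \<in> {1..l} \<Longrightarrow> \<beta> i j = \<beta> j i"
  using decomp by (auto simp: block_decomposition_def)

lemma \<beta>_diag: "i \<in> {1..l} \<Longrightarrow> \<beta> i i > 0"
  using decomp by (auto simp: block_decomposition_def)

lemma \<beta>_in: "h \<in> {1..q} \<Longrightarrow> i \<in> block L h \<Longrightarrow> j \<in> block L h \<Longrightarrow> \<beta> i j \<ge> 0"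
  using decomp unfolding block_decomposition_def by blast

lemma \<beta>_out: "h \<in> {1..q} \<Longrightarrow> k \<in> {1..q} \<Longrightarrow> h \<noteq> k \<Longrightarrow> i \<in> block L h \<Longrightarrow> j \<in> block L k \<Longrightarrow> \<beta> i j \<le> 0"
  using decomp unfolding block_decomposition_def by blast

abbreviation "nlam i v \<equiv> norm_lam \<Omega> (lam i) v"
abbreviation "itr v w \<equiv> interaction \<Omega> p v w"

definition block_sq :: "(nat \<Rightarrow> real^'n \<Rightarrow> real) \<Rightarrow> nat \<Rightarrow> real" where
  "block_sq u h = (\<Sum>i\<in>block L h. (nlam i (u i))\<^sup>2)"

definition block_coupling :: "(nat \<Rightarrow> real^'n \<Rightarrow> real) \<Rightarrow> nat \<Rightarrow> nat \<Rightarrow> real" where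
  "block_coupling u h k = (\<Sum>i\<in>block L h. \<Sum>j\<in>block L k. \<beta> i j * itr (u i) (u j))"

definition scaled :: "(nat \<Rightarrow> real) \<Rightarrow> (nat \<Rightarrow> real^'n \<Rightarrow> real) \<Rightarrow> nat \<Rightarrow> real^'n \<Rightarrow> real" where
  "scaled s u i = (\<lambda>x. s (blk i) * u i x)"

lemma block_sq_nonneg: "block_sq u h \<ge> 0"
  by (simp add: block_sq_def sum_nonneg)

lemma block_norm_sq: "(block_norm \<Omega> lam L h u)\<^sup>2 = block_sq u h"
  by (simp add: block_norm_def block_sq_def sum_nonneg)

lemma block_norm_eq_0: "block_norm \<Omega> lam L h u = 0 \<longleftrightarrow> block_sq u h = 0"
  by (simp add: block_norm_def block_sq_def)

lemma block_coupling_sym: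
  assumes "h \<in> {1..q}" "k \<in> {1..q}"
  shows "block_coupling u h k = block_coupling u k h"
proof -
  have "block_coupling u h k = (\<Sum>j\<in>block L k. \<Sum>i\<in>block L h. \<beta> i j * itr (u i) (u j))"
    unfolding block_coupling_def by (rule sum.swap)
  also have "\<dots> = block_coupling u k h" unfolding block_coupling_def
    using block_subset assms by (intro sum.cong refl) (simp add: \<beta>_sym interaction_commute[of _ _ "u _" "u _"] cong: sum.cong)
  finally show ?thesis .
qed

lemma block_coupling_off:
  assumes "h \<in> {1..q}" "k \<in> {1..q}" "h \<noteq> k"
  shows "block_coupling u h k \<le> 0"
  unfolding block_coupling_def using \<beta>_out[OF assms]
  by (intro sum_nonpos) (auto simp: mult_nonpos_nonneg interaction_nonneg)

lemma block_deriv_eq: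
  "h \<in> {1..q} \<Longrightarrow> block_deriv \<Omega> l p lam \<beta> L h u = block_sq u h - (\<Sum>k=1..q. block_coupling u h k)"
  unfolding block_deriv_def block_norm_sq block_coupling_def sum_blocks
  by (subst (2) sum.swap) simp

lemma energy_eq: "energy \<Omega> l p lam \<beta> u = reduced_energy q p (block_sq u) (block_coupling u) (\<lambda>_. 1)"
proof -
  have "(\<Sum>i=1..l. \<Sum>j=1..l. \<beta> i j * itr (u i) (u j)) = (\<Sum>h=1..q. \<Sum>k=1..q. block_coupling u h k)"
    unfolding block_coupling_def sum_blocks by (intro sum.cong refl sum.swap)
  then show ?thesis
    unfolding energy_def reduced_energy_def by (simp add: sum_blocks block_sq_def)
qed

lemma block_sq_scaled:
  assumes "\<And>i. i \<in> {1..l} \<Longrightarrow> u i \<in> H" "h \<in> {1..q}"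
  shows "block_sq (scaled s u) h = (s h)\<^sup>2 * block_sq u h"
  unfolding block_sq_def scaled_def sum_distrib_left
  using assms block_subset[of h] blk_eq[of h]
  by (intro sum.cong refl) (auto simp: norm_scale power_mult_distrib)

lemma block_coupling_scaled:
  assumes "\<And>h. s h > 0" "h \<in> {1..q}" "k \<in> {1..q}"
  shows "block_coupling (scaled s u) h k = s h powr p * s k powr p * block_coupling u h k"
  unfolding block_coupling_def scaled_def sum_distrib_left interaction_scale
  using assms(1)[of h] assms(1)[of k]
  by (intro sum.cong refl) (auto simp: blk_eq[OF assms(2)] blk_eq[OF assms(3)])

lemma energy_scaled:
  assumes "\<And>i. i \<in> {1..l} \<Longrightarrow> u i \<in> H" "\<And>h. s h > 0"
  shows "energy \<Omega> l p lam \<beta> (scaled s u) = reduced_energy q p (block_sq u) (block_coupling u) s"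
proof -
  have "(\<Sum>h=1..q. 1\<^sup>2 * block_sq (scaled s u) h) = (\<Sum>h=1..q. (s h)\<^sup>2 * block_sq u h)"
    using block_sq_scaled[of u] assms(1) by (intro sum.cong refl) simp
  moreover have "(\<Sum>h=1..q. \<Sum>k=1..q. 1 powr p * 1 powr p * block_coupling (scaled s u) h k)
      = (\<Sum>h=1..q. \<Sum>k=1..q. s h powr p * s k powr p * block_coupling u h k)"
    using block_coupling_scaled[of s] assms(2) by (intro sum.cong refl) simp
  ultimately show ?thesis unfolding energy_eq reduced_energy_def by simp
qed

lemma nehari_iff:
  "u \<in> nehari \<Omega> H l q p lam \<beta> L \<longleftrightarrow> (\<forall>i\<in>{1..l}. u i \<in> H) \<and>
     (\<forall>h\<in>{1..q}. block_sq u h > 0 \<and> block_sq u h = (\<Sum>k=1..q. block_coupling u h k))"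
proof -
  have "block_sq u h \<noteq> 0 \<longleftrightarrow> block_sq u h > 0" for h using block_sq_nonneg[of u h] by auto
  then show ?thesis
    unfolding nehari_def block_norm_eq_0 by (auto simp: block_deriv_eq)
qed

lemma nehari_scaled:
  assumes "\<And>i. i \<in> {1..l} \<Longrightarrow> u i \<in> H" "\<And>h. s h > 0"
    and "\<And>h. h \<in> {1..q} \<Longrightarrow> block_sq u h > 0"
    and "\<And>h. h \<in> {1..q} \<Longrightarrow> (s h)\<^sup>2 * block_sq u h = (\<Sum>k=1..q. s h powr p * s k powr p * block_coupling u h k)"
  shows "scaled s u \<in> nehari \<Omega> H l q p lam \<beta> L"
  unfolding nehari_iff
proof (intro conjI ballI)
  fix h assume h: "h \<in> {1..q}"
  have A: "block_sq (scaled s u) h = (s h)\<^sup>2 * block_sq u h"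
    using assms(1) h by (rule block_sq_scaled)
  show "block_sq (scaled s u) h > 0"
    unfolding A using assms(2)[of h] assms(3)[OF h] by simp
  show "block_sq (scaled s u) h = (\<Sum>k=1..q. block_coupling (scaled s u) h k)"
    unfolding A assms(4)[OF h] using block_coupling_scaled[OF assms(2) h] by (intro sum.cong refl) simp
qed (simp add: scaled_def assms(1) H_scale)

lemma nehari_balanced:
  assumes "u \<in> nehari \<Omega> H l q p lam \<beta> L"
  shows "balanced_form q p (block_sq u) (block_coupling u)"
  using assms p unfolding nehari_iff by unfold_locales (blast intro: block_coupling_off block_coupling_sym)+

lemma energy_nehari:
  assumes "u \<in> nehari \<Omega> H l q p lam \<beta> L"
  shows "energy \<Omega> l p lam \<beta> u = (1/2 - 1/(2*p)) * (\<Sum>h=1..q. block_sq u h)"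
  unfolding energy_eq by (rule balanced_form.reduced_energy_one[OF nehari_balanced[OF assms]])

text \<open>
  The equation for \<open>u\<^sub>i\<close> tested with \<open>u\<^sub>i\<close> itself.
\<close>

lemma weak_solution_testing:
  assumes u: "weak_solution \<Omega> H l p lam \<beta> u" and i: "i \<in> {1..l}"
  shows "(nlam i (u i))\<^sup>2 = (\<Sum>j=1..l. \<beta> i j * itr (u i) (u j))"
proof -
  let ?Q = "LINT x|lebesgue_on \<Omega>. (norm (weak_grad \<Omega> (u i) x))\<^sup>2 + lam i * (u i x)\<^sup>2"
  have ui: "u i \<in> H" using u i by (simp add: weak_solution_def)
  have "?Q \<ge> 0" using norm_nonneg[OF i ui] by (simp add: norm_lam_def)
  then have "(nlam i (u i))\<^sup>2 = ?Q" by (simp add: norm_lam_def)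
  also have "\<dots> = (LINT x|lebesgue_on \<Omega>. weak_grad \<Omega> (u i) x \<bullet> weak_grad \<Omega> (u i) x + lam i * u i x * u i x)"
    by (simp only: power2_norm_eq_inner power2_eq_square[of "u i _"] mult.assoc)
  also have "\<dots> = (\<Sum>j=1..l. \<beta> i j * (LINT x|lebesgue_on \<Omega>.
                   \<bar>u j x\<bar> powr p * (\<bar>u i x\<bar> powr (p - 2) * u i x) * u i x))"
    using u i ui unfolding weak_solution_def by blast
  also have "\<dots> = (\<Sum>j=1..l. \<beta> i j * itr (u i) (u j))"
  proof -
    have "\<bar>t\<bar> powr (p - 2) * t * t = \<bar>t\<bar> powr p" for t :: real
    proof (cases "t = 0")
      case False
      have "t * t = \<bar>t\<bar> powr 2" using False by (simp add: power2_eq_square powr_numeral)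
      then have "\<bar>t\<bar> powr (p - 2) * t * t = \<bar>t\<bar> powr (p - 2) * \<bar>t\<bar> powr 2"
        by (simp only: mult.assoc)
      then show ?thesis by (simp only: powr_add[symmetric]) simp
    qed simp
    then have "\<bar>u j x\<bar> powr p * (\<bar>u i x\<bar> powr (p - 2) * u i x) * u i x = \<bar>u i x\<bar> powr p * \<bar>u j x\<bar> powr p" for j x
      by (metis mult.assoc mult.commute)
    then show ?thesis by (simp only: interaction_def)
  qed
  finally show ?thesis .
qed

lemma least_energy_nehari:
  assumes u: "least_energy_solution \<Omega> H l q p lam \<beta> L u"
  shows "u \<in> nehari \<Omega> H l q p lam \<beta> L"
    and "\<And>w. w \<in> nehari \<Omega> H l q p lam \<beta> L \<Longrightarrow> energy \<Omega> l p lam \<beta> u \<le> energy \<Omega> l p lam \<beta> w"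
proof -
  have ws: "weak_solution \<Omega> H l p lam \<beta> u" and bn: "blockwise_nontrivial \<Omega> q L u"
    using u by (auto simp: least_energy_solution_def)
  have uH: "\<And>i. i \<in> {1..l} \<Longrightarrow> u i \<in> H" using ws by (auto simp: weak_solution_def)
  show "u \<in> nehari \<Omega> H l q p lam \<beta> L"
    unfolding nehari_iff
  proof (intro conjI ballI)
    fix h assume h: "h \<in> {1..q}"
    obtain i where i: "i \<in> block L h" "\<not> zero_on \<Omega> (u i)"
      using bn h unfolding blockwise_nontrivial_def by blast
    have "nlam i (u i) \<noteq> 0" using norm_eq_0 uH block_subset[OF h i(1)] i by auto
    then show "block_sq u h > 0" unfolding block_sq_def
      using i by (intro sum_pos2[of _ i]) auto
    have "block_sq u h = (\<Sum>i\<in>block L h. \<Sum>j=1..l. \<beta> i j * itr (u i) (u j))"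
      unfolding block_sq_def using block_subset[OF h] by (intro sum.cong refl weak_solution_testing[OF ws]) auto
    also have "\<dots> = (\<Sum>k=1..q. block_coupling u h k)"
      unfolding block_coupling_def sum_blocks by (rule sum.swap)
    finally show "block_sq u h = (\<Sum>k=1..q. block_coupling u h k)" .
  qed (use uH in auto)
  fix w assume w: "w \<in> nehari \<Omega> H l q p lam \<beta> L"
  have "bdd_below (energy \<Omega> l p lam \<beta> ` nehari \<Omega> H l q p lam \<beta> L)"
  proof (rule bdd_belowI2[of _ 0])
    fix v assume "v \<in> nehari \<Omega> H l q p lam \<beta> L"
    then show "0 \<le> energy \<Omega> l p lam \<beta> v"
      using p by (simp add: energy_nehari sum_nonneg block_sq_nonneg divide_simps)
  qed
  then show "energy \<Omega> l p lam \<beta> u \<le> energy \<Omega> l p lam \<beta> w"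
    using u w by (auto simp: least_energy_solution_def intro: cINF_lower)
qed

section \<open>Bounds for the components of a minimiser\<close>

text \<open>
  The competitor has, in each block \<open>k\<close>, the bump \<open>\<psi>\<^sub>k\<close> in the component with the largest \<open>\<beta>\<^sub>i\<^sub>i\<close> and
  zero elsewhere.  As the bumps do not interact, the Nehari conditions decouple and are solved by
  an explicit scaling; its energy is proportional to \<open>\<beta>\<^sub>i\<^sub>i\<close> to the power \<open>-1/(p-1)\<close>, whence the
  bound in terms of the smallest of the block maxima.
\<close>

lemma energy_bound:
  assumes u: "u \<in> nehari \<Omega> H l q p lam \<beta> L"
    and min: "\<And>w. w \<in> nehari \<Omega> H l q p lam \<beta> L \<Longrightarrow> energy \<Omega> l p lam \<beta> u \<le> energy \<Omega> l p lam \<beta> w"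
    and \<psi>: "\<And>k. k \<in> {1..q} \<Longrightarrow> \<psi> k \<in> H" "\<And>k. k \<in> {1..q} \<Longrightarrow> \<not> zero_on \<Omega> (\<psi> k)"
    and disj: "\<And>k m. k \<in> {1..q} \<Longrightarrow> m \<in> {1..q} \<Longrightarrow> k \<noteq> m \<Longrightarrow> itr (\<psi> k) (\<psi> m) = 0"
    and q: "q \<ge> 1"
  shows "minmax_diag q L \<beta> > 0"
    and "(\<Sum>h=1..q. block_sq u h) \<le> (\<Sum>k=1..q. \<Sum>i=1..l. nlam i (\<psi> k) powr (2 * p / (p - 1)) /
            itr (\<psi> k) (\<psi> k) powr (1 / (p - 1))) * minmax_diag q L \<beta> powr (- 1 / (p - 1))"
proof -
  define \<mu> where "\<mu> = minmax_diag q L \<beta>"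
  define b where "b k = (MAX i\<in>block L k. \<beta> i i)" for k
  have "\<exists>i\<in>block L k. \<beta> i i = b k" if "k \<in> {1..q}" for k
  proof -
    have "b k \<in> (\<lambda>i. \<beta> i i) ` block L k"
      unfolding b_def using block_nonempty[OF that] by (intro Max_in) auto
    then show ?thesis by force
  qed
  then obtain \<iota> where \<iota>: "\<And>k. k \<in> {1..q} \<Longrightarrow> \<iota> k \<in> block L k" "\<And>k. k \<in> {1..q} \<Longrightarrow> \<beta> (\<iota> k) (\<iota> k) = b k"
    by metis
  have \<iota>l: "\<iota> k \<in> {1..l}" if "k \<in> {1..q}" for k using block_subset[OF that \<iota>(1)[OF that]] .
  have b_pos: "b k > 0" if "k \<in> {1..q}" for k using \<iota>(2)[OF that] \<beta>_diag[OF \<iota>l[OF that]] by simp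
  have "\<mu> \<in> b ` {1..q}" unfolding \<mu>_def minmax_diag_def b_def[symmetric] using q by (intro Min_in) auto
  then show \<mu>_pos: "\<mu> > 0" using b_pos by auto
  have \<mu>_le: "\<mu> \<le> b k" if "k \<in> {1..q}" for k
    unfolding \<mu>_def minmax_diag_def b_def[symmetric] using that by (intro Min_le) auto
  define n where "n k = nlam (\<iota> k) (\<psi> k)" for k
  define I where "I k = itr (\<psi> k) (\<psi> k)" for k
  have n_pos: "n k > 0" if "k \<in> {1..q}" for k
    using norm_eq_0[OF \<iota>l[OF that] \<psi>(1)[OF that]] norm_nonneg[OF \<iota>l[OF that] \<psi>(1)[OF that]] \<psi>(2)[OF that]
    by (simp add: n_def)
  have I_pos: "I k > 0" if "k \<in> {1..q}" for k
    using interaction_self_zero_iff[OF H_Lspace[OF \<psi>(1)[OF that]]] \<psi>(2)[OF that]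
      interaction_nonneg[of \<Omega> p "\<psi> k" "\<psi> k"] by (simp add: I_def less_le)
  define w where "w i = (if i = \<iota> (blk i) then \<psi> (blk i) else (\<lambda>x. 0 * \<psi> 1 x))" for i
  have zero: "zero_on \<Omega> (\<lambda>x. 0 * \<psi> 1 x)" by (simp add: zero_on_def)
  have wH: "w i \<in> H" if "i \<in> {1..l}" for i
    using ex_block[OF that] blk_eq[of _ i] \<psi>(1) H_scale[OF \<psi>(1), of 1 0] q
    by (auto simp: w_def)
  have w\<iota>: "w (\<iota> k) = \<psi> k" if "k \<in> {1..q}" for k
    using blk_eq[OF that \<iota>(1)[OF that]] by (simp add: w_def)
  have w0: "zero_on \<Omega> (w i)" if "k \<in> {1..q}" "i \<in> block L k" "i \<noteq> \<iota> k" for i k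
    using blk_eq[OF that(1,2)] that(3) zero by (simp add: w_def)
  have Aw: "block_sq w k = (n k)\<^sup>2" if k: "k \<in> {1..q}" for k
  proof -
    have "block_sq w k = (nlam (\<iota> k) (w (\<iota> k)))\<^sup>2 + (\<Sum>i\<in>block L k - {\<iota> k}. (nlam i (w i))\<^sup>2)"
      unfolding block_sq_def using \<iota>(1)[OF k] by (intro sum.remove) auto
    also have "(\<Sum>i\<in>block L k - {\<iota> k}. (nlam i (w i))\<^sup>2) = 0"
    proof (intro sum.neutral ballI)
      fix i assume i: "i \<in> block L k - {\<iota> k}"
      then have "i \<in> {1..l}" using block_subset[OF k] by blast
      then show "(nlam i (w i))\<^sup>2 = 0"
        using norm_eq_0[of i "w i"] wH[of i] w0[OF k, of i] i by auto
    qed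
    finally show ?thesis using w\<iota>[OF k] by (simp add: n_def)
  qed
  have Bw: "block_coupling w k m = (if k = m then b k * I k else 0)" if k: "k \<in> {1..q}" and m: "m \<in> {1..q}" for k m
  proof -
    have "block_coupling w k m = (\<Sum>j\<in>block L m. \<beta> (\<iota> k) j * itr (w (\<iota> k)) (w j))
        + (\<Sum>i\<in>block L k - {\<iota> k}. \<Sum>j\<in>block L m. \<beta> i j * itr (w i) (w j))"
      unfolding block_coupling_def using \<iota>(1)[OF k] by (intro sum.remove) auto
    also have "(\<Sum>i\<in>block L k - {\<iota> k}. \<Sum>j\<in>block L m. \<beta> i j * itr (w i) (w j)) = 0"
      by (intro sum.neutral ballI) (use w0[OF k] in \<open>auto simp: interaction_zero_left\<close>)
    also have "(\<Sum>j\<in>block L m. \<beta> (\<iota> k) j * itr (w (\<iota> k)) (w j))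
        = \<beta> (\<iota> k) (\<iota> m) * itr (w (\<iota> k)) (w (\<iota> m)) + (\<Sum>j\<in>block L m - {\<iota> m}. \<beta> (\<iota> k) j * itr (w (\<iota> k)) (w j))"
      using \<iota>(1)[OF m] by (intro sum.remove) auto
    also have "(\<Sum>j\<in>block L m - {\<iota> m}. \<beta> (\<iota> k) j * itr (w (\<iota> k)) (w j)) = 0"
      by (intro sum.neutral ballI) (use w0[OF m] in \<open>auto simp: interaction_zero_right\<close>)
    finally show ?thesis using disj[OF k m] by (auto simp: w\<iota>[OF k] w\<iota>[OF m] \<iota>(2)[OF m] I_def)
  qed
  (* The solution of t^2 n^2 = t^(2p) b I, the Nehari condition of a single bump; the value 1 outside
     the range of blocks only serves positivity. *)
  define t where "t k = (if k \<in> {1..q} then ((n k)\<^sup>2 / (b k * I k)) powr (1 / (2 * p - 2)) else 1)" for k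
  have t_pos: "t k > 0" for k
    using n_pos[of k] b_pos[of k] I_pos[of k] by (auto simp: t_def)
  have t2: "(t k)\<^sup>2 = ((n k)\<^sup>2 / (b k * I k)) powr (1 / (p - 1))" if k: "k \<in> {1..q}" for k
  proof -
    have "(t k)\<^sup>2 = ((n k)\<^sup>2 / (b k * I k)) powr (1 / (2 * p - 2) + 1 / (2 * p - 2))"
      using k by (simp only: t_def power2_eq_square powr_add if_True)
    also have "1 / (2 * p - 2) + 1 / (2 * p - 2) = 1 / (p - 1)" using p by (simp add: field_simps)
    finally show ?thesis .
  qed
  have tp: "t k powr p * t k powr p * (b k * I k) = (t k)\<^sup>2 * (n k)\<^sup>2" if k: "k \<in> {1..q}" for k
  proof -
    have "t k powr p * t k powr p = t k powr (2 + (2 * p - 2))" by (simp flip: powr_add)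
    also have "\<dots> = (t k)\<^sup>2 * t k powr (2 * p - 2)" using t_pos[of k] by (simp only: powr_add) (simp add: powr_numeral)
    also have "t k powr (2 * p - 2) = (n k)\<^sup>2 / (b k * I k)"
      using p k n_pos[OF k] b_pos[OF k] I_pos[OF k] by (simp add: t_def powr_powr)
    finally show ?thesis using b_pos[OF k] I_pos[OF k] by simp
  qed
  have neh: "scaled t w \<in> nehari \<Omega> H l q p lam \<beta> L"
  proof (rule nehari_scaled[OF wH t_pos])
    fix k assume k: "k \<in> {1..q}"
    show "block_sq w k > 0" using Aw[OF k] n_pos[OF k] by simp
    have "(\<Sum>m=1..q. t k powr p * t m powr p * block_coupling w k m)
        = (\<Sum>m=1..q. if m = k then t k powr p * t k powr p * (b k * I k) else 0)"
      by (intro sum.cong refl) (simp add: Bw[OF k])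
    also have "\<dots> = (t k)\<^sup>2 * block_sq w k"
      using k by (simp add: sum.delta Aw tp)
    finally show "(t k)\<^sup>2 * block_sq w k = (\<Sum>m=1..q. t k powr p * t m powr p * block_coupling w k m)" by simp
  qed
  have c: "1/2 - 1/(2*p) > 0" using p by (simp add: field_simps)
  have "(\<Sum>h=1..q. block_sq u h) \<le> (\<Sum>h=1..q. block_sq (scaled t w) h)"
    using min[OF neh] c unfolding energy_nehari[OF u] energy_nehari[OF neh] by simp
  also have "\<dots> = (\<Sum>k=1..q. (t k)\<^sup>2 * (n k)\<^sup>2)"
    using block_sq_scaled[OF wH] by (intro sum.cong refl) (simp add: Aw)
  also have "\<dots> \<le> (\<Sum>k=1..q. (\<Sum>i=1..l. nlam i (\<psi> k) powr (2 * p / (p - 1)) /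
            itr (\<psi> k) (\<psi> k) powr (1 / (p - 1))) * \<mu> powr (- 1 / (p - 1)))"
  proof (rule sum_mono)
    fix k assume k: "k \<in> {1..q}"
    have "(t k)\<^sup>2 * (n k)\<^sup>2 = n k powr (2 * p / (p - 1)) / I k powr (1 / (p - 1)) * b k powr (- 1 / (p - 1))"
    proof -
      have "(n k)\<^sup>2 powr (1 / (p - 1)) * (n k)\<^sup>2 = n k powr (2 / (p - 1) + 2)"
        using n_pos[OF k] by (simp add: powr_add powr_powr flip: powr_numeral)
      also have "2 / (p - 1) + 2 = 2 * p / (p - 1)" using p by (simp add: field_simps)
      finally have "(n k)\<^sup>2 powr (1 / (p - 1)) * (n k)\<^sup>2 = n k powr (2 * p / (p - 1))" .
      then show ?thesis using n_pos[OF k] b_pos[OF k] I_pos[OF k]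
        by (simp add: t2[OF k] powr_divide powr_mult powr_minus field_simps)
    qed
    also have "\<dots> \<le> (\<Sum>i=1..l. nlam i (\<psi> k) powr (2 * p / (p - 1)) /
            itr (\<psi> k) (\<psi> k) powr (1 / (p - 1))) * \<mu> powr (- 1 / (p - 1))"
    proof (rule mult_mono)
      show "n k powr (2 * p / (p - 1)) / I k powr (1 / (p - 1))
        \<le> (\<Sum>i=1..l. nlam i (\<psi> k) powr (2 * p / (p - 1)) / itr (\<psi> k) (\<psi> k) powr (1 / (p - 1)))"
        unfolding n_def I_def
        using \<iota>l[OF k] by (intro member_le_sum[of "\<iota> k" _ "\<lambda>i. nlam i (\<psi> k) powr (2 * p / (p - 1)) / itr (\<psi> k) (\<psi> k) powr (1 / (p - 1))"]) auto
      show "b k powr (- 1 / (p - 1)) \<le> \<mu> powr (- 1 / (p - 1))"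
        using \<mu>_pos \<mu>_le[OF k] p by (intro powr_mono2') auto
    qed (auto intro!: sum_nonneg)
    finally show "(t k)\<^sup>2 * (n k)\<^sup>2 \<le> (\<Sum>i=1..l. nlam i (\<psi> k) powr (2 * p / (p - 1)) /
            itr (\<psi> k) (\<psi> k) powr (1 / (p - 1))) * \<mu> powr (- 1 / (p - 1))" .
  qed
  also have "\<dots> = (\<Sum>k=1..q. \<Sum>i=1..l. nlam i (\<psi> k) powr (2 * p / (p - 1)) /
            itr (\<psi> k) (\<psi> k) powr (1 / (p - 1))) * \<mu> powr (- 1 / (p - 1))"
    by (rule sum_distrib_right[symmetric])
  finally show "(\<Sum>h=1..q. block_sq u h) \<le> (\<Sum>k=1..q. \<Sum>i=1..l. nlam i (\<psi> k) powr (2 * p / (p - 1)) /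
            itr (\<psi> k) (\<psi> k) powr (1 / (p - 1))) * minmax_diag q L \<beta> powr (- 1 / (p - 1))"
    by (simp add: \<mu>_def)
qed

text \<open>
  The component \<open>u\<^sub>j\<close> of largest \<open>L\<^sup>2\<^sup>p\<close> norm \<open>X\<close> (to the power \<open>p\<close>) in the block of a vanishing \<open>u\<^sub>i\<close>
  dominates all components.  Competition only helps in \<open>A\<^sub>h \<le> B\<^sub>h\<^sub>h\<close>, and at most \<open>|I\<^sub>h| - 1\<close>
  components contribute to \<open>B\<^sub>h\<^sub>h \<le> M ((|I\<^sub>h| - 1) X)\<^sup>2\<close>; the embedding turns this into a lower bound for \<open>X\<close>.
  The upper bound for the other components is the energy bound.
\<close>

lemma dominant_component:
  assumes u: "u \<in> nehari \<Omega> H l q p lam \<beta> L"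
    and bound: "(\<Sum>h=1..q. block_sq u h) \<le> S * minmax_diag q L \<beta> powr (- 1 / (p - 1))"
    and S: "S > 0" and \<mu>: "minmax_diag q L \<beta> > 0"
    and h: "h \<in> {1..q}" and i: "i \<in> block L h" and zi: "zero_on \<Omega> (u i)"
    and M: "\<And>a b. a \<in> block L h \<Longrightarrow> b \<in> block L h \<Longrightarrow> \<beta> a b \<le> M"
  shows "\<exists>j\<in>block L h. sqrt (itr (u j) (u j)) > 0 \<and> (\<forall>m\<in>{1..l}. sqrt (itr (u m) (u m)) \<le>
      \<kappa> powr (p / (p - 1)) * S powr (p / 2) *
        (real (card (block L h) - 1) * M / minmax_diag q L \<beta>) powr (p / (p - 1)) * sqrt (itr (u j) (u j)))"
proof -
  define \<mu>' where "\<mu>' = minmax_diag q L \<beta>"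
  define n where "n = real (card (block L h) - 1)"
  define x where "x a = sqrt (itr (u a) (u a))" for a
  have x0: "x a \<ge> 0" for a by (simp add: x_def interaction_nonneg)
  have uH: "u a \<in> H" if "a \<in> {1..l}" for a using u that by (auto simp: nehari_iff)
  have xi: "x i = 0" using zi by (simp add: x_def interaction_zero_left)
  have M0: "M > 0" using M[OF i i] \<beta>_diag[OF block_subset[OF h i]] by linarith
  define X where "X = Max (x ` block L h)"
  obtain j where j: "j \<in> block L h" "x j = X"
  proof -
    have "X \<in> x ` block L h"
      unfolding X_def using block_nonempty[OF h] by (intro Max_in) auto
    then show ?thesis using that by blast
  qed
  have xX: "x a \<le> X" if "a \<in> block L h" for a unfolding X_def using that by (intro Max_ge) auto
  have X0: "X \<ge> 0" using j x0 by metis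
  have AX: "block_sq u h \<le> M * (n * X)\<^sup>2"
  proof -
    have "block_sq u h = (\<Sum>k=1..q. block_coupling u h k)" using u h unfolding nehari_iff by blast
    also have "\<dots> = block_coupling u h h + (\<Sum>k\<in>{1..q} - {h}. block_coupling u h k)" using h by (intro sum.remove) auto
    also have "\<dots> \<le> block_coupling u h h" using block_coupling_off[OF h] sum_nonpos[of "{1..q} - {h}" "block_coupling u h"] by auto
    also have "\<dots> \<le> (\<Sum>a\<in>block L h. \<Sum>b\<in>block L h. M * (x a * x b))"
      unfolding block_coupling_def
    proof (intro sum_mono mult_mono)
      fix a b assume ab: "a \<in> block L h" "b \<in> block L h"
      show "\<beta> a b \<le> M" using M ab .
      show "itr (u a) (u b) \<le> x a * x b" unfolding x_def
        using ab block_subset[OF h] uH by (intro interaction_Cauchy_Schwarz H_Lspace) auto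
    qed (use M0 in \<open>auto simp: interaction_nonneg\<close>)
    also have "\<dots> = M * (\<Sum>a\<in>block L h. x a)\<^sup>2"
      unfolding power2_eq_square sum_product by (simp only: sum_distrib_left)
    also have "(\<Sum>a\<in>block L h. x a) = x i + (\<Sum>a\<in>block L h - {i}. x a)"
      using i by (intro sum.remove) auto
    also have "x i = 0" by fact
    also have "M * (0 + (\<Sum>a\<in>block L h - {i}. x a))\<^sup>2 \<le> M * (n * X)\<^sup>2"
    proof -
      have "(\<Sum>a\<in>block L h - {i}. x a) \<le> (\<Sum>a\<in>block L h - {i}. X)"
        using xX by (intro sum_mono) auto
      also have "\<dots> = n * X" using i by (simp add: n_def card_Diff_singleton)
      finally show ?thesis using M0 x0 by (intro mult_left_mono power_mono) (auto intro: sum_nonneg)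
    qed
    finally show ?thesis .
  qed
  moreover have "block_sq u h > 0" using u h unfolding nehari_iff by blast
  ultimately have nX: "n * X \<noteq> 0" by auto
  then have X: "X > 0" and n: "n \<ge> 1" using X0 by (auto simp: n_def less_le)
  have jl: "j \<in> {1..l}" using block_subset[OF h j(1)] .
  define K where "K = n\<^sup>2 * M"
  have K: "K > 0" using n M0 by (simp add: K_def)
  have lower: "1 \<le> X * (\<kappa> powr (1 / (p - 1)) * K powr (p / (2 * (p - 1))))"
  proof -
    have "(nlam j (u j))\<^sup>2 \<le> block_sq u h"
      unfolding block_sq_def using j(1) by (intro member_le_sum[of j _ "\<lambda>i. (nlam i (u i))\<^sup>2"]) auto
    also have "\<dots> \<le> (M * n\<^sup>2) * X\<^sup>2" using AX by (simp add: power_mult_distrib mult.assoc)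
    finally have nK: "(nlam j (u j))\<^sup>2 \<le> K * X\<^sup>2" by (simp add: K_def mult.commute)
    have "nlam j (u j) \<ge> 0" using norm_nonneg uH jl by simp
    have "X \<le> \<kappa> * nlam j (u j) powr p"
      using embedding[OF jl uH[OF jl]] j(2) by (simp add: x_def)
    also have "nlam j (u j) powr p = ((nlam j (u j))\<^sup>2) powr (p / 2)"
      using \<open>nlam j (u j) \<ge> 0\<close> by (simp add: powr_powr flip: powr_numeral)
    also have "\<dots> \<le> (K * X\<^sup>2) powr (p / 2)" using nK p by (intro powr_mono2) auto
    also have "\<dots> = K powr (p / 2) * X powr p"
      using K X by (simp add: powr_mult powr_powr flip: powr_numeral)
    finally have "X \<le> \<kappa> * K powr (p / 2) * X powr p" using \<kappa> by (simp add: mult.assoc)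
    moreover have "X powr p = X * X powr (p - 1)" using X by (simp add: powr_mult_base)
    ultimately have "1 \<le> \<kappa> * K powr (p / 2) * X powr (p - 1)" using X by (simp add: field_simps)
    then have "1 powr (1 / (p - 1)) \<le> (\<kappa> * K powr (p / 2) * X powr (p - 1)) powr (1 / (p - 1))"
      using p by (intro powr_mono2) auto
    also have "\<dots> = \<kappa> powr (1 / (p - 1)) * K powr (p / (2 * (p - 1))) * X"
      using p \<kappa> K X by (simp add: powr_mult powr_powr)
    finally show ?thesis by (simp add: mult_ac)
  qed
  have "\<beta> i i \<le> (MAX a\<in>block L h. \<beta> a a)" using i by (intro Max_ge) auto
  have "\<mu>' \<le> (MAX a\<in>block L h. \<beta> a a)"
    unfolding \<mu>'_def minmax_diag_def using h by (intro Min_le) auto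
  also have "\<dots> \<le> M" using M block_nonempty[OF h] by (intro Max.boundedI) auto
  finally have \<mu>M: "M / \<mu>' \<ge> 1" using \<mu> by (simp add: \<mu>'_def)
  have upper: "x m \<le> \<kappa> * S powr (p / 2) * \<mu>' powr (- (p / (2 * (p - 1))))" if m: "m \<in> {1..l}" for m
  proof -
    obtain k where k: "k \<in> {1..q}" "m \<in> block L k" using ex_block[OF m] by auto
    have nn: "nlam m (u m) \<ge> 0" using norm_nonneg uH m by simp
    have "(nlam m (u m))\<^sup>2 \<le> block_sq u k"
      unfolding block_sq_def using k(2) by (intro member_le_sum[of m _ "\<lambda>i. (nlam i (u i))\<^sup>2"]) auto
    also have "\<dots> \<le> (\<Sum>h=1..q. block_sq u h)" using k(1) block_sq_nonneg by (intro member_le_sum) auto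
    also note bound
    finally have b: "(nlam m (u m))\<^sup>2 \<le> S * \<mu>' powr (- 1 / (p - 1))" by (simp add: \<mu>'_def)
    have "x m \<le> \<kappa> * nlam m (u m) powr p" using embedding[OF m uH[OF m]] by (simp add: x_def)
    also have "nlam m (u m) powr p = ((nlam m (u m))\<^sup>2) powr (p / 2)"
      using nn by (simp add: powr_powr flip: powr_numeral)
    also have "\<dots> \<le> (S * \<mu>' powr (- 1 / (p - 1))) powr (p / 2)" using b p by (intro powr_mono2) auto
    also have "\<dots> = S powr (p / 2) * \<mu>' powr (- (p / (2 * (p - 1))))"
      using S p by (simp add: powr_mult powr_powr mult.commute)
    finally show ?thesis using \<kappa> by (simp add: mult.assoc)
  qed
  (* The natural bound has half the exponent; doubling it costs nothing because M is at least the
     largest diagonal entry of the block and hence at least the minimum over all blocks. *)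
  have Kle: "(K / \<mu>') powr (p / (2 * (p - 1))) \<le> (n * M / \<mu>') powr (p / (p - 1))"
  proof -
    have "K / \<mu>' = n\<^sup>2 * (M / \<mu>')" by (simp add: K_def)
    also have "\<dots> \<le> n\<^sup>2 * (M / \<mu>')\<^sup>2" using self_le_power[OF \<mu>M, of 2] by (intro mult_left_mono) auto
    also have "\<dots> = (n * M / \<mu>')\<^sup>2" by (simp add: power_mult_distrib power_divide)
    finally have "(K / \<mu>') powr (p / (2 * (p - 1))) \<le> ((n * M / \<mu>')\<^sup>2) powr (p / (2 * (p - 1)))"
      using p K \<mu> by (intro powr_mono2) (auto simp: \<mu>'_def)
    also have "\<dots> = (n * M / \<mu>') powr (2 * (p / (2 * (p - 1))))"
      using n M0 \<mu> by (simp add: \<mu>'_def powr_powr flip: powr_numeral)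
    also have "2 * (p / (2 * (p - 1))) = p / (p - 1)" using p by (simp add: field_simps)
    finally show ?thesis .
  qed
  show ?thesis
  proof (intro bexI[OF _ j(1)] conjI ballI)
    show "sqrt (itr (u j) (u j)) > 0" using X j(2) by (simp add: x_def)
    fix m assume m: "m \<in> {1..l}"
    have "x m \<le> (\<kappa> * S powr (p / 2) * \<mu>' powr (- (p / (2 * (p - 1))))) * 1"
      using upper[OF m] by simp
    also have "\<dots> \<le> (\<kappa> * S powr (p / 2) * \<mu>' powr (- (p / (2 * (p - 1)))))
        * (X * (\<kappa> powr (1 / (p - 1)) * K powr (p / (2 * (p - 1)))))"
      using lower \<kappa> by (intro mult_left_mono) auto
    also have "\<dots> = (\<kappa> * \<kappa> powr (1 / (p - 1))) * S powr (p / 2) *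
        (K powr (p / (2 * (p - 1))) * \<mu>' powr (- (p / (2 * (p - 1))))) * X"
      by (simp add: mult_ac)
    also have "\<kappa> * \<kappa> powr (1 / (p - 1)) = \<kappa> powr (p / (p - 1))"
    proof -
      have "1 + 1 / (p - 1) = p / (p - 1)" using p by (simp add: field_simps)
      then show ?thesis using \<kappa> by (simp add: powr_mult_base)
    qed
    also have "K powr (p / (2 * (p - 1))) * \<mu>' powr (- (p / (2 * (p - 1)))) = (K / \<mu>') powr (p / (2 * (p - 1)))"
      using K \<mu> by (simp add: \<mu>'_def powr_divide powr_minus field_simps)
    also have "\<kappa> powr (p / (p - 1)) * S powr (p / 2) * (K / \<mu>') powr (p / (2 * (p - 1))) * X
      \<le> \<kappa> powr (p / (p - 1)) * S powr (p / 2) * (n * M / \<mu>') powr (p / (p - 1)) * X"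
      using Kle X0 by (intro mult_right_mono mult_left_mono) auto
    finally show "sqrt (itr (u m) (u m)) \<le>
      \<kappa> powr (p / (p - 1)) * S powr (p / 2) *
        (real (card (block L h) - 1) * M / minmax_diag q L \<beta>) powr (p / (p - 1)) * sqrt (itr (u j) (u j))"
      by (simp add: x_def n_def \<mu>'_def flip: j(2))
  qed
qed

end

section \<open>Filling a vanishing component\<close>

text \<open>
  Exact change of \<open>F\<close> when only the block \<open>h\<close> is perturbed, so that \<open>A\<close> changes at \<open>h\<close> and \<open>B\<close> in the
  row and the column of \<open>h\<close>.
\<close>

lemma reduced_energy_perturbed:
  fixes g :: "nat \<Rightarrow> real"
  assumes h: "h \<in> {1..q}"
    and A: "\<And>k. k \<in> {1..q} \<Longrightarrow> A' k = A k + (if k = h then \<rho> else 0)"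
    and B: "\<And>k m. k \<in> {1..q} \<Longrightarrow> m \<in> {1..q} \<Longrightarrow> B' k m = B k m + (if k = h then g m else 0)
        + (if m = h then g k else 0) + (if k = h \<and> m = h then R else 0)"
  shows "reduced_energy q p A' B' s = reduced_energy q p A B s + 1 / 2 * ((s h)\<^sup>2 * \<rho>)
      - 1 / (2 * p) * (2 * (s h powr p * (\<Sum>k=1..q. s k powr p * g k)) + s h powr p * s h powr p * R)"
proof -
  define t where "t k = s k powr p" for k
  define \<Gamma> where "\<Gamma> = (\<Sum>k=1..q. t k * g k)"
  have "(\<Sum>k=1..q. (s k)\<^sup>2 * A' k) = (\<Sum>k=1..q. (s k)\<^sup>2 * A k + (if k = h then (s h)\<^sup>2 * \<rho> else 0))"
    by (intro sum.cong refl) (simp add: A distrib_left)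
  also have "\<dots> = (\<Sum>k=1..q. (s k)\<^sup>2 * A k) + (s h)\<^sup>2 * \<rho>"
    unfolding sum.distrib using h by simp
  finally have SA: "(\<Sum>k=1..q. (s k)\<^sup>2 * A' k) = (\<Sum>k=1..q. (s k)\<^sup>2 * A k) + (s h)\<^sup>2 * \<rho>" .
  have inner: "(\<Sum>m=1..q. t k * t m * B' k m) = (\<Sum>m=1..q. t k * t m * B k m)
      + (if k = h then t h * \<Gamma> + t h * t h * R else 0) + t h * (t k * g k)" if k: "k \<in> {1..q}" for k
  proof -
    have "(\<Sum>m=1..q. t k * t m * B' k m) = (\<Sum>m=1..q. t k * t m * B k m
        + t k * (if k = h then t m * g m else 0) + (if m = h then t k * t h * g k else 0)
        + (if m = h then (if k = h then t h * t h * R else 0) else 0))"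
      by (intro sum.cong refl) (simp add: B[OF k] distrib_left)
    also have "\<dots> = (\<Sum>m=1..q. t k * t m * B k m) + (\<Sum>m=1..q. t k * (if k = h then t m * g m else 0))
        + t k * t h * g k + (if k = h then t h * t h * R else 0)"
      unfolding sum.distrib using h by simp
    also have "(\<Sum>m=1..q. t k * (if k = h then t m * g m else 0)) = (if k = h then t h * \<Gamma> else 0)"
      unfolding \<Gamma>_def by (simp only: sum_distrib_left[symmetric]) simp
    finally show ?thesis by simp
  qed
  have "(\<Sum>k=1..q. \<Sum>m=1..q. t k * t m * B' k m) = (\<Sum>k=1..q. (\<Sum>m=1..q. t k * t m * B k m)
      + (if k = h then t h * \<Gamma> + t h * t h * R else 0) + t h * (t k * g k))"
    by (intro sum.cong refl inner)
  also have "\<dots> = (\<Sum>k=1..q. \<Sum>m=1..q. t k * t m * B k m) + (t h * \<Gamma> + t h * t h * R) + t h * \<Gamma>"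
    unfolding sum.distrib using h by (simp add: \<Gamma>_def sum_distrib_left[symmetric])
  finally have SB: "(\<Sum>k=1..q. \<Sum>m=1..q. t k * t m * B' k m)
      = (\<Sum>k=1..q. \<Sum>m=1..q. t k * t m * B k m) + (2 * (t h * \<Gamma>) + t h * t h * R)" by simp
  show ?thesis
    unfolding reduced_energy_def SA unfolding t_def[symmetric] SB \<Gamma>_def[symmetric]
    by (simp add: distrib_left)
qed

context coupled_system
begin

text \<open>
  Consequence of minimality.  For \<open>U\<^sub>E\<close> close to \<open>u\<close> some scaling \<open>s\<close> puts \<open>U\<^sub>E\<close> on the Nehari set, and then
  \<open>F\<^sub>u(s) \<le> F\<^sub>u(1) = J(u) \<le> J(s U\<^sub>E) = F\<^sub>U(s)\<close>.  Both functions are compared at the same \<open>s\<close>, so the rate at which \<open>s\<close> approaches \<open>1\<close> does not enter.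
\<close>

lemma eventually_comparison:
  fixes U :: "real \<Rightarrow> nat \<Rightarrow> real^'n \<Rightarrow> real"
  assumes u: "u \<in> nehari \<Omega> H l q p lam \<beta> L"
    and min: "\<And>w. w \<in> nehari \<Omega> H l q p lam \<beta> L \<Longrightarrow> energy \<Omega> l p lam \<beta> u \<le> energy \<Omega> l p lam \<beta> w"
    and U: "\<forall>\<^sub>F E in F. \<forall>i\<in>{1..l}. U E i \<in> H"
    and A: "\<And>h. h \<in> {1..q} \<Longrightarrow> ((\<lambda>E. block_sq (U E) h) \<longlongrightarrow> block_sq u h) F"
    and B: "\<And>h k. h \<in> {1..q} \<Longrightarrow> k \<in> {1..q} \<Longrightarrow> ((\<lambda>E. block_coupling (U E) h k) \<longlongrightarrow> block_coupling u h k) F"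
  shows "\<forall>\<^sub>F E in F. \<exists>s\<in>scaling_box.
      reduced_energy q p (block_sq u) (block_coupling u) s \<le> reduced_energy q p (block_sq (U E)) (block_coupling (U E)) s"
proof -
  interpret balanced_form q p "block_sq u" "block_coupling u" by (rule nehari_balanced[OF u])
  obtain \<delta> where \<delta>: "\<delta> > 0" and near: "\<And>A' B'. \<forall>h\<in>{1..q}. \<bar>A' h - block_sq u h\<bar> < \<delta> \<Longrightarrow>
      \<forall>h\<in>{1..q}. \<forall>k\<in>{1..q}. \<bar>B' h k - block_coupling u h k\<bar> < \<delta> \<Longrightarrow>
      \<forall>h\<in>{1..q}. \<forall>k\<in>{1..q}. B' h k = B' k h \<Longrightarrow>
      \<exists>s\<in>scaling_box. \<forall>h\<in>{1..q}. A' h > 0 \<and>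
        (s h)\<^sup>2 * A' h = (\<Sum>k=1..q. s h powr p * s k powr p * B' h k)"
    using nehari_projection_near by blast
  have "\<forall>\<^sub>F E in F. \<forall>h\<in>{1..q}. \<bar>block_sq (U E) h - block_sq u h\<bar> < \<delta>"
    using tendstoD[OF A \<delta>] by (intro eventually_ball_finite) (auto simp: dist_real_def)
  moreover have "\<forall>\<^sub>F E in F. \<forall>h\<in>{1..q}. \<forall>k\<in>{1..q}. \<bar>block_coupling (U E) h k - block_coupling u h k\<bar> < \<delta>"
    using tendstoD[OF B \<delta>] by (intro eventually_ball_finite ballI) (auto simp: dist_real_def)
  ultimately show ?thesis using U
  proof eventually_elim
    case (elim E)
    have "\<forall>h\<in>{1..q}. \<forall>k\<in>{1..q}. block_coupling (U E) h k = block_coupling (U E) k h" using block_coupling_sym by blast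
    from near[OF elim(1,2) this] obtain s where s: "s \<in> scaling_box"
      and ns: "\<And>h. h \<in> {1..q} \<Longrightarrow> block_sq (U E) h > 0"
        "\<And>h. h \<in> {1..q} \<Longrightarrow> (s h)\<^sup>2 * block_sq (U E) h = (\<Sum>k=1..q. s h powr p * s k powr p * block_coupling (U E) h k)"
      by blast
    have sp: "s h > 0" for h using scaling_boxD[OF s, of h] by linarith
    have UH: "U E i \<in> H" if "i \<in> {1..l}" for i using elim(3) that by blast
    have "reduced_energy q p (block_sq u) (block_coupling u) s \<le> reduced_energy q p (block_sq u) (block_coupling u) (\<lambda>_. 1)"
      by (rule reduced_energy_le_one[OF sp])
    also have "\<dots> = energy \<Omega> l p lam \<beta> u" by (rule energy_eq[symmetric])
    also have "\<dots> \<le> energy \<Omega> l p lam \<beta> (scaled s (U E))"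
      by (rule min[OF nehari_scaled[OF UH sp ns]])
    also have "\<dots> = reduced_energy q p (block_sq (U E)) (block_coupling (U E)) s"
      by (rule energy_scaled[OF UH sp])
    finally show ?case using s by blast
  qed
qed

text \<open>
  Replacing \<open>u\<^sub>i = 0\<close> and \<open>u\<^sub>j\<close> by multiples of \<open>u\<^sub>j\<close> adds to the vector of the functions \<open>|u\<^sub>r|\<^sup>p\<close> the vector
  \<open>d |u\<^sub>j|\<^sup>p\<close> with \<open>d\<^sub>i = E\<close>, \<open>d\<^sub>j = - T\<close>; the formula is the expansion of the quadratic form \<open>B\<close> in \<open>d\<close>.
\<close>

lemma block_coupling_perturbed:
  assumes h: "h \<in> {1..q}" and i: "i \<in> block L h" and j: "j \<in> block L h" and ij: "i \<noteq> j"
    and zi: "zero_on \<Omega> (u i)"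
    and ae: "\<bar>a\<bar> powr p = 1 - T" "\<bar>e\<bar> powr p = E"
    and k: "k \<in> {1..q}" and m: "m \<in> {1..q}"
  defines "U \<equiv> u(i := (\<lambda>x. e * u j x), j := (\<lambda>x. a * u j x))"
    and "G \<equiv> \<lambda>m. \<Sum>b\<in>block L m. (E * \<beta> i b - T * \<beta> j b) * itr (u j) (u b)"
  shows "block_coupling U k m = block_coupling u k m + (if k = h then G m else 0) + (if m = h then G k else 0)
      + (if k = h \<and> m = h then (E\<^sup>2 * \<beta> i i - 2 * E * T * \<beta> i j + T\<^sup>2 * \<beta> j j) * itr (u j) (u j) else 0)"
proof -
  define d where "d r = (if r = i then E else if r = j then - T else 0)" for r
  have [simp]: "itr (u i) w = 0" "itr w (u i) = 0" for w
    using zi by (auto simp: interaction_zero_left interaction_zero_right)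
  define w where "w r = (if r = i then E else if r = j then 1 - T else 1)" for r
  define b where "b r = (if r = i \<or> r = j then u j else u r)" for r
  have U_eq: "\<exists>t. U r = (\<lambda>x. t * b r x) \<and> \<bar>t\<bar> powr p = w r" for r
  proof -
    have "U r = (\<lambda>x. (if r = j then a else if r = i then e else 1) * b r x)"
      by (simp add: U_def b_def)
    moreover have "\<bar>if r = j then a else if r = i then e else 1\<bar> powr p = w r"
      using ae ij by (simp add: w_def)
    ultimately show ?thesis by blast
  qed
  have itr_w: "itr (U r) (U r') = w r * w r' * itr (b r) (b r')" for r r'
    using U_eq[of r] U_eq[of r'] by (auto simp: interaction_scale)
  have itrU: "itr (U r) (U r') = itr (u r) (u r') + d r * itr (u j) (u r') + d r' * itr (u j) (u r)
      + d r * d r' * itr (u j) (u j)" for r r'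
    unfolding itr_w w_def b_def d_def using ij interaction_commute[of \<Omega> p "u r" "u j"]
    by (cases "r = i"; cases "r = j"; cases "r' = i"; cases "r' = j") (simp_all add: algebra_simps)
  have dsum: "(\<Sum>r\<in>block L k. d r * f r) = (if k = h then E * f i - T * f j else 0)"
    if "k \<in> {1..q}" for k f
  proof (cases "k = h")
    case True
    have "(\<Sum>r\<in>block L h. d r * f r) = (\<Sum>r\<in>{i, j}. d r * f r)"
      using i j by (intro sum.mono_neutral_right) (auto simp: d_def)
    then show ?thesis using True ij by (simp add: d_def)
  next
    case False
    have "d r = 0" if "r \<in> block L k" for r
      using that False blk_eq[OF h i] blk_eq[OF h j] blk_eq[OF \<open>k \<in> {1..q}\<close> that] by (auto simp: d_def)
    then show ?thesis using False by (simp add: sum.neutral)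
  qed
  have G_eq: "G m = E * (\<Sum>b\<in>block L m. \<beta> i b * itr (u j) (u b))
      - T * (\<Sum>b\<in>block L m. \<beta> j b * itr (u j) (u b))" for m
    by (simp only: G_def sum_distrib_left sum_subtractf left_diff_distrib mult.assoc)
  have "block_coupling U k m = block_coupling u k m
      + (\<Sum>r\<in>block L k. d r * (\<Sum>r'\<in>block L m. \<beta> r r' * itr (u j) (u r')))
      + (\<Sum>r\<in>block L k. \<Sum>r'\<in>block L m. d r' * (\<beta> r r' * itr (u j) (u r)))
      + (\<Sum>r\<in>block L k. d r * (\<Sum>r'\<in>block L m. d r' * (\<beta> r r' * itr (u j) (u j))))"
    unfolding block_coupling_def itrU sum_distrib_left
    by (simp only: distrib_left sum.distrib mult_ac)
  also have "(\<Sum>r\<in>block L k. \<Sum>r'\<in>block L m. d r' * (\<beta> r r' * itr (u j) (u r)))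
      = (\<Sum>r'\<in>block L m. d r' * (\<Sum>r\<in>block L k. \<beta> r r' * itr (u j) (u r)))"
    unfolding sum_distrib_left by (rule sum.swap)
  also have "\<dots> = (if m = h then G k else 0)"
  proof -
    have "(\<Sum>r\<in>block L k. \<beta> r c * itr (u j) (u r)) = (\<Sum>r\<in>block L k. \<beta> c r * itr (u j) (u r))"
      if "c \<in> {1..l}" for c
      using block_subset[OF k] that
      by (intro sum.cong refl) (simp add: \<beta>_sym)
    from this[OF block_subset[OF h i]] this[OF block_subset[OF h j]]
    show ?thesis unfolding dsum[OF m] G_eq by simp
  qed
  also have "(\<Sum>r\<in>block L k. d r * (\<Sum>r'\<in>block L m. \<beta> r r' * itr (u j) (u r'))) = (if k = h then G m else 0)"
    unfolding dsum[OF k] G_eq ..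
  also have "(\<Sum>r\<in>block L k. d r * (\<Sum>r'\<in>block L m. d r' * (\<beta> r r' * itr (u j) (u j))))
      = (if k = h \<and> m = h then (E\<^sup>2 * \<beta> i i - 2 * E * T * \<beta> i j + T\<^sup>2 * \<beta> j j) * itr (u j) (u j) else 0)"
    using \<beta>_sym[OF block_subset[OF h i] block_subset[OF h j]]
    unfolding dsum[OF k] dsum[OF m] by (simp add: power2_eq_square algebra_simps)
  finally show ?thesis .
qed

lemma block_sq_perturbed:
  fixes a e :: real
  assumes h: "h \<in> {1..q}" and i: "i \<in> block L h" and j: "j \<in> block L h" and ij: "i \<noteq> j"
    and uH: "\<And>i. i \<in> {1..l} \<Longrightarrow> u i \<in> H" and zi: "zero_on \<Omega> (u i)" and k: "k \<in> {1..q}"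
  defines "U \<equiv> u(i := (\<lambda>x. e * u j x), j := (\<lambda>x. a * u j x))"
  shows "block_sq U k = block_sq u k + (if k = h then (a\<^sup>2 - 1) * (nlam j (u j))\<^sup>2 + e\<^sup>2 * (nlam i (u j))\<^sup>2 else 0)"
proof (cases "k = h")
  case True
  have il: "i \<in> {1..l}" and jl: "j \<in> {1..l}" using block_subset[OF h] i j by auto
  have split: "block_sq w h = (nlam i (w i))\<^sup>2 + ((nlam j (w j))\<^sup>2 + (\<Sum>r\<in>block L h - {i} - {j}. (nlam r (w r))\<^sup>2))" for w
    unfolding block_sq_def using i j ij by (subst sum.remove[of _ i], simp, simp, subst sum.remove[of _ j]) auto
  have "(\<Sum>r\<in>block L h - {i} - {j}. (nlam r (U r))\<^sup>2) = (\<Sum>r\<in>block L h - {i} - {j}. (nlam r (u r))\<^sup>2)"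
    by (intro sum.cong refl) (auto simp: U_def)
  moreover have "nlam i (u i) = 0" using norm_eq_0[OF il uH[OF il]] zi by simp
  ultimately show ?thesis
    unfolding True split using ij il jl uH[OF jl]
    by (simp add: U_def norm_scale power_mult_distrib algebra_simps)
next
  case False
  have "U r = u r" if "r \<in> block L k" for r
    using that False blk_eq[OF h i] blk_eq[OF h j] blk_eq[OF k that] by (auto simp: U_def)
  then show ?thesis using False by (simp add: block_sq_def)
qed

text \<open>
  Here \<open>g\<^sub>h\<close> is the first order gain inside the block and the other \<open>g\<^sub>k\<close> are the losses; \<open>\<tau>\<close> is the rate at
  which \<open>u\<^sub>j\<close> is depleted.  The hypothesis on the limit says that the quadratic part of the energy
  changes by \<open>o(E)\<close>.  The factor \<open>4\<^sup>p\<close> pays for the scalings, which are only known to lie in the cube: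
  the gain is seen with a weight at least \<open>2\<^sup>-\<^sup>p\<close> and the losses with weights at most \<open>2\<^sup>p\<close>.
\<close>

lemma component_perturbation:
  assumes u: "u \<in> nehari \<Omega> H l q p lam \<beta> L"
    and min: "\<And>w. w \<in> nehari \<Omega> H l q p lam \<beta> L \<Longrightarrow> energy \<Omega> l p lam \<beta> u \<le> energy \<Omega> l p lam \<beta> w"
    and h: "h \<in> {1..q}" and i: "i \<in> block L h" and j: "j \<in> block L h" and ij: "i \<noteq> j"
    and zi: "zero_on \<Omega> (u i)"
    and \<rho>: "((\<lambda>E. (((1 - \<tau> * E) powr (2 / p) - 1) * (nlam j (u j))\<^sup>2 + E powr (2 / p) * (nlam i (u j))\<^sup>2) / E)
        \<longlongrightarrow> 0) (at_right 0)"
  defines "g \<equiv> \<lambda>k. \<Sum>m\<in>block L k. (\<beta> i m - \<tau> * \<beta> j m) * itr (u j) (u m)"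
  shows "g h \<le> 4 powr p * (\<Sum>k\<in>{1..q} - {h}. \<bar>g k\<bar>)"
proof (rule ccontr)
  assume neg: "\<not> ?thesis"
  define \<sigma> where "\<sigma> = (\<Sum>k\<in>{1..q} - {h}. \<bar>g k\<bar>)"
  define c where "c = (1/2) powr p * g h - 2 powr p * \<sigma>"
  have c: "c > 0"
  proof -
    have "(1/2) powr p * (4 powr p * \<sigma>) < (1/2) powr p * g h"
      using neg by (intro mult_strict_left_mono) (auto simp: \<sigma>_def)
    moreover have "(1/2) powr p * (4 powr p * \<sigma>) = 2 powr p * \<sigma>"
      by (simp add: mult.assoc[symmetric] flip: powr_mult)
    ultimately show ?thesis by (simp add: c_def)
  qed
  have gh: "g h > 0"
  proof -
    have "\<sigma> \<ge> 0" by (simp add: \<sigma>_def sum_nonneg)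
    then have "4 powr p * \<sigma> \<ge> 0" by simp
    then show ?thesis using neg[folded \<sigma>_def] by linarith
  qed
  have uH: "u m \<in> H" if "m \<in> {1..l}" for m using u that by (auto simp: nehari_iff)
  have jl: "j \<in> {1..l}" using block_subset[OF h j] .
  define U where "U E = u(i := (\<lambda>x. E powr (1/p) * u j x), j := (\<lambda>x. (1 - \<tau> * E) powr (1/p) * u j x))" for E
  define r where "r = (\<beta> i i - 2 * \<tau> * \<beta> i j + \<tau>\<^sup>2 * \<beta> j j) * itr (u j) (u j)"
  define \<rho>f where "\<rho>f E = ((1 - \<tau> * E) powr (2 / p) - 1) * (nlam j (u j))\<^sup>2 + E powr (2 / p) * (nlam i (u j))\<^sup>2" for E
  have small: "\<forall>\<^sub>F E in at_right (0::real). E > 0 \<and> 1 - \<tau> * E > 0"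
  proof (rule eventually_conj)
    show "\<forall>\<^sub>F E in at_right (0::real). E > 0" by (rule eventually_at_right_less)
    have "((\<lambda>E. 1 - \<tau> * E) \<longlongrightarrow> 1 - \<tau> * 0) (at_right 0)" by (intro tendsto_intros)
    then show "\<forall>\<^sub>F E in at_right (0::real). 1 - \<tau> * E > 0"
      by (rule order_tendstoD) simp
  qed
  have AU: "block_sq (U E) k = block_sq u k + (if k = h then \<rho>f E else 0)"
    if "E > 0" "1 - \<tau> * E > 0" "k \<in> {1..q}" for E k
  proof -
    have sq: "(y powr (1/p))\<^sup>2 = y powr (2/p)" for y :: real
      by (simp add: power2_eq_square flip: powr_add)
    have "block_sq (U E) k = block_sq u k + (if k = h then (((1 - \<tau> * E) powr (1/p))\<^sup>2 - 1) * (nlam j (u j))\<^sup>2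
        + (E powr (1/p))\<^sup>2 * (nlam i (u j))\<^sup>2 else 0)"
      unfolding U_def by (rule block_sq_perturbed[where u = u, OF h i j ij uH zi that(3)])
    then show ?thesis by (simp only: sq \<rho>f_def)
  qed
  have BU: "block_coupling (U E) k m = block_coupling u k m + (if k = h then E * g m else 0) + (if m = h then E * g k else 0)
      + (if k = h \<and> m = h then E\<^sup>2 * r else 0)"
    if "E > 0" "1 - \<tau> * E > 0" "k \<in> {1..q}" "m \<in> {1..q}" for E k m
  proof -
    have e: "\<bar>(1 - \<tau> * E) powr (1/p)\<bar> powr p = 1 - \<tau> * E" "\<bar>E powr (1/p)\<bar> powr p = E"
      using that p by (simp_all add: powr_powr)
    have G: "(\<Sum>b\<in>block L m. (E * \<beta> i b - \<tau> * E * \<beta> j b) * itr (u j) (u b)) = E * g m" for m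
      by (simp add: g_def sum_distrib_left algebra_simps)
    have R: "(E\<^sup>2 * \<beta> i i - 2 * E * (\<tau> * E) * \<beta> i j + (\<tau> * E)\<^sup>2 * \<beta> j j) * itr (u j) (u j) = E\<^sup>2 * r"
      by (simp add: r_def power2_eq_square algebra_simps)
    show ?thesis
      using block_coupling_perturbed[where u = u, OF h i j ij zi e that(3,4)] by (simp only: U_def G R)
  qed
  have \<rho>lim: "((\<lambda>E. \<rho>f E / E) \<longlongrightarrow> 0) (at_right 0)" using \<rho> by (simp add: \<rho>f_def)
  have "((\<lambda>E. \<rho>f E / E * E) \<longlongrightarrow> 0 * 0) (at_right 0)" by (intro tendsto_intros \<rho>lim)
  moreover have "\<forall>\<^sub>F E in at_right 0. \<rho>f E / E * E = \<rho>f E"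
    using small by eventually_elim simp
  ultimately have \<rho>0: "(\<rho>f \<longlongrightarrow> 0) (at_right 0)"
    using Lim_transform_eventually by fastforce
  have "\<forall>\<^sub>F E in at_right 0. \<exists>s\<in>scaling_box.
      reduced_energy q p (block_sq u) (block_coupling u) s \<le> reduced_energy q p (block_sq (U E)) (block_coupling (U E)) s"
  proof (rule eventually_comparison[OF u min])
    have "U E m \<in> H" if "m \<in> {1..l}" for E m using uH that jl by (simp add: U_def H_scale)
    then show "\<forall>\<^sub>F E in at_right 0. \<forall>i\<in>{1..l}. U E i \<in> H" by simp
  next
    fix k assume k: "k \<in> {1..q}"
    have "((\<lambda>E. block_sq u k + (if k = h then \<rho>f E else 0)) \<longlongrightarrow> block_sq u k + (if k = h then 0 else 0)) (at_right 0)"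
      by (cases "k = h") (auto intro!: tendsto_eq_intros \<rho>0)
    moreover have "\<forall>\<^sub>F E in at_right 0. block_sq u k + (if k = h then \<rho>f E else 0) = block_sq (U E) k"
      using small by eventually_elim (simp only: AU k)
    ultimately show "((\<lambda>E. block_sq (U E) k) \<longlongrightarrow> block_sq u k) (at_right 0)"
      using Lim_transform_eventually by fastforce
    fix m assume m: "m \<in> {1..q}"
    have "((\<lambda>E. block_coupling u k m + (if k = h then E * g m else 0) + (if m = h then E * g k else 0)
      + (if k = h \<and> m = h then E\<^sup>2 * r else 0)) \<longlongrightarrow> block_coupling u k m + (if k = h then 0 * g m else 0) + (if m = h then 0 * g k else 0)
      + (if k = h \<and> m = h then 0\<^sup>2 * r else 0)) (at_right 0)"
      by (cases "k = h"; cases "m = h"; simp only: if_True if_False simp_thms; intro tendsto_intros)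
    moreover have "\<forall>\<^sub>F E in at_right 0. block_coupling u k m + (if k = h then E * g m else 0) + (if m = h then E * g k else 0)
      + (if k = h \<and> m = h then E\<^sup>2 * r else 0) = block_coupling (U E) k m"
      using small by eventually_elim (simp only: BU k m)
    ultimately have "((\<lambda>E. block_coupling (U E) k m) \<longlongrightarrow> block_coupling u k m + (if k = h then 0 * g m else 0) + (if m = h then 0 * g k else 0)
      + (if k = h \<and> m = h then 0\<^sup>2 * r else 0)) (at_right 0)"
      by (rule Lim_transform_eventually)
    moreover have "block_coupling u k m + (if k = h then 0 * g m else 0) + (if m = h then 0 * g k else 0)
      + (if k = h \<and> m = h then 0\<^sup>2 * r else 0) = block_coupling u k m" by simp
    ultimately show "((\<lambda>E. block_coupling (U E) k m) \<longlongrightarrow> block_coupling u k m) (at_right 0)" by (simp only:)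
  qed
  (* If the gain exceeded the losses, the comparison, divided by E, would keep the positive number on
     the left below a quantity that tends to 0. *)
  with small have ineq: "\<forall>\<^sub>F E in at_right 0. (1/2) powr p * c / p \<le> 2 * \<bar>\<rho>f E / E\<bar> + E * (4 powr p * \<bar>r\<bar> / (2 * p))"
  proof eventually_elim
    case (elim E)
    then obtain s where s: "s \<in> scaling_box" and
      le: "reduced_energy q p (block_sq u) (block_coupling u) s \<le> reduced_energy q p (block_sq (U E)) (block_coupling (U E)) s" and E: "E > 0" "1 - \<tau> * E > 0"
      by auto
    have sb: "1/2 \<le> s k" "s k \<le> 2" for k using scaling_boxD[OF s] by auto
    have sp: "s k > 0" for k using sb(1)[of k] by linarith
    have slo: "(1/2) powr p \<le> s k powr p" for k using sb p by (intro powr_mono2) auto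
    have shi: "s k powr p \<le> 2 powr p" for k using sb sp[of k] p by (intro powr_mono2) auto
    define \<Gamma> where "\<Gamma> = (\<Sum>k=1..q. s k powr p * g k)"
    have E\<Gamma>: "(\<Sum>k=1..q. s k powr p * (E * g k)) = E * \<Gamma>"
      unfolding \<Gamma>_def sum_distrib_left by (intro sum.cong refl) (simp only: mult_ac)
    have "reduced_energy q p (block_sq (U E)) (block_coupling (U E)) s = reduced_energy q p (block_sq u) (block_coupling u) s + 1 / 2 * ((s h)\<^sup>2 * \<rho>f E)
        - 1 / (2 * p) * (2 * (s h powr p * (E * \<Gamma>)) + s h powr p * s h powr p * (E\<^sup>2 * r))"
      unfolding E\<Gamma>[symmetric] by (rule reduced_energy_perturbed[OF h AU[OF E] BU[OF E]])
    with le have "0 \<le> 1/2 * ((s h)\<^sup>2 * \<rho>f E) - 1/(2*p) * (2 * (s h powr p * (E * \<Gamma>)) + s h powr p * s h powr p * (E\<^sup>2 * r))"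
      by linarith
    moreover have "(s h)\<^sup>2 * \<rho>f E \<le> 4 * \<bar>\<rho>f E\<bar>"
    proof -
      have "(s h)\<^sup>2 \<le> 2\<^sup>2" using sb sp[of h] by (intro power_mono) auto
      then have "(s h)\<^sup>2 * \<bar>\<rho>f E\<bar> \<le> 4 * \<bar>\<rho>f E\<bar>" by (intro mult_right_mono) auto
      moreover have "(s h)\<^sup>2 * \<rho>f E \<le> (s h)\<^sup>2 * \<bar>\<rho>f E\<bar>" by (intro mult_left_mono) auto
      ultimately show ?thesis by linarith
    qed
    moreover have "c \<le> \<Gamma>"
    proof -
      have "\<Gamma> = s h powr p * g h + (\<Sum>k\<in>{1..q} - {h}. s k powr p * g k)"
        unfolding \<Gamma>_def using h by (intro sum.remove) auto
      moreover have "(1/2) powr p * g h \<le> s h powr p * g h" using slo gh by (intro mult_right_mono) auto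
      moreover have "(\<Sum>k\<in>{1..q} - {h}. - (2 powr p * \<bar>g k\<bar>)) \<le> (\<Sum>k\<in>{1..q} - {h}. s k powr p * g k)"
      proof (rule sum_mono)
        fix k
        have "s k powr p * \<bar>g k\<bar> \<le> 2 powr p * \<bar>g k\<bar>" using shi by (intro mult_right_mono) auto
        moreover have "- (s k powr p * \<bar>g k\<bar>) \<le> s k powr p * g k"
        proof -
          have "s k powr p * - \<bar>g k\<bar> \<le> s k powr p * g k" by (intro mult_left_mono) auto
          then show ?thesis by simp
        qed
        ultimately show "- (2 powr p * \<bar>g k\<bar>) \<le> s k powr p * g k" by linarith
      qed
      ultimately show ?thesis by (simp add: c_def \<sigma>_def sum_negf sum_distrib_left)
    qed
    then have "(1/2) powr p * c * E \<le> s h powr p * (E * \<Gamma>)"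
    proof -
      assume "c \<le> \<Gamma>"
      then have "(1/2) powr p * c \<le> s h powr p * \<Gamma>" using slo c by (intro mult_mono) auto
      then have "(1/2) powr p * c * E \<le> s h powr p * \<Gamma> * E" using E by (intro mult_right_mono) auto
      then show ?thesis by (simp add: mult_ac)
    qed
    moreover have "- (4 powr p * \<bar>r\<bar> * E\<^sup>2) \<le> s h powr p * s h powr p * (E\<^sup>2 * r)"
    proof -
      have "s h powr p * s h powr p \<le> 2 powr p * 2 powr p" using shi by (intro mult_mono) auto
      also have "\<dots> = 4 powr p" by (simp flip: powr_mult)
      finally have "s h powr p * s h powr p * (E\<^sup>2 * \<bar>r\<bar>) \<le> 4 powr p * (E\<^sup>2 * \<bar>r\<bar>)"
        by (intro mult_right_mono) auto
      moreover have "s h powr p * s h powr p * (E\<^sup>2 * - \<bar>r\<bar>) \<le> s h powr p * s h powr p * (E\<^sup>2 * r)"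
        by (intro mult_left_mono) auto
      ultimately show ?thesis by (simp add: mult_ac)
    qed
    ultimately have *: "0 \<le> 2 * \<bar>\<rho>f E\<bar> - 1/(2*p) * (2 * ((1/2) powr p * c * E) - 4 powr p * \<bar>r\<bar> * E\<^sup>2)"
    proof -
      have *: "0 \<le> 2 * y - 1/(2*p) * (2 * b - d)"
        if "0 \<le> 1/2 * X - 1/(2*p) * (2 * Y + Z)" "X \<le> 4 * y" "b \<le> Y" "- d \<le> Z" for X Y Z y b d :: real
      proof -
        have "1/(2*p) * (2 * b - d) \<le> 1/(2*p) * (2 * Y + Z)"
          using that p by (intro mult_left_mono) auto
        then show ?thesis using that by linarith
      qed
      show ?thesis if "0 \<le> 1/2 * X - 1/(2*p) * (2 * Y + Z)" "X \<le> 4 * \<bar>\<rho>f E\<bar>"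
        "(1/2) powr p * c * E \<le> Y" "- (4 powr p * \<bar>r\<bar> * E\<^sup>2) \<le> Z" for X Y Z
        by (rule *[OF that])
    qed
    have "(1/2) powr p * c / p * E \<le> (2 * \<bar>\<rho>f E / E\<bar> + E * (4 powr p * \<bar>r\<bar> / (2 * p))) * E"
    proof -
      have "(1/2) powr p * c / p * E = 1/(2*p) * (2 * ((1/2) powr p * c * E))"
        using p by (simp add: field_simps)
      also have "\<dots> \<le> 2 * \<bar>\<rho>f E\<bar> + 1/(2*p) * (4 powr p * \<bar>r\<bar> * E\<^sup>2)"
        using * by (simp only: right_diff_distrib)
      also have "\<bar>\<rho>f E\<bar> = \<bar>\<rho>f E / E\<bar> * E" using E by simp
      finally show ?thesis by (simp add: algebra_simps power2_eq_square)
    qed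
    then show ?case by (rule mult_right_le_imp_le) (rule E(1))
  qed
  have lim: "((\<lambda>E. 2 * \<bar>\<rho>f E / E\<bar> + E * (4 powr p * \<bar>r\<bar> / (2 * p))) \<longlongrightarrow> 2 * \<bar>0\<bar> + 0 * (4 powr p * \<bar>r\<bar> / (2 * p))) (at_right 0)"
    by (intro tendsto_intros \<rho>lim)
  have "(1/2) powr p * c / p \<le> 2 * \<bar>0\<bar> + 0 * (4 powr p * \<bar>r\<bar> / (2 * p))"
    by (rule tendsto_lowerbound[OF lim ineq]) simp
  then have "(1/2) powr p * c / p \<le> 0" by simp
  moreover have "(1/2) powr p * c / p > 0" using c p by (intro divide_pos_pos mult_pos_pos) auto
  ultimately show False by linarith
qed

section \<open>Gain against loss under the conditions on the matrix\<close>

lemma cross_interaction_bound: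
  assumes uH: "\<And>i. i \<in> {1..l} \<Longrightarrow> u i \<in> H" and h: "h \<in> {1..q}" and j: "j \<in> {1..l}"
    and R: "\<And>m. m \<in> {1..l} \<Longrightarrow> sqrt (itr (u m) (u m)) \<le> R * sqrt (itr (u j) (u j))"
  shows "(\<Sum>k\<in>{1..q} - {h}. \<bar>\<Sum>m\<in>block L k. \<gamma> m * itr (u j) (u m)\<bar>)
    \<le> R * itr (u j) (u j) * (\<Sum>m\<in>{1..l} - block L h. \<bar>\<gamma> m\<bar>)"
proof -
  have one: "\<bar>\<gamma> m * itr (u j) (u m)\<bar> \<le> \<bar>\<gamma> m\<bar> * (R * itr (u j) (u j))" if m: "m \<in> {1..l}" for m
  proof -
    have "itr (u j) (u m) \<le> sqrt (itr (u j) (u j)) * sqrt (itr (u m) (u m))"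
      using uH[OF j] uH[OF m] by (intro interaction_Cauchy_Schwarz H_Lspace)
    also have "\<dots> \<le> sqrt (itr (u j) (u j)) * (R * sqrt (itr (u j) (u j)))"
      using R[OF m] by (intro mult_left_mono) (auto simp: interaction_nonneg)
    also have "\<dots> = R * itr (u j) (u j)" by (simp add: interaction_nonneg)
    finally show ?thesis by (simp add: abs_mult interaction_nonneg mult_left_mono)
  qed
  have "(\<Sum>k\<in>{1..q} - {h}. \<bar>\<Sum>m\<in>block L k. \<gamma> m * itr (u j) (u m)\<bar>)
      \<le> (\<Sum>k\<in>{1..q} - {h}. \<Sum>m\<in>block L k. \<bar>\<gamma> m\<bar> * (R * itr (u j) (u j)))"
  proof (rule sum_mono, rule order_trans[OF sum_abs sum_mono])
    fix k m assume "k \<in> {1..q} - {h}" "m \<in> block L k"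
    then show "\<bar>\<gamma> m * itr (u j) (u m)\<bar> \<le> \<bar>\<gamma> m\<bar> * (R * itr (u j) (u j))"
      using block_subset[of k m] one by blast
  qed
  also have "\<dots> = (\<Sum>m\<in>{1..l} - block L h. \<bar>\<gamma> m\<bar> * (R * itr (u j) (u j)))"
    by (rule sum_other_blocks[OF h, symmetric])
  also have "\<dots> = R * itr (u j) (u j) * (\<Sum>m\<in>{1..l} - block L h. \<bar>\<gamma> m\<bar>)"
    by (simp only: sum_distrib_left mult.commute)
  finally show ?thesis .
qed

lemma four_powr_le: "p \<le> 2 \<Longrightarrow> (4::real) powr p \<le> 16"
  using powr_mono[of p 2 "4::real"] by simp

text \<open>
  For \<open>p < 2\<close> nothing has to be taken from \<open>u\<^sub>j\<close>: the quadratic cost \<open>E\<^sup>2\<^sup>/\<^sup>p\<close> of the new component is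
  already of higher order.
\<close>

lemma perturbation_rate_subcritical:
  assumes "p < 2"
  shows "((\<lambda>E. (((1 - 0 * E) powr (2 / p) - 1) * a + E powr (2 / p) * b) / E) \<longlongrightarrow> 0) (at_right (0::real))"
proof -
  have e: "2 / p - 1 > 0" using p assms by (simp add: field_simps)
  have "((\<lambda>E. E powr (2 / p - 1) * b) \<longlongrightarrow> 0 powr (2 / p - 1) * b) (at_right (0::real))"
    by (intro tendsto_intros) (use e in \<open>auto simp: eventually_at_right_less less_imp_le eventually_at_filter\<close>)
  moreover have "\<forall>\<^sub>F E in at_right (0::real). E powr (2 / p - 1) * b
      = (((1 - 0 * E) powr (2 / p) - 1) * a + E powr (2 / p) * b) / E"
    using eventually_at_right_less[of "0::real"]
    by eventually_elim (simp add: powr_diff)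
  ultimately have "((\<lambda>E. (((1 - 0 * E) powr (2 / p) - 1) * a + E powr (2 / p) * b) / E)
      \<longlongrightarrow> 0 powr (2 / p - 1) * b) (at_right (0::real))"
    by (rule Lim_transform_eventually)
  moreover have "0 powr (2 / p - 1) * b = 0" by simp
  ultimately show ?thesis by (simp only:)
qed

text \<open>
  With \<open>\<tau> = 0\<close> the gain is at least \<open>\<beta>\<^sub>i\<^sub>j X\<^sup>2\<close>, where \<open>X\<^sup>2\<close> is the interaction of \<open>u\<^sub>j\<close> with itself, while the
  losses are at most \<open>X\<^sup>2 \<Sum> |\<beta>\<^sub>i\<^sub>m|\<close> times the ratio from \<open>dominant_component\<close>.
\<close>

lemma fully_nontrivial_subcritical:
  assumes u: "u \<in> nehari \<Omega> H l q p lam \<beta> L"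
    and min: "\<And>w. w \<in> nehari \<Omega> H l q p lam \<beta> L \<Longrightarrow> energy \<Omega> l p lam \<beta> u \<le> energy \<Omega> l p lam \<beta> w"
    and bound: "(\<Sum>h=1..q. block_sq u h) \<le> S * minmax_diag q L \<beta> powr (- 1 / (p - 1))"
    and S: "S > 0" and \<mu>: "minmax_diag q L \<beta> > 0"
    and p2: "p < 2"
    and cond: "condition1 (16 * (\<kappa> powr (p / (p - 1)) * S powr (p / 2))) l q p \<beta> L"
  shows "fully_nontrivial \<Omega> l u"
  unfolding fully_nontrivial_def
proof (intro ballI notI)
  fix i assume il: "i \<in> {1..l}" and zi: "zero_on \<Omega> (u i)"
  define C where "C = \<kappa> powr (p / (p - 1)) * S powr (p / 2)"
  have C: "C > 0" using \<kappa> S by (simp add: C_def)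
  obtain h where h: "h \<in> {1..q}" and i: "i \<in> block L h" using ex_block[OF il] by blast
  define M where "M = (MAX (i, j)\<in>block L h \<times> block L h. \<beta> i j)"
  define n where "n = real (card (block L h) - 1)"
  define \<mu>' where "\<mu>' = minmax_diag q L \<beta>"
  have M: "\<beta> a b \<le> M" if "a \<in> block L h" "b \<in> block L h" for a b
    unfolding M_def using that by (intro Max_ge) (auto intro!: image_eqI[of _ _ "(a, b)"])
  have M0: "M > 0" using M[OF i i] \<beta>_diag[OF il] by linarith
  have uH: "u m \<in> H" if "m \<in> {1..l}" for m using u that unfolding nehari_iff by blast
  obtain j where j: "j \<in> block L h" and xj: "sqrt (itr (u j) (u j)) > 0"
    and R: "\<And>m. m \<in> {1..l} \<Longrightarrow> sqrt (itr (u m) (u m)) \<le> C * (n * M / \<mu>') powr (p / (p - 1)) * sqrt (itr (u j) (u j))"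
    using dominant_component[OF u bound S \<mu> h i zi M] unfolding C_def n_def \<mu>'_def by blast
  have jl: "j \<in> {1..l}" using block_subset[OF h j] .
  have X: "itr (u j) (u j) > 0" using xj by simp
  have ij: "i \<noteq> j" using X interaction_zero_left[OF zi] by force
  have card2: "card (block L h) \<ge> 2"
    using card_mono[of "block L h" "{i, j}"] i j ij by auto
  then have n1: "n \<ge> 1" and n_eq: "n = real (L h) - real (L (h - 1)) - 1"
    using card_block[OF h] by (auto simp: n_def of_nat_diff)
  define \<sigma> where "\<sigma> = (\<Sum>m\<in>{1..l} - block L h. \<bar>\<beta> i m\<bar>)"
  define e where "e = p / (p - 1)"
  have "(\<Sum>m\<in>block L h. (\<beta> i m - 0 * \<beta> j m) * itr (u j) (u m))
      \<le> 4 powr p * (\<Sum>k\<in>{1..q} - {h}. \<bar>\<Sum>m\<in>block L k. (\<beta> i m - 0 * \<beta> j m) * itr (u j) (u m)\<bar>)"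
    by (rule component_perturbation[OF u min h i j ij zi perturbation_rate_subcritical[OF p2]])
  also have "\<dots> \<le> 4 powr p * (C * (n * M / \<mu>') powr e * itr (u j) (u j) * \<sigma>)"
    using cross_interaction_bound[where u=u and \<gamma>="\<beta> i", OF uH h jl R]
    by (simp add: \<sigma>_def e_def)
  also have "\<dots> \<le> 16 * (C * (n * M / \<mu>') powr e * itr (u j) (u j) * \<sigma>)"
    using four_powr_le p2 C X by (intro mult_right_mono mult_nonneg_nonneg) (auto simp: \<sigma>_def sum_nonneg)
  finally have up: "(\<Sum>m\<in>block L h. \<beta> i m * itr (u j) (u m)) \<le> 16 * (C * (n * M / \<mu>') powr e * itr (u j) (u j) * \<sigma>)"
    by simp
  have "\<beta> i j * itr (u j) (u j) \<le> (\<Sum>m\<in>block L h. \<beta> i m * itr (u j) (u m))"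
    using j \<beta>_in[OF h i] by (intro member_le_sum[of j _ "\<lambda>m. \<beta> i m * itr (u j) (u m)"]) (auto simp: interaction_nonneg)
  with up have "\<beta> i j * itr (u j) (u j) \<le> 16 * C * (n * M / \<mu>') powr e * \<sigma> * itr (u j) (u j)"
    by (simp add: mult_ac)
  then have main: "\<beta> i j \<le> 16 * C * (n * M / \<mu>') powr e * \<sigma>" using X by simp
  have \<mu>0: "\<mu>' > 0" using \<mu> by (simp add: \<mu>'_def)
  define \<Sigma> where "\<Sigma> = (\<Sum>i\<in>block L h. \<Sum>j\<in>{1..l} - block L h. \<bar>\<beta> i j\<bar>)"
  have \<sigma>\<Sigma>: "\<sigma> \<le> \<Sigma>" unfolding \<sigma>_def \<Sigma>_def
    using i by (intro member_le_sum[of i _ "\<lambda>i. \<Sum>j\<in>{1..l} - block L h. \<bar>\<beta> i j\<bar>"]) (auto intro: sum_nonneg)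
  have \<sigma>0: "\<sigma> \<ge> 0" by (simp add: \<sigma>_def sum_nonneg)
  define \<beta>m where "\<beta>m = (MIN (i, j)\<in>{(i, j). i \<in> block L h \<and> j \<in> block L h \<and> i \<noteq> j}. \<beta> i j)"
  have "\<beta>m \<le> \<beta> i j" unfolding \<beta>m_def
  proof (intro Min_le)
    have "finite (block L h \<times> block L h)" by simp
    then show "finite ((\<lambda>(i, j). \<beta> i j) ` {(i, j). i \<in> block L h \<and> j \<in> block L h \<and> i \<noteq> j})"
      by (intro finite_imageI) (rule finite_subset[of _ "block L h \<times> block L h"], auto)
  qed (use i j ij in \<open>auto intro!: image_eqI[of _ _ "(i, j)"]\<close>)
  have "16 * C * n powr (2 * e) * \<Sigma> < \<beta>m * (\<mu>' / M) powr e"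
    using cond h card2 unfolding condition1_def \<beta>m_def \<Sigma>_def M_def n_eq \<mu>'_def e_def C_def
    by auto
  also have "\<dots> \<le> \<beta> i j * (\<mu>' / M) powr e" using \<open>\<beta>m \<le> \<beta> i j\<close> by (intro mult_right_mono) auto
  also have "\<dots> \<le> (16 * C * (n * M / \<mu>') powr e * \<sigma>) * (\<mu>' / M) powr e" using main by (intro mult_right_mono) auto
  also have "\<dots> = 16 * C * \<sigma> * ((n * M / \<mu>') powr e * (\<mu>' / M) powr e)" by (simp add: mult_ac)
  also have "(n * M / \<mu>') powr e * (\<mu>' / M) powr e = n powr e"
    using n1 M0 \<mu>0 by (simp flip: powr_mult)
  also have "16 * C * \<sigma> * n powr e \<le> 16 * C * \<Sigma> * n powr (2 * e)"
  proof (rule mult_mono)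
    have "e > 0" using p by (simp add: e_def)
    then show "n powr e \<le> n powr (2 * e)" using n1 by (intro powr_mono) auto
  qed (use C \<sigma>\<Sigma> \<sigma>0 in auto)
  finally show False by (simp add: mult_ac)
qed

text \<open>
  For \<open>p = 2\<close> the cost \<open>E\<^sup>2\<^sup>/\<^sup>p\<close> is of the same order as the gain, so it has to be compensated: with \<open>\<tau> = 1\<close> the
  mass given to the slot \<open>i\<close> is taken from \<open>u\<^sub>j\<close>, and as \<open>\<lambda>\<^sub>i = \<lambda>\<^sub>j\<close> the quadratic part does not change at all.
  Equality of the off-diagonal entries cancels the interaction with the rest of the block and leaves
  the gain \<open>(b - \<beta>\<^sub>j\<^sub>j) X\<^sup>2\<close>.
\<close>

lemma fully_nontrivial_quadratic:
  assumes u: "u \<in> nehari \<Omega> H l q p lam \<beta> L"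
    and min: "\<And>w. w \<in> nehari \<Omega> H l q p lam \<beta> L \<Longrightarrow> energy \<Omega> l p lam \<beta> u \<le> energy \<Omega> l p lam \<beta> w"
    and bound: "(\<Sum>h=1..q. block_sq u h) \<le> S * minmax_diag q L \<beta> powr (- 1 / (p - 1))"
    and S: "S > 0" and \<mu>: "minmax_diag q L \<beta> > 0"
    and p2: "p = 2"
    and cond: "condition2 (16 * (\<kappa> powr (p / (p - 1)) * S powr (p / 2))) l q lam \<beta> L"
  shows "fully_nontrivial \<Omega> l u"
  unfolding fully_nontrivial_def
proof (intro ballI notI)
  fix i assume il: "i \<in> {1..l}" and zi: "zero_on \<Omega> (u i)"
  define C where "C = \<kappa> powr (p / (p - 1)) * S powr (p / 2)"
  have C: "C > 0" using \<kappa> S by (simp add: C_def)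
  obtain h where h: "h \<in> {1..q}" and i: "i \<in> block L h" using ex_block[OF il] by blast
  define n where "n = real (card (block L h) - 1)"
  define \<mu>' where "\<mu>' = minmax_diag q L \<beta>"
  have \<mu>0: "\<mu>' > 0" using \<mu> by (simp add: \<mu>'_def)
  have uH: "u m \<in> H" if "m \<in> {1..l}" for m using u that unfolding nehari_iff by blast
  have card2: "card (block L h) \<ge> 2"
  proof (rule ccontr)
    assume "\<not> ?thesis"
    moreover have "card (block L h) > 0" using i by (simp add: card_gt_0_iff) blast
    ultimately have "card (block L h) = 1" by simp
    then obtain c where "block L h = {c}" by (rule card_1_singletonE)
    then have "block L h = {i}" using i by simp
    then have "block_sq u h = (nlam i (u i))\<^sup>2" by (simp add: block_sq_def)
    also have "\<dots> = 0" using norm_eq_0[OF il uH[OF il]] zi by simp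
    finally show False using u h unfolding nehari_iff by force
  qed
  then have n_eq: "n = real (L h) - real (L (h - 1)) - 1"
    using card_block[OF h] by (auto simp: n_def of_nat_diff)
  define \<delta> where "\<delta> = (MAX (i, j)\<in>block L h \<times> block L h. \<Sum>m\<in>{1..l} - block L h. \<bar>\<beta> i m - \<beta> j m\<bar>)"
  define m\<beta> where "m\<beta> = (MAX i\<in>block L h. \<beta> i i)"
  obtain a b where ab: "\<forall>i\<in>block L h. lam i = a"
      "\<forall>i\<in>block L h. \<forall>j\<in>block L h. i \<noteq> j \<longrightarrow> \<beta> i j = b"
      "b > m\<beta> + 16 * C * (n * b / \<mu>')\<^sup>2 * \<delta>"
    using cond[unfolded condition2_def, rule_format, OF h card2]
    unfolding C_def[symmetric] n_eq[symmetric] \<mu>'_def[symmetric] \<delta>_def[symmetric] m\<beta>_def[symmetric]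
    by (elim exE conjE)
  have lam: "lam i = a" if "i \<in> block L h" for i using ab(1) that by blast
  have off: "\<beta> i j = b" if "i \<in> block L h" "j \<in> block L h" "i \<noteq> j" for i j using ab(2) that by blast
  note b = ab(3)
  have \<delta>: "(\<Sum>m\<in>{1..l} - block L h. \<bar>\<beta> c m - \<beta> d m\<bar>) \<le> \<delta>" if "c \<in> block L h" "d \<in> block L h" for c d
    unfolding \<delta>_def using that by (intro Max_ge) (auto intro!: image_eqI[of _ _ "(c, d)"])
  have \<delta>0: "\<delta> \<ge> 0" using \<delta>[OF i i] by simp
  have m\<beta>: "\<beta> c c \<le> m\<beta>" if "c \<in> block L h" for c
    unfolding m\<beta>_def using that by (intro Max_ge) auto
  have bm: "m\<beta> < b"
  proof -
    have "16 * C * (n * b / \<mu>')\<^sup>2 * \<delta> \<ge> 0" using C \<delta>0 by (intro mult_nonneg_nonneg) auto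
    then show ?thesis using b by linarith
  qed
  have b0: "b > 0" using m\<beta>[OF i] bm \<beta>_diag[OF il] by linarith
  have M: "\<beta> c d \<le> b" if "c \<in> block L h" "d \<in> block L h" for c d
    using off[OF that] m\<beta>[OF that(1)] bm by (cases "c = d") auto
  obtain j where j: "j \<in> block L h" and xj: "sqrt (itr (u j) (u j)) > 0"
    and R: "\<And>m. m \<in> {1..l} \<Longrightarrow> sqrt (itr (u m) (u m)) \<le> C * (n * b / \<mu>') powr (p / (p - 1)) * sqrt (itr (u j) (u j))"
    using dominant_component[OF u bound S \<mu> h i zi M] unfolding C_def n_def \<mu>'_def by blast
  have jl: "j \<in> {1..l}" using block_subset[OF h j] .
  have X: "itr (u j) (u j) > 0" using xj by simp
  have ij: "i \<noteq> j" using X interaction_zero_left[OF zi] by force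
  have rate: "((\<lambda>E. (((1 - 1 * E) powr (2 / p) - 1) * (nlam j (u j))\<^sup>2 + E powr (2 / p) * (nlam i (u j))\<^sup>2) / E)
        \<longlongrightarrow> 0) (at_right 0)"
  proof (rule Lim_transform_eventually)
    show "((\<lambda>E. 0) \<longlongrightarrow> (0::real)) (at_right (0::real))" by simp
    have "\<forall>\<^sub>F E in at_right (0::real). E < 1" by (rule eventually_at_rightI[of 0 1]) auto
    then show "\<forall>\<^sub>F E in at_right 0. 0 = (((1 - 1 * E) powr (2 / p) - 1) * (nlam j (u j))\<^sup>2 + E powr (2 / p) * (nlam i (u j))\<^sup>2) / E"
      using eventually_at_right_less[of "0::real"]
      by eventually_elim (simp add: p2 lam[OF i] lam[OF j])
  qed
  have "(\<Sum>m\<in>block L h. (\<beta> i m - 1 * \<beta> j m) * itr (u j) (u m))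
      \<le> 4 powr p * (\<Sum>k\<in>{1..q} - {h}. \<bar>\<Sum>m\<in>block L k. (\<beta> i m - 1 * \<beta> j m) * itr (u j) (u m)\<bar>)"
    by (rule component_perturbation[OF u min h i j ij zi rate])
  also have "\<dots> \<le> 4 powr p * (C * (n * b / \<mu>') powr (p / (p - 1)) * itr (u j) (u j) * (\<Sum>m\<in>{1..l} - block L h. \<bar>\<beta> i m - 1 * \<beta> j m\<bar>))"
    by (intro mult_left_mono cross_interaction_bound[where u=u, OF uH h jl R]) auto
  also have "\<dots> = 16 * (C * (n * b / \<mu>')\<^sup>2 * itr (u j) (u j) * (\<Sum>m\<in>{1..l} - block L h. \<bar>\<beta> i m - \<beta> j m\<bar>))"
    using b0 \<mu>0 by (simp add: p2 powr_numeral n_def)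
  also have "\<dots> \<le> 16 * (C * (n * b / \<mu>')\<^sup>2 * itr (u j) (u j) * \<delta>)"
    using C X by (intro mult_left_mono \<delta> i j mult_nonneg_nonneg) auto
  finally have up: "(\<Sum>m\<in>block L h. (\<beta> i m - \<beta> j m) * itr (u j) (u m)) \<le> 16 * (C * (n * b / \<mu>')\<^sup>2 * itr (u j) (u j) * \<delta>)"
    by simp
  have "(\<Sum>m\<in>block L h. (\<beta> i m - \<beta> j m) * itr (u j) (u m)) = (\<Sum>m\<in>{j}. (\<beta> i m - \<beta> j m) * itr (u j) (u m))"
  proof (rule sum.mono_neutral_right)
    show "\<forall>m\<in>block L h - {j}. (\<beta> i m - \<beta> j m) * itr (u j) (u m) = 0"
    proof
      fix m assume m: "m \<in> block L h - {j}"
      show "(\<beta> i m - \<beta> j m) * itr (u j) (u m) = 0"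
      proof (cases "m = i")
        case True then show ?thesis by (simp add: interaction_zero_right[OF zi])
      next
        case False
        then show ?thesis using off[OF i, of m] off[OF j, of m] m by auto
      qed
    qed
  qed (use j in auto)
  also have "\<dots> = (b - \<beta> j j) * itr (u j) (u j)" using off[OF i j ij] by simp
  finally have "(b - \<beta> j j) * itr (u j) (u j) \<le> (16 * C * (n * b / \<mu>')\<^sup>2 * \<delta>) * itr (u j) (u j)"
    using up by (simp add: mult_ac)
  then have "b - \<beta> j j \<le> 16 * C * (n * b / \<mu>')\<^sup>2 * \<delta>" using X by simp
  then show False using b m\<beta>[OF j] by linarith
qed

end

section \<open>Smooth bump functions\<close>

text \<open>
  The functions \<open>x\<^sup>-\<^sup>n exp (- 1/x)\<close>, extended by zero; up to linear combinations the family is closed under differentiation.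
\<close>

definition flat :: "nat \<Rightarrow> real \<Rightarrow> real" where
  "flat n x = (if x > 0 then inverse x ^ n * exp (- inverse x) else 0)"

lemma flat_has_derivative:
  "(flat n has_real_derivative flat (Suc (Suc n)) x - n * flat (Suc n) x) (at x)"
proof -
  consider "x > 0" | "x < 0" | "x = 0" by linarith
  then show ?thesis
  proof cases
    case 1
    have "((\<lambda>x. inverse x ^ n * exp (- inverse x)) has_real_derivative
        flat (Suc (Suc n)) x - n * flat (Suc n) x) (at x)"
    proof -
      have "((\<lambda>x. inverse x ^ n * exp (- inverse x)) has_real_derivative
        (real n * (- (inverse x * 1 * inverse x)) * inverse x ^ (n - Suc 0)) * exp (- inverse x)
        + exp (- inverse x) * (inverse x * 1 * inverse x) * inverse x ^ n) (at x)"
        using 1 by (auto intro!: derivative_eq_intros)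
      also have "(real n * (- (inverse x * 1 * inverse x)) * inverse x ^ (n - Suc 0)) * exp (- inverse x)
        + exp (- inverse x) * (inverse x * 1 * inverse x) * inverse x ^ n = flat (Suc (Suc n)) x - n * flat (Suc n) x"
        using 1 by (cases n) (simp_all add: flat_def algebra_simps)
      finally show ?thesis .
    qed
    then show ?thesis
      by (rule has_field_derivative_transform_within_open[of _ _ _ "{0<..}"]) (use 1 in \<open>auto simp: flat_def\<close>)
  next
    case 2
    have "((\<lambda>x. 0) has_real_derivative flat (Suc (Suc n)) x - n * flat (Suc n) x) (at x)"
      using 2 by (simp add: flat_def)
    then show ?thesis
      by (rule has_field_derivative_transform_within_open[of _ _ _ "{..<0}"]) (use 2 in \<open>auto simp: flat_def\<close>)
  next
    case 3
    have "((\<lambda>y. flat n y / y) \<longlongrightarrow> 0) (at 0)"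
    proof -
      have "((\<lambda>y. flat n y / y) \<longlongrightarrow> 0) (at_right 0)"
      proof (rule Lim_transform_eventually)
        show "((\<lambda>y. (inverse y) ^ Suc n / exp (inverse y)) \<longlongrightarrow> (0::real)) (at_right 0)"
          by (rule filterlim_compose[OF tendsto_power_div_exp_0 filterlim_inverse_at_top_right])
        show "\<forall>\<^sub>F y in at_right 0. inverse y ^ Suc n / exp (inverse y) = flat n y / y"
          using eventually_at_right_less[of 0]
          by eventually_elim (simp add: flat_def exp_minus field_simps)
      qed
      moreover have "((\<lambda>y. flat n y / y) \<longlongrightarrow> 0) (at_left 0)"
      proof (rule Lim_transform_eventually)
        show "((\<lambda>y. 0) \<longlongrightarrow> (0::real)) (at_left 0)" by simp
        show "\<forall>\<^sub>F y in at_left 0. 0 = flat n y / y"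
          by (rule eventually_at_leftI[of "-1"]) (auto simp: flat_def)
      qed
      ultimately show ?thesis by (simp add: filterlim_split_at)
    qed
    then show ?thesis using 3 by (simp add: has_field_derivative_iff flat_def)
  qed
qed

text \<open>
  A class of functions on the line that contains the building blocks of the bumps and is closed under
  differentiation, which replaces a notion of smoothness in one variable.
\<close>

inductive flat_poly :: "(real \<Rightarrow> real) \<Rightarrow> bool" where
  const: "flat_poly (\<lambda>x. c)"
| flat: "flat_poly (\<lambda>x. flat n (c * x + d))"
| add: "flat_poly f \<Longrightarrow> flat_poly g \<Longrightarrow> flat_poly (\<lambda>x. f x + g x)"
| mult: "flat_poly f \<Longrightarrow> flat_poly g \<Longrightarrow> flat_poly (\<lambda>x. f x * g x)"

lemma flat_poly_deriv:
  "flat_poly f \<Longrightarrow> \<exists>f'. flat_poly f' \<and> (\<forall>x. (f has_real_derivative f' x) (at x))"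
proof (induction rule: flat_poly.induct)
  case (const c)
  show ?case by (intro exI[of _ "\<lambda>x. 0"]) (auto intro: flat_poly.const)
next
  case (flat n c d)
  have "((\<lambda>x. flat n (c * x + d)) has_real_derivative
      c * flat (Suc (Suc n)) (c * x + d) + (- (n * c)) * flat (Suc n) (c * x + d)) (at x)" for x
  proof -
    have "((\<lambda>x. flat n (c * x + d)) has_real_derivative
      (flat (Suc (Suc n)) (c * x + d) - n * flat (Suc n) (c * x + d)) * c) (at x)"
      by (rule DERIV_chain2[OF flat_has_derivative]) (auto intro!: derivative_eq_intros)
    then show ?thesis by (simp add: algebra_simps)
  qed
  then show ?case
    by (intro exI[of _ "\<lambda>x. c * flat (Suc (Suc n)) (c * x + d) + (- (n * c)) * flat (Suc n) (c * x + d)"] conjI allI)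
       (rule flat_poly.intros)+
next
  case (add f g)
  then obtain f' g' where *: "flat_poly f'" "flat_poly g'"
    "\<And>x. (f has_real_derivative f' x) (at x)" "\<And>x. (g has_real_derivative g' x) (at x)" by blast
  show ?case
    by (intro exI[of _ "\<lambda>x. f' x + g' x"] conjI allI flat_poly.intros *) (auto intro!: derivative_eq_intros *)
next
  case (mult f g)
  then obtain f' g' where *: "flat_poly f'" "flat_poly g'"
    "\<And>x. (f has_real_derivative f' x) (at x)" "\<And>x. (g has_real_derivative g' x) (at x)" by blast
  show ?case
    by (intro exI[of _ "\<lambda>x. f' x * g x + g' x * f x"] conjI allI flat_poly.intros * mult.hyps) (auto intro!: derivative_eq_intros *)
qed

text \<open>
  Partial derivatives of a product of functions of single coordinates are again of this form, so
  smoothness in several variables reduces to one variable.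
\<close>

definition coord_prod :: "('n \<Rightarrow> real \<Rightarrow> real) \<Rightarrow> real^'n \<Rightarrow> real" where
  "coord_prod g x = (\<Prod>i\<in>UNIV. g i (x $ i))"

lemma coord_prod_derivative:
  assumes g: "\<And>i x. (g i has_real_derivative g' i x) (at x)"
  shows "(coord_prod g has_derivative
      (\<lambda>y. \<Sum>i\<in>UNIV. (g' i (x $ i) * y $ i) * (\<Prod>j\<in>UNIV - {i}. g j (x $ j)))) (at x)"
  unfolding coord_prod_def[abs_def]
proof (rule has_derivative_prod)
  fix i
  have "((\<lambda>x. x $ i) has_derivative (\<lambda>y. y $ i)) (at x)"
    by (rule bounded_linear_imp_has_derivative[OF bounded_linear_vec_nth])
  from has_derivative_compose[OF this g[of i "x $ i", unfolded has_field_derivative_def]]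
  show "((\<lambda>x. g i (x $ i)) has_derivative (\<lambda>y. g' i (x $ i) * y $ i)) (at x)" by simp
qed

lemma partial_deriv_coord_prod:
  assumes g: "\<And>i x. (g i has_real_derivative g' i x) (at x)"
  shows "partial_deriv k (coord_prod g) = coord_prod (g(k := g' k))"
proof
  fix x
  have "partial_deriv k (coord_prod g) x
      = (\<Sum>i\<in>UNIV. (g' i (x $ i) * axis k 1 $ i) * (\<Prod>j\<in>UNIV - {i}. g j (x $ j)))"
    unfolding partial_deriv_def frechet_derivative_at[OF coord_prod_derivative[OF g], symmetric] ..
  also have "\<dots> = (\<Sum>i\<in>UNIV. if i = k then g' k (x $ k) * (\<Prod>j\<in>UNIV - {k}. g j (x $ j)) else 0)"
    by (intro sum.cong refl) (auto simp: axis_def)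
  also have "\<dots> = g' k (x $ k) * (\<Prod>j\<in>UNIV - {k}. g j (x $ j))" by simp
  also have "\<dots> = coord_prod (g(k := g' k)) x"
    unfolding coord_prod_def by (subst prod.remove[of UNIV k]) auto
  finally show "partial_deriv k (coord_prod g) x = coord_prod (g(k := g' k)) x" .
qed

lemma smooth_coord_prod:
  assumes "\<And>i. flat_poly (g i)"
  shows "smooth (coord_prod g)"
proof -
  have step: "\<exists>g'. (\<forall>i. flat_poly (g' i)) \<and> (\<forall>i x. (g i has_real_derivative g' i x) (at x))"
    if "\<And>i. flat_poly (g i)" for g :: "'a \<Rightarrow> real \<Rightarrow> real"
    using flat_poly_deriv[OF that] by metis
  have "\<exists>g'. (\<forall>i. flat_poly (g' i)) \<and> foldr partial_deriv is (coord_prod g) = coord_prod g'" for "is"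
  proof (induction "is")
    case Nil then show ?case using assms by auto
  next
    case (Cons k "is")
    then obtain g1 where g1: "\<And>i. flat_poly (g1 i)" "foldr partial_deriv is (coord_prod g) = coord_prod g1"
      by blast
    obtain g2 where g2: "\<And>i. flat_poly (g2 i)" "\<And>i x. (g1 i has_real_derivative g2 i x) (at x)"
      using step[of g1, OF g1(1)] by blast
    have "partial_deriv k (coord_prod g1) = coord_prod (g1(k := g2 k))"
      by (rule partial_deriv_coord_prod) (rule g2(2))
    moreover have "\<forall>i. flat_poly ((g1(k := g2 k)) i)" using g1(1) g2(1) by simp
    ultimately have "(\<forall>i. flat_poly ((g1(k := g2 k)) i))
        \<and> foldr partial_deriv (k # is) (coord_prod g) = coord_prod (g1(k := g2 k))"
      using g1(2) by (simp only: foldr_Cons comp_apply) simp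
    then show ?case by (rule exI[of _ "g1(k := g2 k)"])
  qed
  moreover have "coord_prod g' differentiable (at x)" if "\<And>i. flat_poly (g' i)" for g' :: "'a \<Rightarrow> real \<Rightarrow> real" and x
    using step[of g', OF that] coord_prod_derivative[of g'] unfolding differentiable_def by blast
  ultimately show ?thesis unfolding smooth_def by metis
qed

text \<open>
  A bump on the box from \<open>a\<close> to \<open>b\<close>; for \<open>r \<rightarrow> \<infinity>\<close> it increases to the indicator of the open box.
\<close>

definition bump :: "real \<Rightarrow> real^'n \<Rightarrow> real^'n \<Rightarrow> real^'n \<Rightarrow> real" where
  "bump r a b = coord_prod (\<lambda>i t. flat 0 (r * t + - (r * a $ i)) * flat 0 (- r * t + r * b $ i))"

lemma bump_eq: "bump r a b x = (\<Prod>i\<in>UNIV. flat 0 (r * (x $ i - a $ i)) * flat 0 (r * (b $ i - x $ i)))"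
  by (simp add: bump_def coord_prod_def algebra_simps)

lemma smooth_bump: "smooth (bump r a b)"
  unfolding bump_def by (intro smooth_coord_prod flat_poly.intros)

lemma flat_0_bounds: "0 \<le> flat 0 x" "flat 0 x \<le> 1" "flat 0 x > 0 \<longleftrightarrow> x > 0"
  by (auto simp: flat_def)

lemma bump_nonneg: "0 \<le> bump r a b x"
  unfolding bump_eq by (intro prod_nonneg mult_nonneg_nonneg ballI conjI flat_0_bounds)

lemma bump_le_1: "bump r a b x \<le> 1"
  unfolding bump_eq by (intro prod_le_1 conjI mult_nonneg_nonneg mult_le_one flat_0_bounds)

lemma bump_pos: "r > 0 \<Longrightarrow> x \<in> box a b \<Longrightarrow> bump r a b x > 0"
  unfolding bump_eq by (intro prod_pos ballI mult_pos_pos) (auto simp: flat_0_bounds mem_box_cart)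

lemma bump_zero: "r > 0 \<Longrightarrow> x \<notin> box a b \<Longrightarrow> bump r a b x = 0"
proof -
  assume r: "r > 0" and "x \<notin> box a b"
  then obtain i where "\<not> (a $ i < x $ i \<and> x $ i < b $ i)" by (auto simp: mem_box_cart)
  then have "flat 0 (r * (x $ i - a $ i)) * flat 0 (r * (b $ i - x $ i)) = 0"
    using r by (auto simp: flat_def zero_less_mult_iff)
  then show ?thesis unfolding bump_eq by (intro prod_zero) auto
qed

lemma bump_Cc:
  assumes "r > 0" "cbox a b \<subseteq> \<Omega>"
  shows "bump r a b \<in> Cc_infinity \<Omega>"
proof -
  have "{x. bump r a b x \<noteq> 0} \<subseteq> cbox a b"
    using bump_zero[OF assms(1)] box_subset_cbox by blast
  then have cl: "closure {x. bump r a b x \<noteq> 0} \<subseteq> cbox a b"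
    by (rule closure_minimal) (rule closed_cbox)
  then have "compact (closure {x. bump r a b x \<noteq> 0})"
    using compact_cbox closed_closure compact_Int_closed by (metis inf.absorb_iff2)
  then show ?thesis using cl assms smooth_bump by (auto simp: Cc_infinity_def)
qed

lemma bump_tendsto:
  "(\<lambda>n. bump (real (Suc n)) a b x) \<longlonglongrightarrow> indicat_real (box a b) x"
proof (cases "x \<in> box a b")
  case False
  then show ?thesis by (simp add: bump_zero)
next
  case True
  have fl: "(\<lambda>n. flat 0 (real (Suc n) * y)) \<longlonglongrightarrow> 1" if "y > 0" for y
  proof -
    have "(\<lambda>n. exp (- (inverse (real (Suc n)) * inverse y))) \<longlonglongrightarrow> exp (- (0 * inverse y))"
      by (intro tendsto_intros LIMSEQ_inverse_real_of_nat)
    moreover have "flat 0 (real (Suc n) * y) = exp (- (inverse (real (Suc n)) * inverse y))" for n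
      using that by (simp add: flat_def zero_less_mult_iff del: of_nat_Suc)
    ultimately show ?thesis by simp
  qed
  have "(\<lambda>n. bump (real (Suc n)) a b x) \<longlonglongrightarrow> (\<Prod>i\<in>(UNIV::'a set). 1 * 1)"
    unfolding bump_eq
    by (intro tendsto_prod tendsto_mult fl) (use True in \<open>auto simp: mem_box_cart\<close>)
  then show ?thesis using True by simp
qed

section \<open>Test functions\<close>

lemma differentiable_partial:
  fixes F :: "real^'n \<Rightarrow> real"
  assumes "\<And>x. F differentiable (at x)"
  shows "((\<lambda>t. F (x + t *\<^sub>R axis i 1)) has_real_derivative partial_deriv i F (x + t *\<^sub>R axis i 1)) (at t)"
proof -
  have "((\<lambda>t. x + t *\<^sub>R axis i 1) has_derivative (\<lambda>s. s *\<^sub>R axis i (1::real))) (at t)"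
    by (auto intro!: derivative_eq_intros)
  from has_derivative_compose[OF this frechet_derivative_works[THEN iffD1, OF assms]]
  have "((\<lambda>t. F (x + t *\<^sub>R axis i 1)) has_derivative
      (\<lambda>s. frechet_derivative F (at (x + t *\<^sub>R axis i 1)) (s *\<^sub>R axis i 1))) (at t)" .
  moreover have "frechet_derivative F (at y) (s *\<^sub>R axis i 1) = partial_deriv i F y * s" for s y
    using linear_scale[OF linear_frechet_derivative[OF assms[of y]]]
    by (simp add: partial_deriv_def mult.commute)
  ultimately show ?thesis by (simp add: has_field_derivative_def)
qed

lemma partial_deriv_mult:
  fixes f g :: "real^'n \<Rightarrow> real"
  assumes "f differentiable (at x)" "g differentiable (at x)"
  shows "partial_deriv i (\<lambda>x. f x * g x) x = f x * partial_deriv i g x + partial_deriv i f x * g x"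
  unfolding partial_deriv_def
  using frechet_derivative_at[OF has_derivative_mult[OF frechet_derivative_works[THEN iffD1, OF assms(1)] frechet_derivative_works[THEN iffD1, OF assms(2)]], symmetric]
  by simp

lemma partial_deriv_cmult:
  fixes f :: "real^'n \<Rightarrow> real"
  assumes "f differentiable (at x)"
  shows "partial_deriv i (\<lambda>x. c * f x) x = c * partial_deriv i f x"
  unfolding partial_deriv_def
  using frechet_derivative_at[OF has_derivative_mult_right[OF frechet_derivative_works[THEN iffD1, OF assms]], of c, symmetric]
  by simp

lemma Cc_infinityE:
  fixes \<phi> :: "real^'n \<Rightarrow> real"
  assumes "\<phi> \<in> Cc_infinity \<Omega>"
  obtains K where "compact K" "K \<subseteq> \<Omega>" "\<And>x. x \<notin> K \<Longrightarrow> \<phi> x = 0" "\<And>x i. x \<notin> K \<Longrightarrow> partial_deriv i \<phi> x = 0"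
    "\<And>x. \<phi> differentiable (at x)" "continuous_on UNIV \<phi>" "\<And>i. continuous_on UNIV (partial_deriv i \<phi>)"
proof
  let ?K = "closure {x. \<phi> x \<noteq> 0}"
  have sm: "foldr partial_deriv is \<phi> differentiable (at x)" for "is" x
    using assms by (auto simp: Cc_infinity_def smooth_def)
  show d: "\<phi> differentiable (at x)" for x using sm[of "[]"] by simp
  show "compact ?K" "?K \<subseteq> \<Omega>" using assms by (auto simp: Cc_infinity_def)
  show z: "\<phi> x = 0" if "x \<notin> ?K" for x using that closure_subset[of "{x. \<phi> x \<noteq> 0}"] by blast
  show "partial_deriv i \<phi> x = 0" if "x \<notin> ?K" for x i
  proof -
    have "open (- ?K)" by (rule open_Compl) (rule closed_closure)
    have "((\<lambda>x. 0::real) has_derivative (\<lambda>x. 0)) (at x)" by (rule has_derivative_const)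
    then have "(\<phi> has_derivative (\<lambda>x. 0)) (at x)"
    proof (rule has_derivative_transform_within_open[OF _ \<open>open (- ?K)\<close>])
      show "x \<in> - ?K" using that by blast
      fix y assume "y \<in> - ?K"
      then show "0 = \<phi> y" using z[of y] by (metis ComplD)
    qed
    then have "(\<lambda>x. 0) = frechet_derivative \<phi> (at x)" by (rule frechet_derivative_at)
    then show ?thesis unfolding partial_deriv_def by metis
  qed
  show "continuous_on UNIV \<phi>"
    using d by (intro differentiable_imp_continuous_on) (auto simp: differentiable_on_def)
  show "continuous_on UNIV (partial_deriv i \<phi>)" for i
    using sm[of "[i]"] by (intro differentiable_imp_continuous_on) (auto simp: differentiable_on_def)
qed

lemma Cc_infinity_cmult:
  fixes \<phi> :: "real^'n \<Rightarrow> real"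
  assumes \<phi>: "\<phi> \<in> Cc_infinity \<Omega>"
  shows "(\<lambda>x. c * \<phi> x) \<in> Cc_infinity \<Omega>"
proof -
  have sm: "foldr partial_deriv is \<phi> differentiable (at x)" for "is" x
    using assms by (auto simp: Cc_infinity_def smooth_def)
  have "foldr partial_deriv is (\<lambda>x. c * \<phi> x) = (\<lambda>x. c * foldr partial_deriv is \<phi> x)" for "is"
    by (induction "is") (auto simp: partial_deriv_cmult sm)
  then have "smooth (\<lambda>x. c * \<phi> x)" unfolding smooth_def
    using sm by (auto intro!: derivative_intros)
  moreover have "closure {x. c * \<phi> x \<noteq> 0} \<subseteq> closure {x. \<phi> x \<noteq> 0}"
    by (intro closure_mono) auto
  moreover from this have "compact (closure {x. c * \<phi> x \<noteq> 0})"
    using \<phi> closed_closure compact_Int_closed unfolding Cc_infinity_def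
    by (metis (no_types, lifting) inf.absorb_iff2 mem_Collect_eq)
  ultimately show ?thesis using \<phi> by (auto simp: Cc_infinity_def)
qed

section \<open>Integrals of compactly supported functions\<close>

lemma compact_support_bounded:
  fixes f :: "real^'n \<Rightarrow> real"
  assumes f: "continuous_on UNIV f" and K: "compact K" "\<And>x. x \<notin> K \<Longrightarrow> f x = 0"
  obtains M where "M \<ge> 0" "\<And>x. \<bar>f x\<bar> \<le> M"
proof -
  have "bounded (f ` K)"
    using compact_continuous_image[OF continuous_on_subset[OF f] K(1)] by (auto intro: compact_imp_bounded)
  then obtain M where M: "M > 0" "\<And>x. x \<in> K \<Longrightarrow> \<bar>f x\<bar> \<le> M"
    unfolding bounded_pos by force
  have "\<bar>f x\<bar> \<le> M" for x using M K(2)[of x] by (cases "x \<in> K") auto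
  with M(1) show ?thesis using that[of M] by simp
qed

lemma compact_support_integrable:
  fixes f :: "real^'n \<Rightarrow> real"
  assumes f: "continuous_on UNIV f" and K: "compact K" "\<And>x. x \<notin> K \<Longrightarrow> f x = 0"
  shows "integrable lborel f"
proof -
  have "integrable lborel (\<lambda>x. indicator K x *\<^sub>R f x)"
    by (rule borel_integrable_compact[OF K(1) continuous_on_subset[OF f]]) simp
  moreover have "(\<lambda>x. indicator K x *\<^sub>R f x) = f"
    using K(2) by (auto simp: indicator_def fun_eq_iff)
  ultimately show ?thesis by simp
qed

lemma integral_lebesgue_on_support:
  fixes f :: "real^'n \<Rightarrow> real"
  assumes "open \<Omega>" "\<And>x. x \<notin> \<Omega> \<Longrightarrow> f x = 0"
  shows "(LINT x|lebesgue_on \<Omega>. f x) = integral\<^sup>L lebesgue f"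
    and "integrable (lebesgue_on \<Omega>) f \<longleftrightarrow> integrable lebesgue f"
proof -
  have O: "\<Omega> \<inter> space lebesgue \<in> sets lebesgue" using assms(1) by auto
  have "(\<lambda>x. indicator \<Omega> x *\<^sub>R f x) = f"
    using assms(2) by (auto simp: indicator_def fun_eq_iff)
  then show "(LINT x|lebesgue_on \<Omega>. f x) = integral\<^sup>L lebesgue f"
    and "integrable (lebesgue_on \<Omega>) f \<longleftrightarrow> integrable lebesgue f"
    using integral_restrict_space[OF O, of f] integrable_restrict_space[OF O, of f] by simp_all
qed

text \<open>
  The integral of a difference quotient vanishes by translation invariance.  The quotients are
  bounded by the maximum of the derivative and supported in a common ball, so dominated convergence
  applies.
\<close>

lemma integral_partial_deriv_zero:
  fixes F :: "real^'n \<Rightarrow> real"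
  assumes d: "\<And>x. F differentiable (at x)" and c: "continuous_on UNIV (partial_deriv i F)"
    and K: "compact K" "\<And>x. x \<notin> K \<Longrightarrow> F x = 0" "\<And>x. x \<notin> K \<Longrightarrow> partial_deriv i F x = 0"
  shows "(LINT x|lborel. partial_deriv i F x) = 0"
proof -
  let ?e = "axis i (1::real) :: real^'n"
  have cF: "continuous_on UNIV F"
    using d by (intro differentiable_imp_continuous_on) (auto simp: differentiable_on_def)
  have [measurable]: "F \<in> borel_measurable borel" "partial_deriv i F \<in> borel_measurable borel"
    using cF c by (auto intro: borel_measurable_continuous_onI)
  have intF: "integrable lborel F" by (rule compact_support_integrable[OF cF K(1,2)])
  obtain M where M: "M \<ge> 0" "\<And>x. \<bar>partial_deriv i F x\<bar> \<le> M"
    using compact_support_bounded[OF c K(1,3)] by blast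
  obtain R where R: "\<And>x. x \<in> K \<Longrightarrow> norm x \<le> R"
    using compact_imp_bounded[OF K(1)] unfolding bounded_iff by blast
  define r where "r n = inverse (real (Suc n))" for n
  have r: "r n > 0" "r n \<le> 1" for n by (auto simp: r_def field_simps)
  define Q where "Q n x = (F (r n *\<^sub>R ?e + x) - F x) / r n" for n x
  have shift: "integrable lborel (\<lambda>x. F (v + x))" "(LINT x|lborel. F (v + x)) = (LINT x|lborel. F x)" for v
  proof -
    have i: "integrable (distr lborel borel ((+) v)) F" by (simp add: lborel_distr_plus intF)
    show "integrable lborel (\<lambda>x. F (v + x))"
      by (rule integrable_distr[OF _ i]) simp
    have "integral\<^sup>L (distr lborel borel ((+) v)) F = (LINT x|lborel. F (v + x))"
      by (rule integral_distr) simp_all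
    then show "(LINT x|lborel. F (v + x)) = (LINT x|lborel. F x)" by (simp add: lborel_distr_plus)
  qed
  have Q0: "(LINT x|lborel. Q n x) = 0" for n
    unfolding Q_def using shift[of "r n *\<^sub>R ?e"] intF by simp
  have line: "((\<lambda>t. F (x + t *\<^sub>R ?e)) has_real_derivative partial_deriv i F (x + t *\<^sub>R ?e)) (at t)" for x t
    by (rule differentiable_partial[OF d])
  have Qb: "\<bar>Q n x\<bar> \<le> indicat_real (cball 0 (R + 1)) x * M" for n x
  proof (cases "x \<in> cball 0 (R + 1)")
    case True
    obtain z where "F (x + r n *\<^sub>R ?e) - F (x + 0 *\<^sub>R ?e) = (r n - 0) * partial_deriv i F (x + z *\<^sub>R ?e)"
      using MVT2[of 0 "r n" "\<lambda>t. F (x + t *\<^sub>R ?e)" "\<lambda>t. partial_deriv i F (x + t *\<^sub>R ?e)"] r(1) line by blast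
    then have "Q n x = partial_deriv i F (x + z *\<^sub>R ?e)"
      using r(1)[of n] by (simp add: Q_def add.commute field_simps)
    then show ?thesis using True M(2) by simp
  next
    case False
    then have nx: "norm x > R + 1" by (simp add: dist_norm)
    have "norm x = norm ((r n *\<^sub>R ?e + x) - r n *\<^sub>R ?e)" by simp
    also have "\<dots> \<le> norm (r n *\<^sub>R ?e + x) + norm (r n *\<^sub>R ?e)" by (rule norm_triangle_ineq4)
    also have "norm (r n *\<^sub>R ?e) \<le> 1" using r[of n] by (simp add: norm_axis_1)
    finally have "x \<notin> K" "r n *\<^sub>R ?e + x \<notin> K" using nx R[of x] R[of "r n *\<^sub>R ?e + x"] by linarith+
    then show ?thesis using K(2) M(1) by (simp add: Q_def indicator_def)
  qed
  have "(\<lambda>n. LINT x|lborel. Q n x) \<longlonglongrightarrow> (LINT x|lborel. partial_deriv i F x)"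
  proof (rule integral_dominated_convergence[where w = "\<lambda>x. indicator (cball 0 (R + 1)) x * M"])
    show "integrable lborel (\<lambda>x. indicat_real (cball (0::real^'n) (R + 1)) x * M)"
    proof -
      have "emeasure lborel (cball (0::real^'n) (R + 1)) < \<infinity>"
        by (rule emeasure_bounded_finite) simp
      then have "integrable lborel (indicat_real (cball (0::real^'n) (R + 1)))"
        by (intro integrable_real_indicator) simp_all
      then show ?thesis by simp
    qed
    show "AE x in lborel. norm (Q n x) \<le> indicat_real (cball 0 (R + 1)) x * M" for n
      using Qb by simp
    show "AE x in lborel. (\<lambda>n. Q n x) \<longlonglongrightarrow> partial_deriv i F x"
    proof (rule AE_I2)
      fix x
      have "((\<lambda>h. (F (x + h *\<^sub>R ?e) - F x) / h) \<longlongrightarrow> partial_deriv i F x) (at 0)"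
        using line[of x 0] by (simp add: has_field_derivative_iff)
      moreover have "filterlim r (at 0) sequentially"
        unfolding filterlim_at r_def using LIMSEQ_inverse_real_of_nat by auto
      ultimately show "(\<lambda>n. Q n x) \<longlonglongrightarrow> partial_deriv i F x"
        unfolding Q_def by (auto simp: add.commute[of _ x] intro: filterlim_compose)
    qed
    show "Q n \<in> borel_measurable lborel" for n unfolding Q_def by measurable
  qed simp
  then show ?thesis by (simp add: Q0 LIMSEQ_const_iff)
qed

section \<open>Weak gradients\<close>

lemma loc_integrable_test:
  fixes f \<xi> :: "real^'n \<Rightarrow> real"
  assumes f: "loc_integrable \<Omega> f" and O: "open \<Omega>" and \<xi>: "continuous_on UNIV \<xi>"
    and K: "compact K" "K \<subseteq> \<Omega>" "\<And>x. x \<notin> K \<Longrightarrow> \<xi> x = 0"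
  shows "integrable (lebesgue_on \<Omega>) (\<lambda>x. f x * \<xi> x)"
proof -
  obtain M where M: "M \<ge> 0" "\<And>x. \<bar>\<xi> x\<bar> \<le> M" using compact_support_bounded[OF \<xi> K(1,3)] by blast
  have Kl: "K \<inter> space lebesgue \<in> sets lebesgue" using K(1) by (simp add: borel_compact)
  have "integrable (lebesgue_on K) f" using f K by (simp add: loc_integrable_def)
  then have fK: "integrable lebesgue (\<lambda>x. indicator K x *\<^sub>R f x)" by (simp add: integrable_restrict_space[OF Kl])
  have [measurable]: "\<xi> \<in> borel_measurable lebesgue"
    using \<xi> by (intro measurable_completion) (auto intro: borel_measurable_continuous_onI)
  have "integrable lebesgue (\<lambda>x. (indicator K x *\<^sub>R f x) * \<xi> x)"
  proof (rule Bochner_Integration.integrable_bound[OF integrable_mult_left[OF fK, of M]])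
    show "(\<lambda>x. (indicator K x *\<^sub>R f x) * \<xi> x) \<in> borel_measurable lebesgue"
      using borel_measurable_integrable[OF fK] by measurable
    show "AE x in lebesgue. norm (indicator K x *\<^sub>R f x * \<xi> x) \<le> norm (indicator K x *\<^sub>R f x * M)"
      using M by (intro AE_I2) (auto simp: abs_mult intro!: mult_left_mono)
  qed
  moreover have "(\<lambda>x. (indicator K x *\<^sub>R f x) * \<xi> x) = (\<lambda>x. f x * \<xi> x)"
    using K(3) by (auto simp: indicator_def fun_eq_iff)
  ultimately have "integrable lebesgue (\<lambda>x. f x * \<xi> x)" by simp
  moreover have "f x * \<xi> x = 0" if "x \<notin> \<Omega>" for x using K that by auto
  ultimately show ?thesis using integral_lebesgue_on_support(2)[OF O] by metis
qed

lemma loc_integrable_lincomb: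
  fixes f g :: "real^'n \<Rightarrow> real"
  assumes "loc_integrable \<Omega> f" "loc_integrable \<Omega> g"
  shows "loc_integrable \<Omega> (\<lambda>x. a * f x + b * g x)"
  using assms unfolding loc_integrable_def by auto

lemma loc_integrable_continuous:
  fixes f :: "real^'n \<Rightarrow> real"
  assumes "continuous_on UNIV f"
  shows "loc_integrable \<Omega> f"
  unfolding loc_integrable_def
proof (intro allI impI)
  fix K assume K: "compact K \<and> K \<subseteq> \<Omega>"
  have Kl: "K \<inter> space lebesgue \<in> sets lebesgue" using K by (simp add: borel_compact)
  have "integrable lborel (\<lambda>x. indicator K x *\<^sub>R f x)"
    using K by (intro borel_integrable_compact continuous_on_subset[OF assms]) auto
  then have "integrable lebesgue (\<lambda>x. indicator K x *\<^sub>R f x)"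
    using integrable_completion borel_measurable_integrable by blast
  then show "integrable (lebesgue_on K) f" by (simp add: integrable_restrict_space[OF Kl])
qed

lemma has_weak_grad_lincomb:
  fixes u v :: "real^'n \<Rightarrow> real"
  assumes O: "open \<Omega>" and u: "has_weak_grad \<Omega> u g" and v: "has_weak_grad \<Omega> v k"
  shows "has_weak_grad \<Omega> (\<lambda>x. a * u x + b * v x) (\<lambda>x. a *\<^sub>R g x + b *\<^sub>R k x)"
  unfolding has_weak_grad_def
proof (intro conjI allI ballI)
  have l: "loc_integrable \<Omega> u" "loc_integrable \<Omega> v"
    "\<And>i. loc_integrable \<Omega> (\<lambda>x. g x $ i)" "\<And>i. loc_integrable \<Omega> (\<lambda>x. k x $ i)"
    using u v by (auto simp: has_weak_grad_def)
  show "loc_integrable \<Omega> (\<lambda>x. a * u x + b * v x)" by (intro loc_integrable_lincomb l)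
  show "loc_integrable \<Omega> (\<lambda>x. (a *\<^sub>R g x + b *\<^sub>R k x) $ i)" for i
    using loc_integrable_lincomb[OF l(3)[of i] l(4)[of i], of a b] by simp
  fix \<phi> i assume \<phi>: "\<phi> \<in> Cc_infinity \<Omega>"
  obtain K where K: "compact K" "K \<subseteq> \<Omega>" "\<And>x. x \<notin> K \<Longrightarrow> \<phi> x = 0" "\<And>x i. x \<notin> K \<Longrightarrow> partial_deriv i \<phi> x = 0"
    "continuous_on UNIV \<phi>" "\<And>i. continuous_on UNIV (partial_deriv i \<phi>)"
    using Cc_infinityE[OF \<phi>] by metis
  have iu: "integrable (lebesgue_on \<Omega>) (\<lambda>x. w x * partial_deriv i \<phi> x)" if "loc_integrable \<Omega> w" for w
    by (rule loc_integrable_test[OF that O K(6) K(1,2,4)])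
  have ig: "integrable (lebesgue_on \<Omega>) (\<lambda>x. w x * \<phi> x)" if "loc_integrable \<Omega> w" for w
    by (rule loc_integrable_test[OF that O K(5) K(1,2,3)])
  have "(LINT x|lebesgue_on \<Omega>. (a * u x + b * v x) * partial_deriv i \<phi> x)
      = (LINT x|lebesgue_on \<Omega>. a * (u x * partial_deriv i \<phi> x) + b * (v x * partial_deriv i \<phi> x))"
    by (simp add: algebra_simps)
  also have "\<dots> = a * (LINT x|lebesgue_on \<Omega>. u x * partial_deriv i \<phi> x) + b * (LINT x|lebesgue_on \<Omega>. v x * partial_deriv i \<phi> x)"
    using iu[OF l(1)] iu[OF l(2)] by simp
  also have "\<dots> = a * - (LINT x|lebesgue_on \<Omega>. g x $ i * \<phi> x) + b * - (LINT x|lebesgue_on \<Omega>. k x $ i * \<phi> x)"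
    using u v \<phi> unfolding has_weak_grad_def by auto
  also have "\<dots> = - (LINT x|lebesgue_on \<Omega>. a * (g x $ i * \<phi> x) + b * (k x $ i * \<phi> x))"
    using ig[OF l(3)[of i]] ig[OF l(4)[of i]] by simp
  also have "\<dots> = - (LINT x|lebesgue_on \<Omega>. (a *\<^sub>R g x + b *\<^sub>R k x) $ i * \<phi> x)"
    by (simp add: algebra_simps)
  finally show "(LINT x|lebesgue_on \<Omega>. (a * u x + b * v x) * partial_deriv i \<phi> x)
      = - (LINT x|lebesgue_on \<Omega>. (a *\<^sub>R g x + b *\<^sub>R k x) $ i * \<phi> x)" .
qed

text \<open>
  Integration by parts: the product of two test functions has a partial derivative with integral zero.
\<close>

lemma has_weak_grad_Cc:
  fixes \<phi> :: "real^'n \<Rightarrow> real"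
  assumes O: "open \<Omega>" and \<phi>: "\<phi> \<in> Cc_infinity \<Omega>"
  shows "has_weak_grad \<Omega> \<phi> (grad \<phi>)"
  unfolding has_weak_grad_def
proof (intro conjI allI ballI)
  obtain K where K: "compact K" "K \<subseteq> \<Omega>" "\<And>x. x \<notin> K \<Longrightarrow> \<phi> x = 0" "\<And>x i. x \<notin> K \<Longrightarrow> partial_deriv i \<phi> x = 0"
    "\<And>x. \<phi> differentiable (at x)" "continuous_on UNIV \<phi>" "\<And>i. continuous_on UNIV (partial_deriv i \<phi>)"
    using Cc_infinityE[OF \<phi>] by metis
  show "loc_integrable \<Omega> \<phi>" by (intro loc_integrable_continuous K)
  show "loc_integrable \<Omega> (\<lambda>x. grad \<phi> x $ i)" for i
    using loc_integrable_continuous[OF K(7)] by (simp add: grad_def)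
  fix \<xi> i assume \<xi>: "\<xi> \<in> Cc_infinity \<Omega>"
  obtain J where J: "\<And>x. \<xi> differentiable (at x)" "continuous_on UNIV \<xi>" "\<And>i. continuous_on UNIV (partial_deriv i \<xi>)"
    using Cc_infinityE[OF \<xi>] by metis
  have pm: "partial_deriv i (\<lambda>x. \<phi> x * \<xi> x) = (\<lambda>x. \<phi> x * partial_deriv i \<xi> x + partial_deriv i \<phi> x * \<xi> x)"
    using partial_deriv_mult K(5) J(1) by blast
  have i1: "integrable lborel (\<lambda>x. \<phi> x * partial_deriv i \<xi> x)"
    by (rule compact_support_integrable[OF _ K(1)]) (auto intro!: continuous_intros K J simp: K(3))
  have i2: "integrable lborel (\<lambda>x. partial_deriv i \<phi> x * \<xi> x)"
    by (rule compact_support_integrable[OF _ K(1)]) (auto intro!: continuous_intros K J simp: K(4))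
  have "(LINT x|lborel. partial_deriv i (\<lambda>x. \<phi> x * \<xi> x) x) = 0"
  proof (rule integral_partial_deriv_zero[OF _ _ K(1)])
    show "(\<lambda>x. \<phi> x * \<xi> x) differentiable (at x)" for x using K(5) J(1) by (rule differentiable_mult)
    show "continuous_on UNIV (partial_deriv i (\<lambda>x. \<phi> x * \<xi> x))"
      unfolding pm by (intro continuous_intros K J)
  qed (auto simp: pm K(3,4))
  then have "(LINT x|lborel. \<phi> x * partial_deriv i \<xi> x) = - (LINT x|lborel. partial_deriv i \<phi> x * \<xi> x)"
    unfolding pm using i1 i2 by simp
  moreover have "(LINT x|lebesgue_on \<Omega>. \<phi> x * partial_deriv i \<xi> x) = (LINT x|lborel. \<phi> x * partial_deriv i \<xi> x)"
    using K by (subst integral_lebesgue_on_support[OF O]) (auto intro!: integral_completion borel_measurable_integrable[OF i1])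
  moreover have "(LINT x|lebesgue_on \<Omega>. grad \<phi> x $ i * \<xi> x) = (LINT x|lborel. partial_deriv i \<phi> x * \<xi> x)"
    using K by (subst integral_lebesgue_on_support[OF O]) (auto simp: grad_def intro!: integral_completion borel_measurable_integrable[OF i2])
  ultimately show "(LINT x|lebesgue_on \<Omega>. \<phi> x * partial_deriv i \<xi> x) = - (LINT x|lebesgue_on \<Omega>. grad \<phi> x $ i * \<xi> x)"
    by simp
qed

text \<open>
  Boxes are stable under intersection and generate the Borel sets; the sets with integral zero form a
  Dynkin system.
\<close>

lemma zero_if_box_integrals_zero:
  fixes f :: "real^'n \<Rightarrow> real"
  assumes f: "integrable lebesgue f"
    and box: "\<And>a b. (LINT x|lebesgue. indicator (box a b) x * f x) = 0"
    and total: "(LINT x|lebesgue. f x) = 0"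
  shows "AE x in lebesgue. f x = 0"
proof (rule density_unique_real[OF f, of "\<lambda>_. 0", simplified])
  have int: "integrable lebesgue (\<lambda>x. indicator A x * f x)" if "A \<in> sets lebesgue" for A
    using integrable_mult_indicator[OF that f] by simp
  have borel: "(LINT x|lebesgue. indicator B x * f x) = 0" if "B \<in> sets borel" for B
  proof -
    have B: "B \<in> sigma_sets UNIV (range (\<lambda>(a, b). box a b :: (real^'n) set))"
      using that unfolding borel_eq_box by (simp add: sets_measure_of)
    have stable: "Int_stable (range (\<lambda>(a, b). box a b :: (real^'n) set))"
    proof (rule Int_stableI)
      have rg: "box c d \<in> range (\<lambda>(a, b). box a b :: (real^'n) set)" for c d
        by (rule range_eqI[of _ _ "(c, d)"]) simp
      fix A B assume "A \<in> range (\<lambda>(a, b). box a b :: (real^'n) set)" "B \<in> range (\<lambda>(a, b). box a b :: (real^'n) set)"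
      then obtain a b c d where "A = box a b" "B = box c d" by auto
      then show "A \<inter> B \<in> range (\<lambda>(a, b). box a b :: (real^'n) set)"
        unfolding box_Int_box by (simp only: rg box_Int_box)
    qed
    have sets: "A \<in> sets borel \<longleftrightarrow> A \<in> sigma_sets UNIV (range (\<lambda>(a, b). box a b :: (real^'n) set))" for A
      unfolding borel_eq_box by (simp add: sets_measure_of)
    have sub: "range (\<lambda>(a, b). box a b :: (real^'n) set) \<subseteq> Pow UNIV" by simp
    from stable sub B show ?thesis
    proof (induction rule: sigma_sets_induct_disjoint)
      case (compl A)
      then have A: "A \<in> sets lebesgue" by (intro sets_completionI_sets) (simp add: sets)
      have "(LINT x|lebesgue. indicator (UNIV - A) x * f x) = (LINT x|lebesgue. f x - indicator A x * f x)"
        by (intro Bochner_Integration.integral_cong) (auto simp: indicator_def)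
      also have "\<dots> = 0" using int[OF A] f compl(2) total by simp
      finally show ?case .
    next
      case (union A)
      have A: "A i \<in> sets lebesgue" for i
        using union(2) by (intro sets_completionI_sets) (auto simp: sets)
      then have U: "(\<Union>i. A i) \<in> sets lebesgue" by blast
      have "(LINT x:(\<Union>i. A i)|lebesgue. f x) = (\<Sum>i. (LINT x:(A i)|lebesgue. f x))"
        using A union(1) int[OF U]
        by (intro lebesgue_integral_countable_add) (auto simp: disjoint_family_on_def set_integrable_def)
      then show ?case using union(3) by (simp add: set_lebesgue_integral_def)
    qed (use box in auto)
  qed
  fix A :: "(real^'n) set" assume "A \<in> sets lebesgue"
  then obtain S N N' where S: "A = S \<union> N" "S \<in> sets lborel" "N \<subseteq> N'" "N' \<in> null_sets lborel"
    using sets_completionE[of A lborel] by metis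
  have "AE x in lebesgue. x \<notin> N'" using S(4) by (intro AE_completion AE_not_in)
  then have "(LINT x|lebesgue. indicator A x * f x) = (LINT x|lebesgue. indicator S x * f x)"
  proof (intro integral_cong_AE)
    show "(\<lambda>x. indicator A x * f x) \<in> borel_measurable lebesgue"
      by (rule borel_measurable_integrable[OF int[OF \<open>A \<in> sets lebesgue\<close>]])
    have "S \<in> sets lebesgue" using S(2) by (rule sets_completionI_sets)
    then show "(\<lambda>x. indicator S x * f x) \<in> borel_measurable lebesgue"
      by (rule borel_measurable_integrable[OF int])
    show "AE x in lebesgue. indicator A x * f x = indicator S x * f x"
      using \<open>AE x in lebesgue. x \<notin> N'\<close> by eventually_elim (use S(1,3) in \<open>auto simp: indicator_def\<close>)
  qed
  also have "\<dots> = 0" using borel S(2) by simp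
  finally show "set_lebesgue_integral lebesgue A f = 0" by (simp add: set_lebesgue_integral_def)
qed

text \<open>
  Bumps approximate the indicators of boxes, so \<open>f\<close> has integral zero on every box whose closure lies in
  \<open>\<Omega>\<close>; countably many closed boxes exhaust \<open>\<Omega>\<close>.
\<close>

lemma fundamental_lemma_of_variations:
  fixes f :: "real^'n \<Rightarrow> real"
  assumes O: "open \<Omega>" and f: "loc_integrable \<Omega> f"
    and test: "\<And>\<phi>. \<phi> \<in> Cc_infinity \<Omega> \<Longrightarrow> (LINT x|lebesgue_on \<Omega>. f x * \<phi> x) = 0"
  shows "AE x in lebesgue_on \<Omega>. f x = 0"
proof -
  have intc: "integrable lebesgue (\<lambda>x. indicator (cbox c d) x * f x)" if "cbox c d \<subseteq> \<Omega>" for c d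
  proof -
    have "integrable (lebesgue_on (cbox c d)) f" using f that compact_cbox[of c d] unfolding loc_integrable_def by blast
    moreover have "cbox c d \<inter> space lebesgue \<in> sets lebesgue" by simp
    ultimately show ?thesis using integrable_restrict_space[of "cbox c d" lebesgue f] by simp
  qed
  have intb: "integrable lebesgue (\<lambda>x. indicator (box c d) x * f x)" if "cbox c d \<subseteq> \<Omega>" for c d
  proof -
    have "integrable lebesgue (\<lambda>x. indicator (box c d) x *\<^sub>R (indicator (cbox c d) x * f x))"
      by (rule integrable_mult_indicator[OF _ intc[OF that]]) simp
    moreover have "(\<lambda>x. indicator (box c d) x *\<^sub>R (indicator (cbox c d) x * f x)) = (\<lambda>x. indicator (box c d) x * f x)"
      using box_subset_cbox[of c d] by (auto simp: indicator_def fun_eq_iff)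
    ultimately show ?thesis by simp
  qed
  have zero: "(LINT x|lebesgue. indicator (box c d) x * f x) = 0" if cd: "cbox c d \<subseteq> \<Omega>" for c d
  proof -
    define s where "s n x = f x * bump (real (Suc n)) c d x" for n x
    have Cc: "bump (real (Suc n)) c d \<in> Cc_infinity \<Omega>" for n by (rule bump_Cc[OF _ cd]) simp
    have "s n x = 0" if "x \<notin> \<Omega>" for n x
      using that cd box_subset_cbox[of c d] bump_zero[of "real (Suc n)" x c d] by (auto simp: s_def)
    then have "(LINT x|lebesgue. s n x) = (LINT x|lebesgue_on \<Omega>. s n x)" for n
      using integral_lebesgue_on_support(1)[OF O, of "s n"] by simp
    then have s0: "(LINT x|lebesgue. s n x) = 0" for n using test[OF Cc[of n]] by (simp add: s_def)
    have "continuous_on UNIV (bump (real (Suc n)) c d)" for n using Cc_infinityE[OF Cc[of n]] by metis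
    then have [measurable]: "bump (real (Suc n)) c d \<in> borel_measurable lebesgue" for n
      by (intro measurable_completion) (auto intro: borel_measurable_continuous_onI)
    have s_eq: "s n x = (indicator (cbox c d) x * f x) * bump (real (Suc n)) c d x" for n x
      using bump_zero[of "real (Suc n)" x c d] box_subset_cbox[of c d] by (auto simp: s_def indicator_def)
    have "(\<lambda>n. LINT x|lebesgue. s n x) \<longlonglongrightarrow> (LINT x|lebesgue. indicator (box c d) x * f x)"
    proof (rule integral_dominated_convergence[where w = "\<lambda>x. \<bar>indicator (cbox c d) x * f x\<bar>"])
      show "integrable lebesgue (\<lambda>x. \<bar>indicator (cbox c d) x * f x\<bar>)" using intc[OF cd] by simp
      show "s n \<in> borel_measurable lebesgue" for n
        unfolding s_eq[abs_def] using borel_measurable_integrable[OF intc[OF cd]] by measurable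
      show "(\<lambda>x. indicator (box c d) x * f x) \<in> borel_measurable lebesgue"
        using intb[OF cd] by (rule borel_measurable_integrable)
      show "AE x in lebesgue. (\<lambda>n. s n x) \<longlonglongrightarrow> indicator (box c d) x * f x"
        unfolding s_def by (intro AE_I2) (subst mult.commute, intro tendsto_intros bump_tendsto)
      show "AE x in lebesgue. norm (s n x) \<le> \<bar>indicator (cbox c d) x * f x\<bar>" for n
      proof (rule AE_I2)
        fix x
        have "\<bar>indicator (cbox c d) x * f x\<bar> * \<bar>bump (real (Suc n)) c d x\<bar> \<le> \<bar>indicator (cbox c d) x * f x\<bar> * 1"
          using bump_nonneg[of "real (Suc n)" c d x] bump_le_1[of "real (Suc n)" c d x] by (intro mult_left_mono) auto
        then show "norm (s n x) \<le> \<bar>indicator (cbox c d) x * f x\<bar>" by (simp add: s_eq abs_mult)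
      qed
    qed
    then show ?thesis by (simp add: s0 LIMSEQ_const_iff)
  qed
  have AEbox: "AE x in lebesgue. indicator (box c d) x * f x = 0" if cd: "cbox c d \<subseteq> \<Omega>" for c d
  proof (rule zero_if_box_integrals_zero[OF intb[OF cd] _ zero[OF cd]])
    fix a b :: "real^'n"
    obtain e g where eg: "box a b \<inter> box c d = box e g" unfolding box_Int_box by blast
    have "(LINT x|lebesgue. indicator (box e g) x * f x) = 0"
    proof (cases "box e g = {}")
      case False
      then have "cbox e g = closure (box e g)" by simp
      also have "\<dots> \<subseteq> cbox c d"
        by (rule closure_minimal) (use eg box_subset_cbox[of c d] in auto)
      finally show ?thesis using cd by (intro zero) auto
    qed simp
    moreover have "indicator (box e g) x * f x = indicator (box a b) x * (indicator (box c d) x * f x)" for x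
      unfolding eg[symmetric] by (simp add: indicator_inter_arith)
    ultimately show "(LINT x|lebesgue. indicator (box a b) x * (indicator (box c d) x * f x)) = 0" by simp
  qed
  obtain \<D> where D: "countable \<D>" "\<D> \<subseteq> Pow \<Omega>" "\<And>X. X \<in> \<D> \<Longrightarrow> \<exists>a b. X = cbox a b" "\<Union>\<D> = \<Omega>"
    using open_countable_Union_open_cbox[OF O] by metis
  have "AE x in lebesgue. x \<in> X \<longrightarrow> f x = 0" if XD: "X \<in> \<D>" for X
  proof -
    obtain a b where X: "X = cbox a b" using D(3)[OF XD] by blast
    have "negligible (cbox a b - box a b)" by (rule negligible_frontier_interval)
    then have "AE x in lebesgue. x \<notin> cbox a b - box a b"
      by (intro AE_not_in) (simp add: negligible_iff_null_sets)
    moreover have "AE x in lebesgue. indicator (box a b) x * f x = 0"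
      using XD D(2) X by (intro AEbox) auto
    ultimately show ?thesis by eventually_elim (auto simp: X indicator_def split: if_splits)
  qed
  then have "AE x in lebesgue. \<forall>X\<in>\<D>. x \<in> X \<longrightarrow> f x = 0"
    by (subst AE_ball_countable[OF D(1)]) blast
  then have "AE x in lebesgue. x \<in> \<Omega> \<longrightarrow> f x = 0"
    by eventually_elim (use D(4) in blast)
  then show ?thesis using O by (simp add: AE_restrict_space_iff)
qed

text \<open>
  The weak gradient in the norm is picked by a choice operator, so that even homogeneity of the norm
  depends on this uniqueness.
\<close>

lemma weak_grad_unique:
  fixes u :: "real^'n \<Rightarrow> real"
  assumes O: "open \<Omega>" and g: "has_weak_grad \<Omega> u g" and k: "has_weak_grad \<Omega> u k"
  shows "AE x in lebesgue_on \<Omega>. g x = k x"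
proof -
  have "has_weak_grad \<Omega> (\<lambda>x. 1 * u x + (-1) * u x) (\<lambda>x. 1 *\<^sub>R g x + (-1) *\<^sub>R k x)"
    by (rule has_weak_grad_lincomb[OF O g k])
  then have z: "has_weak_grad \<Omega> (\<lambda>x. 0) (\<lambda>x. g x - k x)" by simp
  have "AE x in lebesgue_on \<Omega>. (g x - k x) $ i = 0" for i
  proof (rule fundamental_lemma_of_variations[OF O])
    show "loc_integrable \<Omega> (\<lambda>x. (g x - k x) $ i)" using z by (simp add: has_weak_grad_def)
    show "(LINT x|lebesgue_on \<Omega>. (g x - k x) $ i * \<phi> x) = 0" if "\<phi> \<in> Cc_infinity \<Omega>" for \<phi>
      using z that by (simp add: has_weak_grad_def)
  qed
  then have "AE x in lebesgue_on \<Omega>. \<forall>i\<in>UNIV. (g x - k x) $ i = 0"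
    by (subst AE_ball_countable) auto
  then show ?thesis by eventually_elim (simp add: vec_eq_iff)
qed

lemma weak_grad_AE:
  assumes "open \<Omega>" "has_weak_grad \<Omega> u g"
  shows "AE x in lebesgue_on \<Omega>. weak_grad \<Omega> u x = g x"
proof -
  have "has_weak_grad \<Omega> u (weak_grad \<Omega> u)"
    unfolding weak_grad_def by (rule someI[of _ g]) (rule assms(2))
  then show ?thesis using weak_grad_unique[OF assms(1)] assms(2) by blast
qed

lemma weak_grad_scale_AE:
  assumes O: "open \<Omega>" and g: "has_weak_grad \<Omega> v g"
  shows "AE x in lebesgue_on \<Omega>. weak_grad \<Omega> (\<lambda>x. t * v x) x = t *\<^sub>R weak_grad \<Omega> v x"
proof -
  have "has_weak_grad \<Omega> (\<lambda>x. t * v x) (\<lambda>x. t *\<^sub>R g x)"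
    using has_weak_grad_lincomb[OF O g g, of t 0] by simp
  from weak_grad_AE[OF O this] weak_grad_AE[OF O g] show ?thesis by eventually_elim simp
qed

text \<open>
  Almost everywhere equal integrands have equal integrals once both are measurable; for weak
  gradients this is obtained from local integrability by exhausting \<open>\<Omega>\<close> with closed boxes.
\<close>

lemma loc_integrable_measurable:
  fixes f :: "real^'n \<Rightarrow> real"
  assumes O: "open \<Omega>" and f: "loc_integrable \<Omega> f"
  shows "f \<in> borel_measurable (lebesgue_on \<Omega>)"
proof -
  obtain \<D> where D: "countable \<D>" "\<D> \<subseteq> Pow \<Omega>" "\<And>X. X \<in> \<D> \<Longrightarrow> \<exists>a b. X = cbox a b" "\<Union>\<D> = \<Omega>"
    using open_countable_Union_open_cbox[OF O] by metis
  show ?thesis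
  proof (rule measurable_piecewise_restrict[OF D(1)])
    show "space (lebesgue_on \<Omega>) \<subseteq> \<Union>\<D>" using D(4) by simp
    fix X assume X: "X \<in> \<D>"
    then obtain a b where ab: "X = cbox a b" using D(3) by blast
    have sub: "X \<subseteq> \<Omega>" using X D(2) by blast
    show "X \<inter> space (lebesgue_on \<Omega>) \<in> sets (lebesgue_on \<Omega>)"
      using O sub ab by (auto simp: sets_restrict_space_iff Int_absorb2)
    have "integrable (lebesgue_on X) f" using f sub compact_cbox[of a b] unfolding loc_integrable_def ab by blast
    moreover have "restrict_space (lebesgue_on \<Omega>) X = lebesgue_on X"
      using O sub ab by (simp add: restrict_restrict_space Int_absorb1)
    ultimately show "f \<in> borel_measurable (restrict_space (lebesgue_on \<Omega>) X)" by simp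
  qed
qed

lemma has_weak_grad_measurable:
  fixes v :: "real^'n \<Rightarrow> real"
  assumes O: "open \<Omega>" and g: "has_weak_grad \<Omega> v g"
  shows "(\<lambda>x. (norm (g x))\<^sup>2 + (v x)\<^sup>2) \<in> borel_measurable (lebesgue_on \<Omega>)"
proof -
  have [measurable]: "(\<lambda>x. g x $ i) \<in> borel_measurable (lebesgue_on \<Omega>)" "v \<in> borel_measurable (lebesgue_on \<Omega>)" for i
    using g loc_integrable_measurable[OF O] by (auto simp: has_weak_grad_def)
  have "(norm (g x))\<^sup>2 = (\<Sum>i\<in>UNIV. g x $ i * g x $ i)" for x
    by (simp add: power2_norm_eq_inner inner_vec_def)
  then show ?thesis by simp
qed

lemma H1_norm_scale:
  fixes v :: "real^'n \<Rightarrow> real"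
  assumes O: "open \<Omega>" and g: "has_weak_grad \<Omega> v g"
  shows "H1_norm \<Omega> (\<lambda>x. t * v x) = \<bar>t\<bar> * H1_norm \<Omega> v"
proof -
  have some: "has_weak_grad \<Omega> w (weak_grad \<Omega> w)" if "has_weak_grad \<Omega> w k" for w k
    unfolding weak_grad_def by (rule someI[of _ k]) (rule that)
  have gt: "has_weak_grad \<Omega> (\<lambda>x. t * v x) (\<lambda>x. t *\<^sub>R g x)"
    using has_weak_grad_lincomb[OF O g g, of t 0] by simp
  have "(LINT x|lebesgue_on \<Omega>. (norm (weak_grad \<Omega> (\<lambda>x. t * v x) x))\<^sup>2 + (t * v x)\<^sup>2)
      = (LINT x|lebesgue_on \<Omega>. t\<^sup>2 * ((norm (weak_grad \<Omega> v x))\<^sup>2 + (v x)\<^sup>2))"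
  proof (rule integral_cong_AE)
    show "(\<lambda>x. (norm (weak_grad \<Omega> (\<lambda>x. t * v x) x))\<^sup>2 + (t * v x)\<^sup>2) \<in> borel_measurable (lebesgue_on \<Omega>)"
      by (rule has_weak_grad_measurable[OF O some[OF gt]])
    show "(\<lambda>x. t\<^sup>2 * ((norm (weak_grad \<Omega> v x))\<^sup>2 + (v x)\<^sup>2)) \<in> borel_measurable (lebesgue_on \<Omega>)"
      using has_weak_grad_measurable[OF O some[OF g]] by (rule borel_measurable_times[OF borel_measurable_const])
    show "AE x in lebesgue_on \<Omega>. (norm (weak_grad \<Omega> (\<lambda>x. t * v x) x))\<^sup>2 + (t * v x)\<^sup>2
        = t\<^sup>2 * ((norm (weak_grad \<Omega> v x))\<^sup>2 + (v x)\<^sup>2)"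
      using weak_grad_scale_AE[OF O g, of t]
      by eventually_elim (simp add: power_mult_distrib distrib_left)
  qed
  then show ?thesis by (simp add: H1_norm_def real_sqrt_mult)
qed

section \<open>The function spaces\<close>

lemma Lspace_scale:
  fixes f :: "real^'n \<Rightarrow> 'b::{second_countable_topology, real_normed_vector}"
  assumes "f \<in> Lspace \<Omega> s"
  shows "(\<lambda>x. t *\<^sub>R f x) \<in> Lspace \<Omega> s"
  using assms
  by (auto simp: Lspace_def powr_mult intro: borel_measurable_scaleR[OF borel_measurable_const])

lemma Lnorm_scale:
  assumes "s > 0"
  shows "Lnorm \<Omega> s (\<lambda>x. t *\<^sub>R f x) = \<bar>t\<bar> * Lnorm \<Omega> s f"
proof -
  have "(LINT x|lebesgue_on \<Omega>. norm (f x) powr s) \<ge> 0" by (intro integral_nonneg_AE) auto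
  then show ?thesis using assms by (simp add: Lnorm_def powr_mult powr_powr)
qed

lemma test_function_Lspace:
  fixes f :: "real^'n \<Rightarrow> 'b::{second_countable_topology, real_normed_vector}"
  assumes O: "open \<Omega>" and s: "s > 0" and f: "continuous_on UNIV f"
    and K: "compact K" "K \<subseteq> \<Omega>" "\<And>x. x \<notin> K \<Longrightarrow> f x = 0"
  shows "f \<in> Lspace \<Omega> s"
proof -
  have "f \<in> borel_measurable lebesgue"
    using f by (intro measurable_completion) (auto intro: borel_measurable_continuous_onI)
  then have "f \<in> borel_measurable (lebesgue_on \<Omega>)" by (rule measurable_restrict_space1)
  moreover have "integrable (lebesgue_on \<Omega>) (\<lambda>x. norm (f x) powr s)"
  proof -
    have "continuous_on UNIV (\<lambda>x. norm (f x) powr s)"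
      using f s by (intro continuous_on_powr' continuous_intros) auto
    then have i: "integrable lborel (\<lambda>x. norm (f x) powr s)"
      by (rule compact_support_integrable[OF _ K(1)]) (simp add: K(3))
    then have "integrable lebesgue (\<lambda>x. norm (f x) powr s)"
      using integrable_completion borel_measurable_integrable[OF i] by blast
    moreover have "norm (f x) powr s = 0" if "x \<notin> \<Omega>" for x using that K(2,3) by auto
    ultimately show ?thesis using integral_lebesgue_on_support(2)[OF O] by metis
  qed
  ultimately show ?thesis by (simp add: Lspace_def)
qed

lemma Cc_subset_H1_0:
  fixes \<Omega> :: "(real^'n) set"
  assumes O: "open \<Omega>"
  shows "Cc_infinity \<Omega> \<subseteq> H1_0 \<Omega>"
proof
  fix \<phi> assume \<phi>: "\<phi> \<in> Cc_infinity \<Omega>"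
  obtain K where K: "compact K" "K \<subseteq> \<Omega>" "\<And>x. x \<notin> K \<Longrightarrow> \<phi> x = 0" "\<And>x i. x \<notin> K \<Longrightarrow> partial_deriv i \<phi> x = 0"
    "continuous_on UNIV \<phi>" "\<And>i. continuous_on UNIV (partial_deriv i \<phi>)"
    using Cc_infinityE[OF \<phi>] by metis
  have g: "has_weak_grad \<Omega> \<phi> (grad \<phi>)" by (rule has_weak_grad_Cc[OF O \<phi>])
  have "\<phi> \<in> Lspace \<Omega> 2" by (rule test_function_Lspace[OF O _ K(5,1,2,3)]) simp
  moreover have "grad \<phi> \<in> Lspace \<Omega> 2"
  proof (rule test_function_Lspace[OF O _ _ K(1,2)])
    show "continuous_on UNIV (grad \<phi>)"
      unfolding grad_def[abs_def] by (intro continuous_on_vec_lambda K)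
    show "grad \<phi> x = 0" if "x \<notin> K" for x using K(4)[OF that] by (simp add: grad_def vec_eq_iff)
  qed simp
  moreover have "H1_norm \<Omega> (\<lambda>x. \<phi> x - \<phi> x) = 0"
    using H1_norm_scale[OF O g, of 0] by simp
  ultimately show "\<phi> \<in> H1_0 \<Omega>"
    using \<phi> g by (auto simp: H1_0_def H1_def intro!: exI[of _ "\<lambda>_. \<phi>"])
qed

lemma H1_0_scale:
  fixes \<Omega> :: "(real^'n) set"
  assumes O: "open \<Omega>" and u: "u \<in> H1_0 \<Omega>"
  shows "(\<lambda>x. t * u x) \<in> H1_0 \<Omega>"
proof -
  obtain g \<phi> where g: "g \<in> Lspace \<Omega> 2" "has_weak_grad \<Omega> u g"
    and \<phi>: "\<And>n::nat. \<phi> n \<in> Cc_infinity \<Omega>" "(\<lambda>n. H1_norm \<Omega> (\<lambda>x. \<phi> n x - u x)) \<longlonglongrightarrow> 0"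
    and uL: "u \<in> Lspace \<Omega> 2"
    using u by (auto simp: H1_0_def H1_def)
  have gt: "has_weak_grad \<Omega> (\<lambda>x. t * u x) (\<lambda>x. t *\<^sub>R g x)"
    using has_weak_grad_lincomb[OF O g(2) g(2), of t 0] by simp
  have "H1_norm \<Omega> (\<lambda>x. t * \<phi> n x - t * u x) = \<bar>t\<bar> * H1_norm \<Omega> (\<lambda>x. \<phi> n x - u x)" for n
    using H1_norm_scale[OF O has_weak_grad_lincomb[OF O has_weak_grad_Cc[OF O \<phi>(1)[of n]] g(2), of 1 "-1"], of t]
    by (simp add: right_diff_distrib)
  then have "(\<lambda>n. H1_norm \<Omega> (\<lambda>x. t * \<phi> n x - t * u x)) \<longlonglongrightarrow> 0"
    using tendsto_mult_right_zero[OF \<phi>(2), of "\<bar>t\<bar>"] by simp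
  then show ?thesis
    using Lspace_scale[OF uL, of t] Lspace_scale[OF g(1), of t] gt \<phi>(1)
    by (auto simp: H1_0_def H1_def intro!: exI[of _ "\<lambda>n x. t * \<phi> n x"] Cc_infinity_cmult)
qed

lemma Cc_subset_D12_0:
  fixes \<Omega> :: "(real^'n) set"
  assumes O: "open \<Omega>" and N: "CARD('n) \<ge> 3"
  shows "Cc_infinity \<Omega> \<subseteq> D12_0 \<Omega>"
proof
  fix \<phi> assume \<phi>: "\<phi> \<in> Cc_infinity \<Omega>"
  obtain K where K: "compact K" "K \<subseteq> \<Omega>" "\<And>x. x \<notin> K \<Longrightarrow> \<phi> x = 0" "continuous_on UNIV \<phi>"
    using Cc_infinityE[OF \<phi>] by metis
  have s: "crit_exp TYPE('n) > 0" using N by (simp add: crit_exp_def)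
  have "grad (\<lambda>x. \<phi> x - \<phi> x) = (\<lambda>x. 0)"
    by (auto simp: grad_def partial_deriv_def fun_eq_iff vec_eq_iff)
  then have "Lnorm \<Omega> 2 (grad (\<lambda>x. \<phi> x - \<phi> x)) = 0" by (simp add: Lnorm_def)
  moreover have "Lnorm \<Omega> (crit_exp TYPE('n)) (\<lambda>x. \<phi> x - \<phi> x) = 0" using s by (simp add: Lnorm_def)
  ultimately show "\<phi> \<in> D12_0 \<Omega>"
    using \<phi> test_function_Lspace[OF O s K(4,1,2,3)]
    by (auto simp: D12_0_def intro!: exI[of _ "\<lambda>_. \<phi>"])
qed

lemma D12_0_scale:
  fixes \<Omega> :: "(real^'n) set"
  assumes N: "CARD('n) \<ge> 3" and u: "u \<in> D12_0 \<Omega>"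
  shows "(\<lambda>x. t * u x) \<in> D12_0 \<Omega>"
proof -
  obtain \<phi> where \<phi>: "\<And>n::nat. \<phi> n \<in> Cc_infinity \<Omega>"
    and cauchy: "\<And>\<epsilon>. \<epsilon> > 0 \<Longrightarrow> \<exists>M. \<forall>m\<ge>M. \<forall>n\<ge>M. Lnorm \<Omega> 2 (grad (\<lambda>x. \<phi> m x - \<phi> n x)) < \<epsilon>"
    and lim: "(\<lambda>n. Lnorm \<Omega> (crit_exp TYPE('n)) (\<lambda>x. \<phi> n x - u x)) \<longlonglongrightarrow> 0"
    and uL: "u \<in> Lspace \<Omega> (crit_exp TYPE('n))"
    using u unfolding D12_0_def by blast
  have s: "crit_exp TYPE('n) > 0" using N by (simp add: crit_exp_def)
  have d: "\<phi> n differentiable (at x)" for n x using Cc_infinityE[OF \<phi>] by metis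
  have "grad (\<lambda>x. t * \<phi> m x - t * \<phi> n x) = (\<lambda>x. t *\<^sub>R grad (\<lambda>x. \<phi> m x - \<phi> n x) x)" for m n
    using partial_deriv_cmult[OF differentiable_diff[OF d[of m] d[of n]], where c = t]
    by (simp add: grad_def fun_eq_iff vec_eq_iff right_diff_distrib)
  then have G: "Lnorm \<Omega> 2 (grad (\<lambda>x. t * \<phi> m x - t * \<phi> n x)) = \<bar>t\<bar> * Lnorm \<Omega> 2 (grad (\<lambda>x. \<phi> m x - \<phi> n x))" for m n
    by (simp add: Lnorm_scale)
  have "\<exists>M. \<forall>m\<ge>M. \<forall>n\<ge>M. Lnorm \<Omega> 2 (grad (\<lambda>x. t * \<phi> m x - t * \<phi> n x)) < \<epsilon>" if \<epsilon>0: "\<epsilon> > 0" for \<epsilon>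
  proof -
    obtain M where M: "\<And>m n. m \<ge> M \<Longrightarrow> n \<ge> M \<Longrightarrow> Lnorm \<Omega> 2 (grad (\<lambda>x. \<phi> m x - \<phi> n x)) < \<epsilon> / (\<bar>t\<bar> + 1)"
    proof -
      have "\<epsilon> / (\<bar>t\<bar> + 1) > 0" using \<epsilon>0 by (intro divide_pos_pos) auto
      from cauchy[OF this] show ?thesis using that by blast
    qed
    have "Lnorm \<Omega> 2 (grad (\<lambda>x. t * \<phi> m x - t * \<phi> n x)) < \<epsilon>" if mn: "m \<ge> M" "n \<ge> M" for m n
    proof -
      have "\<bar>t\<bar> * Lnorm \<Omega> 2 (grad (\<lambda>x. \<phi> m x - \<phi> n x)) \<le> \<bar>t\<bar> * (\<epsilon> / (\<bar>t\<bar> + 1))"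
        using M[OF mn] by (intro mult_left_mono) auto
      also have "\<dots> < \<epsilon>" using \<epsilon>0 by (simp add: field_simps)
      finally show ?thesis by (simp add: G)
    qed
    then show ?thesis by blast
  qed
  moreover have "(\<lambda>n. Lnorm \<Omega> (crit_exp TYPE('n)) (\<lambda>x. t * \<phi> n x - t * u x)) \<longlonglongrightarrow> 0"
  proof -
    have "Lnorm \<Omega> (crit_exp TYPE('n)) (\<lambda>x. t * \<phi> n x - t * u x)
        = \<bar>t\<bar> * Lnorm \<Omega> (crit_exp TYPE('n)) (\<lambda>x. \<phi> n x - u x)" for n
      using Lnorm_scale[OF s, of \<Omega> t "\<lambda>x. \<phi> n x - u x"] by (simp add: right_diff_distrib)
    then show ?thesis using tendsto_mult_right_zero[OF lim, of "\<bar>t\<bar>"] by simp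
  qed
  ultimately show ?thesis
    using Lspace_scale[OF uL, of t] \<phi> unfolding D12_0_def
    by (auto intro!: exI[of _ "\<lambda>n x. t * \<phi> n x"] Cc_infinity_cmult)
qed

text \<open>
  The bumps sit on consecutive cubes along the diagonal of a small cube around a point of \<open>\<Omega>\<close>.
\<close>

lemma disjoint_test_functions:
  fixes \<Omega> :: "(real^'n) set"
  assumes O: "open \<Omega>" and ne: "\<Omega> \<noteq> {}"
  shows "\<exists>\<psi>. (\<forall>k\<in>{1..q}. \<psi> k \<in> Cc_infinity \<Omega> \<and> \<not> zero_on \<Omega> (\<psi> k)) \<and>
    (\<forall>k\<in>{1..q::nat}. \<forall>m\<in>{1..q}. k \<noteq> m \<longrightarrow> interaction \<Omega> p (\<psi> k) (\<psi> m) = 0)"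
proof -
  obtain x0 where "x0 \<in> \<Omega>" using ne by blast
  then obtain e where e: "e > 0" "cball x0 e \<subseteq> \<Omega>" using O open_contains_cball by blast
  (* The Euclidean norm is estimated by the sum of the coordinates, which accounts for the dimension. *)
  define d where "d = e / (real (Suc q) * real CARD('n))"
  have d: "d > 0" using e by (simp add: d_def)
  define a :: "nat \<Rightarrow> real^'n" where "a k = (\<chi> i. x0 $ i + real k * d)" for k
  have sub: "cbox (a (k - 1)) (a k) \<subseteq> \<Omega>" if k: "k \<in> {1..q}" for k
  proof
    fix y assume y: "y \<in> cbox (a (k - 1)) (a k)"
    have "norm (y - x0) \<le> (\<Sum>i\<in>UNIV. \<bar>(y - x0) $ i\<bar>)" by (rule norm_le_l1_cart)
    also have "\<dots> \<le> (\<Sum>i\<in>(UNIV::'n set). real (Suc q) * d)"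
    proof (rule sum_mono)
      fix i
      have "x0 $ i + real (k - 1) * d \<le> y $ i" "y $ i \<le> x0 $ i + real k * d"
        using y by (auto simp: mem_box_cart a_def)
      moreover have "real (k - 1) * d \<ge> 0" "real k * d \<le> real (Suc q) * d"
        using d k by (auto intro!: mult_right_mono)
      ultimately show "\<bar>(y - x0) $ i\<bar> \<le> real (Suc q) * d" by simp
    qed
    also have "\<dots> = e" by (simp add: d_def del: of_nat_Suc)
    finally show "y \<in> \<Omega>" using e(2) by (auto simp: dist_norm norm_minus_commute)
  qed
  define \<psi> where "\<psi> k = bump 1 (a (k - 1)) (a k)" for k
  have disj: "\<psi> k x = 0 \<or> \<psi> m x = 0" if km: "k < m" for k m x
  proof (rule ccontr)
    assume "\<not> ?thesis"
    then have "x \<in> box (a (k - 1)) (a k)" "x \<in> box (a (m - 1)) (a m)"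
      using bump_zero[of 1 x] by (auto simp: \<psi>_def)
    then have "x $ undefined < x0 $ undefined + real k * d"
      "x0 $ undefined + real (m - 1) * d < x $ undefined"
      by (auto simp: mem_box_cart a_def)
    then have "real (m - 1) * d < real k * d" by linarith
    then show False using d km by auto
  qed
  have int0: "interaction \<Omega> p (\<psi> k) (\<psi> m) = 0" if "k \<noteq> m" for k m
  proof -
    have "\<psi> k x = 0 \<or> \<psi> m x = 0" for x
      using disj[of k m x] disj[of m k x] that by (cases "k < m") auto
    then have "\<bar>\<psi> k x\<bar> powr p * \<bar>\<psi> m x\<bar> powr p = 0" for x
      using powr_0 abs_zero mult_zero_left mult_zero_right by metis
    then show ?thesis by (simp only: interaction_def Bochner_Integration.integral_zero)
  qed
  have nz: "\<not> zero_on \<Omega> (\<psi> k)" if k: "k \<in> {1..q}" for k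
  proof
    assume "zero_on \<Omega> (\<psi> k)"
    then have "AE x in lebesgue. x \<in> \<Omega> \<longrightarrow> \<psi> k x = 0"
      using O by (simp add: zero_on_def AE_restrict_space_iff)
    then have "AE x in lebesgue. x \<notin> box (a (k - 1)) (a k)"
    proof eventually_elim
      case (elim x)
      show ?case
        using elim bump_pos[of 1 x "a (k - 1)" "a k"] sub[OF k] box_subset_cbox[of "a (k - 1)" "a k"]
        by (auto simp: \<psi>_def)
    qed
    then have "negligible (box (a (k - 1)) (a k))"
      by (simp add: negligible_iff_null_sets AE_iff_null_sets)
    moreover have "box (a (k - 1)) (a k) \<noteq> {}"
      using k d by (auto simp: interval_ne_empty_cart a_def)
    ultimately show False using open_not_negligible open_box by blast
  qed
  have "\<psi> k \<in> Cc_infinity \<Omega>" if "k \<in> {1..q}" for k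
    unfolding \<psi>_def by (rule bump_Cc[OF _ sub[OF that]]) simp
  then show ?thesis using int0 nz by blast
qed

section \<open>Least energy solutions are fully nontrivial\<close>

theorem theorem1p2:
  fixes \<Omega> :: "(real^'n) set"
    and H :: "(real^'n \<Rightarrow> real) set"
    and nrm :: "(real^'n \<Rightarrow> real) \<Rightarrow> real"
    and p :: real and l q :: nat and lam :: "nat \<Rightarrow> real"
  assumes "CARD('n) \<ge> 3" and "l \<ge> 2" and "1 < p" and "p \<le> 2" and "1 \<le> q" and "q \<le> l"
    and "open \<Omega>" and "\<Omega> \<noteq> {}"
    and "H = H1_0 \<Omega> \<and> nrm = H1_norm \<Omega> \<or> H = D12_0 \<Omega> \<and> nrm = D12_norm \<Omega>"
    and "cont_embedded_L \<Omega> H nrm (2 * p)"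
    and "\<forall>i\<in>{1..l}. well_defined_coercive \<Omega> H nrm (lam i)"
  shows "\<exists>C>0. \<forall>\<beta> L. block_decomposition l q L \<beta> \<and>
            (p < 2 \<and> condition1 C l q p \<beta> L \<or> p = 2 \<and> condition2 C l q lam \<beta> L) \<longrightarrow>
            (\<forall>u. least_energy_solution \<Omega> H l q p lam \<beta> L u \<longrightarrow> fully_nontrivial \<Omega> l u)"
proof -
  have Cc: "Cc_infinity \<Omega> \<subseteq> H"
    using assms(9) Cc_subset_H1_0[OF assms(7)] Cc_subset_D12_0[OF assms(7,1)] by auto
  have scale: "(\<lambda>x. t * v x) \<in> H" if "v \<in> H" for v t
    using assms(9) H1_0_scale[OF assms(7)] D12_0_scale[OF assms(1)] that by auto
  have HL: "v \<in> Lspace \<Omega> (2 * p)" if "v \<in> H" for v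
    using assms(10) that by (auto simp: cont_embedded_L_def)
  have nonneg: "norm_lam \<Omega> (lam i) v \<ge> 0"
    and eq0: "norm_lam \<Omega> (lam i) v = 0 \<longleftrightarrow> zero_on \<Omega> v"
    and hom: "norm_lam \<Omega> (lam i) (\<lambda>x. t * v x) = \<bar>t\<bar> * norm_lam \<Omega> (lam i) v"
    if "i \<in> {1..l}" "v \<in> H" for i v t
    using assms(11) that unfolding well_defined_coercive_def is_norm_on_def by blast+
  obtain C0 where C0: "\<And>v. v \<in> H \<Longrightarrow> Lnorm \<Omega> (2 * p) v \<le> C0 * nrm v"
    using assms(10) by (auto simp: cont_embedded_L_def)
  have "\<exists>A>0. \<forall>v\<in>H. A * nrm v \<le> norm_lam \<Omega> (lam i) v" if "i \<in> {1..l}" for i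
    using assms(11) that unfolding well_defined_coercive_def by blast
  then obtain A where A: "\<And>i. i \<in> {1..l} \<Longrightarrow> A i > 0"
    "\<And>i v. i \<in> {1..l} \<Longrightarrow> v \<in> H \<Longrightarrow> A i * nrm v \<le> norm_lam \<Omega> (lam i) v"
    by metis
  define a where "a = Min (A ` {1..l})"
  have l1: "{1..l} \<noteq> {}" using assms(2) by auto
  have a: "a > 0" "\<And>i. i \<in> {1..l} \<Longrightarrow> a \<le> A i"
    using A(1) l1 by (auto simp: a_def)
  (* The embedding constant comes without a sign, hence the absolute value. *)
  define D where "D = (\<bar>C0\<bar> + 1) / a"
  have D: "D > 0" using a by (simp add: D_def)
  have emb: "Lnorm \<Omega> (2 * p) v \<le> D * norm_lam \<Omega> (lam i) v" if i: "i \<in> {1..l}" and v: "v \<in> H" for i v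
  proof -
    have nn: "norm_lam \<Omega> (lam i) v \<ge> 0" using nonneg[OF i v] .
    have nv: "nrm v \<le> norm_lam \<Omega> (lam i) v / a"
    proof (cases "nrm v \<ge> 0")
      case True
      then have "a * nrm v \<le> A i * nrm v" using a(2)[OF i] by (rule mult_right_mono[rotated])
      with A(2)[OF i v] show ?thesis using a(1) by (simp add: field_simps)
    next
      case False
      then show ?thesis using nn a(1) by (smt (verit) divide_nonneg_pos)
    qed
    have "Lnorm \<Omega> (2 * p) v \<le> C0 * nrm v" by (rule C0[OF v])
    also have "\<dots> \<le> (\<bar>C0\<bar> + 1) * (norm_lam \<Omega> (lam i) v / a)"
    proof (cases "nrm v \<ge> 0")
      case True
      then show ?thesis using nv by (intro mult_mono) auto
    next
      case False
      have "nrm v \<ge> 0" using assms(9) by (auto simp: H1_norm_def D12_norm_def intro!: integral_nonneg_AE)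
      with False show ?thesis by simp
    qed
    finally show ?thesis by (simp add: D_def)
  qed
  define \<kappa> where "\<kappa> = D powr p"
  have \<kappa>: "\<kappa> > 0" using D by (simp add: \<kappa>_def)
  have embedding: "sqrt (interaction \<Omega> p v v) \<le> \<kappa> * norm_lam \<Omega> (lam i) v powr p"
    if i: "i \<in> {1..l}" and v: "v \<in> H" for i v
  proof -
    define I where "I = interaction \<Omega> p v v"
    have I: "I \<ge> 0" by (simp add: I_def interaction_nonneg)
    have "sqrt I = (I powr (1 / (2 * p))) powr p"
      using I assms(3) by (simp add: powr_powr powr_half_sqrt)
    also have "I powr (1 / (2 * p)) = Lnorm \<Omega> (2 * p) v"
      by (simp add: I_def interaction_self Lnorm_def)
    also have "Lnorm \<Omega> (2 * p) v powr p \<le> (D * norm_lam \<Omega> (lam i) v) powr p"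
      using emb[OF i v] assms(3) by (intro powr_mono2) (auto simp: Lnorm_def)
    also have "\<dots> = \<kappa> * norm_lam \<Omega> (lam i) v powr p"
      using D nonneg[OF i v] by (simp add: \<kappa>_def powr_mult)
    finally show ?thesis by (simp add: I_def)
  qed
  obtain \<psi> where \<psi>: "\<And>k. k \<in> {1..q} \<Longrightarrow> \<psi> k \<in> Cc_infinity \<Omega>" "\<And>k. k \<in> {1..q} \<Longrightarrow> \<not> zero_on \<Omega> (\<psi> k)"
    "\<And>k m. k \<in> {1..q} \<Longrightarrow> m \<in> {1..q} \<Longrightarrow> k \<noteq> m \<Longrightarrow> interaction \<Omega> p (\<psi> k) (\<psi> m) = 0"
    using disjoint_test_functions[OF assms(7,8), of q p] by blast
  have \<psi>H: "\<psi> k \<in> H" if "k \<in> {1..q}" for k using \<psi>(1)[OF that] Cc by blast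
  (* The constant of the energy bound; the summand 1 only guarantees positivity. *)
  define S where "S = 1 + (\<Sum>k=1..q. \<Sum>i=1..l. norm_lam \<Omega> (lam i) (\<psi> k) powr (2 * p / (p - 1)) /
            interaction \<Omega> p (\<psi> k) (\<psi> k) powr (1 / (p - 1)))"
  have S: "S > 0" unfolding S_def by (intro add_pos_nonneg sum_nonneg) auto
  define C where "C = 16 * (\<kappa> powr (p / (p - 1)) * S powr (p / 2))"
  show ?thesis
  proof (intro exI[of _ C] conjI allI impI)
    show "C > 0" using \<kappa> S by (simp add: C_def)
    fix \<beta> L u
    assume hyp: "block_decomposition l q L \<beta> \<and>
        (p < 2 \<and> condition1 C l q p \<beta> L \<or> p = 2 \<and> condition2 C l q lam \<beta> L)"
      and u: "least_energy_solution \<Omega> H l q p lam \<beta> L u"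
    interpret coupled_system \<Omega> H l q p lam \<beta> L \<kappa>
      using hyp assms(3) HL scale nonneg eq0 hom \<kappa> embedding by unfold_locales blast+
    note neh = least_energy_nehari(1)[OF u]
    note min = least_energy_nehari(2)[OF u]
    have \<mu>: "minmax_diag q L \<beta> > 0"
      by (rule energy_bound(1)[where \<psi> = \<psi>, OF neh min \<psi>H \<psi>(2,3) assms(5)])
    have "(\<Sum>h=1..q. block_sq u h) \<le> (S - 1) * minmax_diag q L \<beta> powr (- 1 / (p - 1))"
      unfolding S_def add_diff_cancel_left'
      by (rule energy_bound(2)[where \<psi> = \<psi>, OF neh min \<psi>H \<psi>(2,3) assms(5)])
    also have "\<dots> \<le> S * minmax_diag q L \<beta> powr (- 1 / (p - 1))"
      by (intro mult_right_mono) auto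
    finally have bound: "(\<Sum>h=1..q. block_sq u h) \<le> S * minmax_diag q L \<beta> powr (- 1 / (p - 1))" .
    have "fully_nontrivial \<Omega> l u" if "p < 2" "condition1 C l q p \<beta> L"
      by (rule fully_nontrivial_subcritical[OF neh min bound S \<mu> that(1) that(2)[unfolded C_def]])
    moreover have "fully_nontrivial \<Omega> l u" if "p = 2" "condition2 C l q lam \<beta> L"
      by (rule fully_nontrivial_quadratic[OF neh min bound S \<mu> that(1) that(2)[unfolded C_def]])
    ultimately show "fully_nontrivial \<Omega> l u" using hyp by blast
  qed
qed

end
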